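(* Let $T_1, T_2$ be locally finite trees, each with a cocompact automorphism group, and let $\Gamma \leq \mathrm{Aut}(T_1) \times \mathrm{Aut}(T_2)$ be a cocompact lattice. Let $(x_1, x_2) \in V(T_1) \times V(T_2)$ be a vertex, and let $\Gamma_1 = \Gamma_{x_1}$ and $\Gamma_2 = \Gamma_{x_2}$ be the respective stabilizers in $\Gamma$ of $x_1$ and $x_2$. Let $\gamma_1 \in \Gamma_1$ and $\gamma_2 \in \Gamma_2$, and let $\varphi \colon \Gamma \to G$ be a homomorphism to a group $G$ satisfying the following conditions: (i) $\varphi(\gamma_1)$ and $\varphi(\gamma_2)$ do not commute. (ii) For $i=1,2$, the order of $\varphi(\gamma_i)$ is finite, and relatively prime to the order of the local action of $\Gamma$ at every vertex of $T_i$. Then $T_1 \times T_2$ contains an anti-torus spanned by powers of $\gamma_1$ and $\gamma_2$. In particular $\Gamma$ is irreducible, and $\gamma_i$ acts as an automorphism of infinite order on $T_i$ for $i=1,2$.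
   Context: The group $\Gamma$ acts on each $T_i$ through the projection $\mathrm{Aut}(T_1)\times\mathrm{Aut}(T_2) \to \mathrm{Aut}(T_i)$; $\Gamma_{x_i}$ is the set of elements of $\Gamma$ whose projection to $\mathrm{Aut}(T_i)$ fixes the vertex $x_i$ of $T_i$. The product $T_1\times T_2$ is a CAT(0) square complex on which $\Gamma$ acts properly and cocompactly. Local action: given a group $G$ acting on a tree $T$, the local action of $G$ at a vertex $v\in V(T)$ is the permutation group formed by the action of the stabilizer $G_v$ on the set of edges emanating from $v$ (a finite group if $T$ is locally finite). Anti-torus: let $X$ be a CAT(0) space and $\Gamma$ a group acting properly and cocompactly on $X$ by isometries. A flat $P$ in $X$ is periodic if its stabilizer in $\Gamma$ acts cocompactly on $P$. An anti-torus is a $2$-dimensional flat $P$ which is the convex hull of two non-parallel geodesic lines that are translation axes for two hyperbolic isometries $\gamma_1,\gamma_2\in\Gamma$, and such that the stabilizer of $P$ in $\Gamma$ does not act cocompactly on $P$. One then says that the anti-torus $P$ is spanned by $\gamma_1$ and $\gamma_2$. Irreducible (usual meaning): $\Gamma$ has no finite index subgroup of the form $\Lambda_1\times\Lambda_2$ with $\Lambda_i\le \mathrm{Aut}(T_i)$. *)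

theory Defs
  imports "HOL-Analysis.Analysis" "HOL-Algebra.Bij" "HOL-Algebra.Multiplicative_Group"
begin

section \<open>Trees\<close>

text \<open>
  Simple undirected graphs: an edge is a two-element set of vertices. (The notion of tree in the
  AFP entry Graph-Theory forbids directed cycles only, hence is not the one needed here.)
\<close>

record 'v ugraph =
  verts :: "'v set"
  edges :: "'v set set"

definition simple_graph :: "'v ugraph \<Rightarrow> bool" where
  "simple_graph T \<longleftrightarrow> (\<forall>e\<in>edges T. \<exists>u\<in>verts T. \<exists>v\<in>verts T. u \<noteq> v \<and> e = {u, v})"

definition gwalk :: "'v ugraph \<Rightarrow> 'v list \<Rightarrow> bool" where
  "gwalk T p \<longleftrightarrow> p \<noteq> [] \<and> set p \<subseteq> verts T \<and> successively (\<lambda>u v. {u, v} \<in> edges T) p"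

definition gconnected :: "'v ugraph \<Rightarrow> bool" where
  "gconnected T \<longleftrightarrow> verts T \<noteq> {} \<and>
     (\<forall>u\<in>verts T. \<forall>v\<in>verts T. \<exists>p. gwalk T p \<and> hd p = u \<and> last p = v)"

definition gcycle :: "'v ugraph \<Rightarrow> 'v list \<Rightarrow> bool" where
  "gcycle T p \<longleftrightarrow> gwalk T p \<and> length p \<ge> 4 \<and> hd p = last p \<and> distinct (tl p)"

definition tree :: "'v ugraph \<Rightarrow> bool" where
  "tree T \<longleftrightarrow> simple_graph T \<and> gconnected T \<and> (\<nexists>p. gcycle T p)"

definition edges_at :: "'v ugraph \<Rightarrow> 'v \<Rightarrow> 'v set set" where
  "edges_at T v = {e \<in> edges T. v \<in> e}"

definition locally_finite :: "'v ugraph \<Rightarrow> bool" where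
  "locally_finite T \<longleftrightarrow> (\<forall>v\<in>verts T. finite (edges_at T v))"

definition gdist :: "'v ugraph \<Rightarrow> 'v \<Rightarrow> 'v \<Rightarrow> nat" where
  "gdist T u v = (LEAST n. \<exists>p. gwalk T p \<and> hd p = u \<and> last p = v \<and> length p = Suc n)"

section \<open>Geometric realization\<close>

text \<open>
  A point is given by its barycentric coordinates; it lies on a vertex or on an edge.
\<close>

definition supp :: "('v \<Rightarrow> real) \<Rightarrow> 'v set" where
  "supp p = {v. p v \<noteq> 0}"

definition realization :: "'v ugraph \<Rightarrow> ('v \<Rightarrow> real) set" where
  "realization T = {p. (\<forall>v. 0 \<le> p v) \<and>
     (\<exists>c \<in> (\<lambda>v. {v}) ` verts T \<union> edges T. supp p \<subseteq> c \<and> (\<Sum>v\<in>c. p v) = 1)}"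

text \<open>
  The length metric for which every edge is isometric to the unit interval. The distance of a
  point \<open>p\<close> to an endpoint \<open>u\<close> of an edge containing it is \<open>1 - p u\<close>. Two
  points on a common edge have distance half the sum of the coordinate differences; otherwise a
  shortest path leaves \<open>p\<close> through some \<open>u\<close> in its support and reaches \<open>q\<close>
  through some \<open>v\<close> in its support. The value \<open>0\<close> outside the realization is a dummy
  making \<open>Metric_space\<close> applicable, which asks for nonnegativity and symmetry everywhere.
\<close>

definition rdist :: "'v ugraph \<Rightarrow> ('v \<Rightarrow> real) \<Rightarrow> ('v \<Rightarrow> real) \<Rightarrow> real" where
  "rdist T p q =
     (if p \<notin> realization T \<or> q \<notin> realization T then 0
      else if \<exists>e\<in>edges T. supp p \<union> supp q \<subseteq> e
      then (\<Sum>v\<in>supp p \<union> supp q. \<bar>p v - q v\<bar>) / 2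
      else Min ((\<lambda>(u, v). (1 - p u) + real (gdist T u v) + (1 - q v)) ` (supp p \<times> supp q)))"

section \<open>Automorphism groups\<close>

definition aut_group :: "'v ugraph \<Rightarrow> ('v \<Rightarrow> 'v) monoid" where
  "aut_group T = BijGroup (verts T)
     \<lparr>carrier := {g \<in> Bij (verts T).
        \<forall>u\<in>verts T. \<forall>v\<in>verts T. {g u, g v} \<in> edges T \<longleftrightarrow> {u, v} \<in> edges T}\<rparr>"

text \<open>The topology of pointwise convergence on vertices.\<close>

definition aut_topology :: "'v ugraph \<Rightarrow> ('v \<Rightarrow> 'v) topology" where
  "aut_topology T =
     subtopology (product_topology (\<lambda>_. discrete_topology (verts T)) (verts T))
       (carrier (aut_group T))"

text \<open>The affine extension of an automorphism to the realization: push-forward of coordinates.\<close>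

definition raction :: "'v ugraph \<Rightarrow> ('v \<Rightarrow> 'v) \<Rightarrow> ('v \<Rightarrow> real) \<Rightarrow> ('v \<Rightarrow> real)" where
  "raction T g p = (\<lambda>v. if v \<in> verts T then p (inv_into (verts T) g v) else 0)"

definition local_action :: "'v ugraph \<Rightarrow> ('v \<Rightarrow> 'v) set \<Rightarrow> 'v \<Rightarrow> ('v set \<Rightarrow> 'v set) monoid" where
  "local_action T H v = BijGroup (edges_at T v)
     \<lparr>carrier := (\<lambda>g. restrict (\<lambda>e. g ` e) (edges_at T v)) ` {g \<in> H. g v = v}\<rparr>"

section \<open>Lattices\<close>

definition cocompact_lattice :: "('g, 'm) monoid_scheme \<Rightarrow> 'g topology \<Rightarrow> 'g set \<Rightarrow> bool" where
  "cocompact_lattice G \<tau> \<Gamma> \<longleftrightarrow> subgroup \<Gamma> G \<and> subtopology \<tau> \<Gamma> = discrete_topology \<Gamma> \<and>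
     (\<exists>Q. quotient_map \<tau> Q (\<lambda>g. g <#\<^bsub>G\<^esub> \<Gamma>) \<and> compact_space Q)"

definition irreducible_lattice :: "'a ugraph \<Rightarrow> 'b ugraph \<Rightarrow> (('a \<Rightarrow> 'a) \<times> ('b \<Rightarrow> 'b)) set \<Rightarrow> bool" where
  "irreducible_lattice T1 T2 \<Gamma> \<longleftrightarrow>
     \<not> (\<exists>\<Lambda>1 \<Lambda>2. subgroup \<Lambda>1 (aut_group T1) \<and> subgroup \<Lambda>2 (aut_group T2) \<and>
          \<Lambda>1 \<times> \<Lambda>2 \<subseteq> \<Gamma> \<and>
          finite (rcosets\<^bsub>(aut_group T1 \<times>\<times> aut_group T2)\<lparr>carrier := \<Gamma>\<rparr>\<^esub> (\<Lambda>1 \<times> \<Lambda>2)))"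

section \<open>Metric geometry\<close>

text \<open>
  Below, \<open>X\<close> is the carrier and \<open>d\<close> the distance function of a metric space, and a
  group element \<open>g\<close> acts on \<open>X\<close> by \<open>act g\<close>.
\<close>

definition cocompact_action :: "'p set \<Rightarrow> ('p \<Rightarrow> 'p \<Rightarrow> real) \<Rightarrow> 'g set \<Rightarrow> ('g \<Rightarrow> 'p \<Rightarrow> 'p) \<Rightarrow> bool" where
  "cocompact_action X d H act \<longleftrightarrow>
     (\<exists>K. compactin (Metric_space.mtopology X d) K \<and> (\<Union>g\<in>H. act g ` K) = X)"

definition geodesic_line :: "'p set \<Rightarrow> ('p \<Rightarrow> 'p \<Rightarrow> real) \<Rightarrow> (real \<Rightarrow> 'p) \<Rightarrow> bool" where
  "geodesic_line X d c \<longleftrightarrow> range c \<subseteq> X \<and> (\<forall>s t. d (c s) (c t) = \<bar>s - t\<bar>)"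

definition geodesic_segment :: "'p set \<Rightarrow> ('p \<Rightarrow> 'p \<Rightarrow> real) \<Rightarrow> real \<Rightarrow> (real \<Rightarrow> 'p) \<Rightarrow> bool" where
  "geodesic_segment X d l c \<longleftrightarrow> 0 \<le> l \<and> c ` {0..l} \<subseteq> X \<and>
     (\<forall>s\<in>{0..l}. \<forall>t\<in>{0..l}. d (c s) (c t) = \<bar>s - t\<bar>)"

definition geodesically_convex :: "'p set \<Rightarrow> ('p \<Rightarrow> 'p \<Rightarrow> real) \<Rightarrow> 'p set \<Rightarrow> bool" where
  "geodesically_convex X d C \<longleftrightarrow> C \<subseteq> X \<and>
     (\<forall>l c. geodesic_segment X d l c \<and> c 0 \<in> C \<and> c l \<in> C \<longrightarrow> c ` {0..l} \<subseteq> C)"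

definition geodesic_hull :: "'p set \<Rightarrow> ('p \<Rightarrow> 'p \<Rightarrow> real) \<Rightarrow> 'p set \<Rightarrow> 'p set" where
  "geodesic_hull X d S = \<Inter> {C. geodesically_convex X d C \<and> S \<subseteq> C}"

text \<open>The distance on \<^typ>\<open>real \<times> real\<close> is the Euclidean one.\<close>

definition flat2 :: "'p set \<Rightarrow> ('p \<Rightarrow> 'p \<Rightarrow> real) \<Rightarrow> 'p set \<Rightarrow> bool" where
  "flat2 X d P \<longleftrightarrow> P \<subseteq> X \<and>
     (\<exists>f :: real \<times> real \<Rightarrow> 'p. range f = P \<and> (\<forall>x y. d (f x) (f y) = dist x y))"

text \<open>Lines are parallel when they are at finite Hausdorff distance.\<close>

definition parallel_lines :: "('p \<Rightarrow> 'p \<Rightarrow> real) \<Rightarrow> 'p set \<Rightarrow> 'p set \<Rightarrow> bool" where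
  "parallel_lines d L L' \<longleftrightarrow>
     (\<exists>K. (\<forall>x\<in>L. \<exists>y\<in>L'. d x y \<le> K) \<and> (\<forall>y\<in>L'. \<exists>x\<in>L. d x y \<le> K))"

definition hyperbolic_isometry :: "'p set \<Rightarrow> ('p \<Rightarrow> 'p \<Rightarrow> real) \<Rightarrow> ('p \<Rightarrow> 'p) \<Rightarrow> bool" where
  "hyperbolic_isometry X d f \<longleftrightarrow>
     bij_betw f X X \<and> (\<forall>x\<in>X. \<forall>y\<in>X. d (f x) (f y) = d x y) \<and>
     (\<exists>x\<in>X. 0 < d x (f x) \<and> (\<forall>y\<in>X. d x (f x) \<le> d y (f y)))"

definition translation_axis :: "'p set \<Rightarrow> ('p \<Rightarrow> 'p \<Rightarrow> real) \<Rightarrow> ('p \<Rightarrow> 'p) \<Rightarrow> 'p set \<Rightarrow> bool" where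
  "translation_axis X d f L \<longleftrightarrow>
     (\<exists>c a. geodesic_line X d c \<and> L = range c \<and> 0 < a \<and> (\<forall>t. f (c t) = c (t + a)))"

definition anti_torus ::
  "'p set \<Rightarrow> ('p \<Rightarrow> 'p \<Rightarrow> real) \<Rightarrow> 'g set \<Rightarrow> ('g \<Rightarrow> 'p \<Rightarrow> 'p) \<Rightarrow> 'g \<Rightarrow> 'g \<Rightarrow> 'p set \<Rightarrow> bool" where
  "anti_torus X d \<Gamma> act g1 g2 P \<longleftrightarrow>
     flat2 X d P \<and> g1 \<in> \<Gamma> \<and> g2 \<in> \<Gamma> \<and>
     hyperbolic_isometry X d (act g1) \<and> hyperbolic_isometry X d (act g2) \<and>
     (\<exists>L1 L2. translation_axis X d (act g1) L1 \<and> translation_axis X d (act g2) L2 \<and>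
        \<not> parallel_lines d L1 L2 \<and> P = geodesic_hull X d (L1 \<union> L2)) \<and>
     \<not> cocompact_action P d {g \<in> \<Gamma>. act g ` P = P} act"

definition product_action ::
  "'a ugraph \<Rightarrow> 'b ugraph \<Rightarrow> ('a \<Rightarrow> 'a) \<times> ('b \<Rightarrow> 'b)
     \<Rightarrow> ('a \<Rightarrow> real) \<times> ('b \<Rightarrow> real) \<Rightarrow> ('a \<Rightarrow> real) \<times> ('b \<Rightarrow> real)" where
  "product_action T1 T2 g = map_prod (raction T1 (fst g)) (raction T2 (snd g))"

end

theory Submission
  imports Defs
begin

text \<open>
  Write \<open>q\<^sub>i\<close> for the order of \<open>\<phi> \<gamma>\<^sub>i\<close>. Since \<open>\<gamma>\<^sub>1\<close> fixes a vertex of the first tree and the local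
  actions have order prime to \<open>q\<^sub>1\<close>, some power of \<open>\<gamma>\<^sub>1\<close> with exponent congruent to 1 modulo \<open>q\<^sub>1\<close> fixes any
  given finite set of vertices of that tree; moreover, if any positive power of \<open>\<gamma>\<^sub>1\<close> fixes a set of
  vertices, finite or not, then so does one with exponent congruent to 1. If positive powers of
  \<open>\<gamma>\<^sub>1\<close> and \<open>\<gamma>\<^sub>2\<close> commuted, then such a power of \<open>\<gamma>\<^sub>1\<close> would fix the \<open>\<gamma>\<^sub>2\<close>-orbit of any finite set
  of vertices, and vice versa. These two powers would then have a commutator fixing as many vertices as desired,
  hence commute by discreteness; but \<open>\<phi>\<close> maps them to \<open>\<phi> \<gamma>\<^sub>1\<close> and \<open>\<phi> \<gamma>\<^sub>2\<close>, a contradiction.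

  So no positive powers commute. It follows that \<open>\<gamma>\<^sub>i\<close> has infinite order on the \<open>i\<close>-th tree and is
  hyperbolic on the other one, and the two axes span a flat. If the stabilizer of the flat acted
  cocompactly, the pigeonhole principle would give commuting elements translating one axis each and
  fixing the other, and these would have powers in common with \<open>\<gamma>\<^sub>1\<close> and \<open>\<gamma>\<^sub>2\<close>.
\<close>

section \<open>Non-backtracking walks and distances in trees\<close>

text \<open>The projections of the lattice to the two factors need not be discrete, so equality of
  two elements is tested on finite vertex sets \<open>F1\<close> and \<open>F2\<close>, one in each
  tree. To see that a power \<alpha> of \<open>\<gamma>1\<close> and a power \<beta> of
  \<open>\<gamma>2\<close> commute on \<open>F1\<close>, it is enough that \<alpha> fixes
  \<open>F1\<close> and \<beta> \<open>F1\<close>; on \<open>F2\<close>, that \<beta> fixes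
  \<open>F2\<close> and \<alpha> \<open>F2\<close>. Each exponent then seems to depend on the other.
  Fixing whole orbits removes this circularity at the price of infinite sets, and this is where a
  given pair of commuting powers enters: it reduces an orbit to finitely many vertices. The same
  test sets, with local finiteness, show that a vertex of the first tree and a vertex of the second
  have a finite common stabilizer. Hence elements \<open>g\<close> and \<open>h\<close> for which
  all \<open>g^t h^-t\<close> lie in such a stabilizer have a common power. This one pigeonhole
  argument is behind hyperbolicity, the powers shared with the translations of the flat, the
  commutation of those translations, and irreducibility.\<close>

fun nonbacktracking :: "'v list \<Rightarrow> bool" where
  "nonbacktracking (x # y # z # xs) \<longleftrightarrow> x \<noteq> z \<and> nonbacktracking (y # z # xs)"
| "nonbacktracking _ \<longleftrightarrow> True"

lemma not_nonbacktrackingE: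
  assumes "\<not> nonbacktracking p"
  obtains xs x y zs where "p = xs @ x # y # x # zs"
proof -
  have "\<not> nonbacktracking p \<Longrightarrow> \<exists>xs x y zs. p = xs @ x # y # x # zs"
  proof (induction p rule: nonbacktracking.induct)
    case (1 x y z xs)
    show ?case
    proof (cases "x = z")
      case True
      then show ?thesis by (metis append_Nil)
    next
      case False
      with 1 obtain as a b bs where "y # z # xs = as @ a # b # a # bs" by auto
      then show ?thesis by (metis append_Cons)
    qed
  qed auto
  then show ?thesis using that assms by blast
qed

text \<open>Three consecutive vertices decide the condition, so the two walks have to overlap in two
  vertices \<open>a\<close>, \<open>b\<close> to be glued.\<close>

lemma nonbacktracking_append:
  "nonbacktracking (xs @ [a, b]) \<Longrightarrow> nonbacktracking (a # b # ys) \<Longrightarrow> nonbacktracking (xs @ a # b # ys)"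
proof (induction xs)
  case (Cons x xs)
  then show ?case by (cases xs; cases "tl xs") auto
qed simp

lemma nonbacktracking_rev [simp]: "nonbacktracking (rev p) \<longleftrightarrow> nonbacktracking p"
proof -
  have "nonbacktracking p" if "nonbacktracking (rev p)" for p :: "'v list"
  proof (rule ccontr)
    assume "\<not> nonbacktracking p"
    then obtain xs x y zs where "p = xs @ x # y # x # zs" by (rule not_nonbacktrackingE)
    then have "rev p = rev zs @ x # y # x # rev xs" by simp
    moreover have "\<not> nonbacktracking (as @ x # y # x # bs)" for as bs
    proof (induction as)
      case (Cons a as)
      then show ?case by (cases as; cases "tl as") auto
    qed simp
    ultimately show False using that by simp
  qed
  from this[of p] this[of "rev p"] show ?thesis by auto
qed

lemma nonbacktracking_Cons: "nonbacktracking (x # p) \<Longrightarrow> nonbacktracking p"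
  by (cases p rule: nonbacktracking.cases) auto

lemma nonbacktracking_nth: "nonbacktracking p \<Longrightarrow> i + 2 < length p \<Longrightarrow> p ! i \<noteq> p ! (i + 2)"
proof (induction p arbitrary: i)
  case (Cons x p)
  show ?case
  proof (cases i)
    case 0
    with Cons.prems obtain y z zs where "p = y # z # zs"
      by (cases p; cases "tl p") auto
    then show ?thesis using 0 Cons.prems by auto
  next
    case (Suc j)
    then show ?thesis using Cons nonbacktracking_Cons by fastforce
  qed
qed simp

lemma nonbacktracking_butlast: "nonbacktracking p \<Longrightarrow> nonbacktracking (butlast p)"
  by (metis nonbacktracking_rev nonbacktracking_Cons butlast_rev list.exhaust_sel rev_rev_ident tl_Nil)

lemma gwalk_rev: "gwalk T p \<Longrightarrow> gwalk T (rev p)"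
  unfolding gwalk_def by (auto simp: insert_commute)

lemma gwalk_append:
  "gwalk T p \<Longrightarrow> gwalk T q \<Longrightarrow> {last p, hd q} \<in> edges T \<Longrightarrow> gwalk T (p @ q)"
  unfolding gwalk_def by (auto simp: successively_append_iff)

lemma gwalk_appendD1: "gwalk T (p @ q) \<Longrightarrow> p \<noteq> [] \<Longrightarrow> gwalk T p"
  and gwalk_appendD2: "gwalk T (p @ q) \<Longrightarrow> q \<noteq> [] \<Longrightarrow> gwalk T q"
  unfolding gwalk_def by (auto simp: successively_append_iff)

lemma gdist_le: "gwalk T p \<Longrightarrow> gdist T (hd p) (last p) \<le> length p - 1"
  unfolding gdist_def
  by (rule Least_le) (auto intro!: exI[of _ p] simp: gwalk_def)

locale graph_tree =
  fixes T :: "'v ugraph"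
  assumes tree: "tree T"
begin

abbreviation "V \<equiv> verts T"
abbreviation "E \<equiv> edges T"
abbreviation "d \<equiv> gdist T"

lemma edge_verts: assumes "{u, v} \<in> E" shows "u \<in> V" "v \<in> V" "u \<noteq> v"
proof -
  obtain x y where "x \<in> V" "y \<in> V" "x \<noteq> y" "{u, v} = {x, y}"
    using tree assms unfolding tree_def simple_graph_def by meson
  then show "u \<in> V" "v \<in> V" "u \<noteq> v" by (auto simp: doubleton_eq_iff)
qed

lemma edgeE: assumes "e \<in> E" obtains u v where "e = {u, v}"
  using tree assms unfolding tree_def simple_graph_def by meson

text \<open>A return to the head \<open>x\<close> would close a cycle: the later vertices are
  distinct by induction, a return after one step would be a loop, and a return after two steps a
  backtrack. \<open>gcycle\<close> counts list entries, so three edges correspond to length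
  4.\<close>

lemma nonbacktracking_imp_distinct: "gwalk T p \<Longrightarrow> nonbacktracking p \<Longrightarrow> distinct p"
proof (induction p)
  case (Cons x p)
  show ?case
  proof (cases "p = []")
    case False
    have wp: "gwalk T p" using gwalk_appendD2[of T "[x]" p] Cons.prems False by simp
    then have dp: "distinct p" using Cons.IH nonbacktracking_Cons[OF Cons.prems(2)] by simp
    have "x \<notin> set p"
    proof
      assume "x \<in> set p"
      then obtain ys zs where p: "p = ys @ x # zs" by (meson split_list)
      have w: "gwalk T (x # ys @ [x])"
        using gwalk_appendD1[of T "x # ys @ [x]" zs] Cons.prems(1) p by simp
      have "ys \<noteq> []" using w edge_verts(3)[of x x] by (auto simp: gwalk_def)
      moreover have "length ys \<noteq> 1"
      proof
        assume "length ys = 1"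
        then obtain y where "ys = [y]" by (metis One_nat_def length_0_conv length_Suc_conv)
        then show False using Cons.prems(2) p by simp
      qed
      ultimately have "length ys \<ge> 2" by (cases ys; cases "tl ys") auto
      then have "gcycle T (x # ys @ [x])"
        unfolding gcycle_def using w dp p by auto
      then show False using tree unfolding tree_def by blast
    qed
    then show ?thesis using dp by simp
  qed simp
qed simp

text \<open>If the second vertices differ, walking back along \<open>q\<close> and then forth along
  \<open>p\<close> does not backtrack at the common start. The result would have distinct vertices,
  yet its two ends coincide.\<close>

lemma nonbacktracking_walk_unique:
  "gwalk T p \<Longrightarrow> nonbacktracking p \<Longrightarrow> gwalk T q \<Longrightarrow> nonbacktracking q \<Longrightarrow> hd p = hd q \<Longrightarrow> last p = last q \<Longrightarrow> p = q"
proof (induction p arbitrary: q)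
  case (Cons u p)
  then obtain q' where q: "q = u # q'" by (cases q) (auto simp: gwalk_def)
  have dist: "distinct (u # p)" "distinct (u # q')"
    using nonbacktracking_imp_distinct[of "u # p"] nonbacktracking_imp_distinct[of q] Cons.prems q
    by simp_all
  show ?case
  proof (cases "p = [] \<or> q' = []")
    case True
    then show ?thesis using Cons.prems(6) q dist
      by (metis distinct.simps(2) last.simps last_in_set)
  next
    case False
    then obtain p1 ps q1 qs where pq: "p = p1 # ps" "q' = q1 # qs"
      by (meson neq_Nil_conv)
    have wp: "gwalk T p" and wq: "gwalk T q'"
      using gwalk_appendD2[of T "[u]"] Cons.prems q False by auto
    show ?thesis
    proof (cases "p1 = q1")
      case True
      have "p = q'"
      proof (rule Cons.IH)
        show "nonbacktracking p" "nonbacktracking q'"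
          using nonbacktracking_Cons[of u p] nonbacktracking_Cons[of u q'] Cons.prems q by simp_all
        show "hd p = hd q'" "last p = last q'" using Cons.prems q pq True by auto
      qed (use wp wq in auto)
      then show ?thesis using q by simp
    next
      case False
      have "nonbacktracking (rev qs @ [q1, u])"
        using Cons.prems(4) q pq nonbacktracking_rev[of "u # q1 # qs"] by simp
      then have "nonbacktracking (rev qs @ q1 # u # p1 # ps)"
        by (rule nonbacktracking_append) (use False Cons.prems(2) pq in auto)
      moreover have "gwalk T (rev (q1 # qs) @ u # p1 # ps)"
        by (rule gwalk_append)
           (use wq Cons.prems(1,3) q pq gwalk_rev[OF wq] in \<open>auto simp: gwalk_def insert_commute\<close>)
      ultimately have "distinct (rev (q1 # qs) @ u # p1 # ps)"
        using nonbacktracking_imp_distinct[of "rev (q1 # qs) @ u # p1 # ps"] by simp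
      moreover have "last (q1 # qs) = last (p1 # ps)" using Cons.prems(6) q pq by simp
      ultimately show ?thesis
        by (metis disjoint_iff distinct_append last_in_set list.distinct(1) list.set_intros(2) set_rev)
    qed
  qed
qed (simp add: gwalk_def)

text \<open>A walk containing \<open>x, y, x\<close> can be shortened to one containing
  \<open>x\<close>, so a shortest walk has no backtrack.\<close>

lemma gdist_walk:
  assumes "u \<in> V" "v \<in> V"
  obtains p where "gwalk T p" "nonbacktracking p" "hd p = u" "last p = v" "length p = Suc (d u v)"
proof -
  obtain p0 where "gwalk T p0" "hd p0 = u" "last p0 = v"
    using tree assms unfolding tree_def gconnected_def by meson
  then have "\<exists>n p. gwalk T p \<and> hd p = u \<and> last p = v \<and> length p = Suc n"
    by (metis gwalk_def length_0_conv not0_implies_Suc)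
  then have "\<exists>p. gwalk T p \<and> hd p = u \<and> last p = v \<and> length p = Suc (d u v)"
    unfolding gdist_def by (rule LeastI_ex)
  then obtain p where p: "gwalk T p" "hd p = u" "last p = v" "length p = Suc (d u v)" by blast
  have "nonbacktracking p"
  proof (rule ccontr)
    assume "\<not> nonbacktracking p"
    then obtain xs x y zs where e: "p = xs @ x # y # x # zs" by (rule not_nonbacktrackingE)
    have w: "gwalk T (xs @ x # zs)"
      using p(1) unfolding gwalk_def e by (auto simp: successively_append_iff successively_Cons)
    have "hd (xs @ x # zs) = u" "last (xs @ x # zs) = v"
      using p e by (auto simp: hd_append)
    with gdist_le[OF w] have "d u v \<le> length (xs @ x # zs) - 1" by simp
    then show False using p(4) e by simp
  qed
  with p that show ?thesis by blast
qed

text \<open>With \<open>gdist_walk\<close> this identifies shortest paths with walks free of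
  backtracking, a condition that can be checked locally.\<close>

lemma gdist_nonbacktracking:
  assumes "gwalk T p" "nonbacktracking p" shows "d (hd p) (last p) = length p - 1"
proof -
  have "hd p \<in> V" "last p \<in> V" using assms(1) by (auto simp: gwalk_def)
  then obtain q where "gwalk T q" "nonbacktracking q" "hd q = hd p" "last q = last p"
    "length q = Suc (d (hd p) (last p))" by (rule gdist_walk)
  with nonbacktracking_walk_unique[OF assms, of q] show ?thesis by simp
qed

lemma gdist_self [simp]: "v \<in> V \<Longrightarrow> d v v = 0"
  using gdist_nonbacktracking[of "[v]"] by (simp add: gwalk_def)

lemma gdist_eq_0:
  assumes "u \<in> V" "v \<in> V" "d u v = 0" shows "u = v"
proof -
  obtain p where "gwalk T p" "hd p = u" "last p = v" "length p = Suc (d u v)"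
    using gdist_walk[OF assms(1,2)] by blast
  then show ?thesis using assms(3) by (cases p) auto
qed

lemma gdist_eq_1:
  assumes "u \<in> V" "v \<in> V" "d u v = 1" shows "{u, v} \<in> E"
proof -
  obtain p where p: "gwalk T p" "hd p = u" "last p = v" "length p = Suc (d u v)"
    using gdist_walk[OF assms(1,2)] by blast
  then obtain x y where "p = [x, y]" using assms(3)
    by (cases p; cases "tl p") auto
  with p show ?thesis by (simp add: gwalk_def)
qed

lemma gdist_edge: "{u, v} \<in> E \<Longrightarrow> d u v = 1"
  using gdist_nonbacktracking[of "[u, v]"] edge_verts[of u v] by (simp add: gwalk_def)

lemma gdist_commute:
  assumes "u \<in> V" "v \<in> V" shows "d u v = d v u"
proof -
  have "d v u \<le> d u v" if uv: "u \<in> V" "v \<in> V" for u v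
  proof -
    obtain p where p: "gwalk T p" "hd p = u" "last p = v" "length p = Suc (d u v)"
      using gdist_walk[OF uv] by blast
    then show ?thesis using gdist_le[OF gwalk_rev[OF p(1)]] by (auto simp: hd_rev last_rev)
  qed
  from this[of u v] this[of v u] show ?thesis using assms by linarith
qed

lemma gdist_triangle:
  assumes "u \<in> V" "v \<in> V" "w \<in> V" shows "d u w \<le> d u v + d v w"
proof -
  obtain p where p: "gwalk T p" "hd p = u" "last p = v" "length p = Suc (d u v)"
    using gdist_walk[OF assms(1,2)] by blast
  obtain q where q: "gwalk T q" "hd q = v" "last q = w" "length q = Suc (d v w)"
    using gdist_walk[OF assms(2,3)] by blast
  then obtain q' where q': "q = v # q'" by (cases q) (auto simp: gwalk_def)
  show ?thesis
  proof (cases "q' = []")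
    case True
    then show ?thesis using q q' p gdist_le[OF p(1)] by auto
  next
    case False
    have "gwalk T (p @ q')"
      by (rule gwalk_append)
         (use p q q' False in \<open>auto simp: gwalk_def successively_Cons\<close>)
    moreover have "hd (p @ q') = u" "last (p @ q') = w"
      using p q q' False by (auto simp: gwalk_def)
    ultimately show ?thesis using gdist_le[of T "p @ q'"] p q q' by auto
  qed
qed

text \<open>If the shortest path from \<open>v\<close> to \<open>w\<close> arrives through
  \<open>w'\<close>, dropping its last vertex gives a shortest path to \<open>w'\<close>; otherwise
  appending \<open>w'\<close> creates no backtrack.\<close>

lemma gdist_neighbour:
  assumes v: "v \<in> V" and e: "{w, w'} \<in> E"
  shows "d v w' = Suc (d v w) \<or> d v w = Suc (d v w')"
proof -
  have w: "w \<in> V" "w' \<in> V" using edge_verts e by auto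
  obtain p where p: "gwalk T p" "nonbacktracking p" "hd p = v" "last p = w" "length p = Suc (d v w)"
    using gdist_walk[OF v w(1)] .
  show ?thesis
  proof (cases "\<exists>q. p = q @ [w', w]")
    case True
    then obtain q where q: "p = (q @ [w']) @ [w]" by auto
    then have "gwalk T (q @ [w'])" "nonbacktracking (q @ [w'])"
      using gwalk_appendD1[of T "q @ [w']" "[w]"] p(1) nonbacktracking_butlast[OF p(2)]
      by (simp_all add: butlast_append)
    then have "d v w' = length q"
      using gdist_nonbacktracking[of "q @ [w']"] p(3) q by (auto simp: hd_append split: if_splits)
    then show ?thesis using p q by simp
  next
    case False
    have wk: "gwalk T (p @ [w'])"
      by (rule gwalk_append) (use p e w in \<open>auto simp: gwalk_def\<close>)
    have "nonbacktracking (p @ [w'])"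
    proof (cases p rule: rev_cases)
      case (snoc q a)
      then have a: "a = w" using p by simp
      show ?thesis
      proof (cases q rule: rev_cases)
        case (snoc r b)
        then have "nonbacktracking (r @ [b, w])" using p(2) \<open>p = q @ [a]\<close> a by simp
        then have "nonbacktracking (r @ b # w # [w'])"
          by (rule nonbacktracking_append) (use False snoc \<open>p = q @ [a]\<close> a in auto)
        then show ?thesis using snoc \<open>p = q @ [a]\<close> a by simp
      qed (use snoc in simp)
    qed simp
    with gdist_nonbacktracking[OF wk] p show ?thesis
      by (auto simp: gwalk_def)
  qed
qed

text \<open>Shortest paths to \<open>x\<close> and to \<open>y\<close>, each extended by
  \<open>w\<close>, are both shortest paths to \<open>w\<close> and hence equal. The arguments about
  lines below use the absence of cycles in this form.\<close>

lemma gdist_closer_unique: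
  assumes v: "v \<in> V" and e: "{w, x} \<in> E" "{w, y} \<in> E"
    and "Suc (d v x) = d v w" "Suc (d v y) = d v w"
  shows "x = y"
proof -
  have *: "\<exists>p. gwalk T (p @ [x, w]) \<and> nonbacktracking (p @ [x, w]) \<and> hd (p @ [x, w]) = v"
    if e: "{w, x} \<in> E" and dx: "Suc (d v x) = d v w" for x
  proof -
    have w: "w \<in> V" "x \<in> V" using edge_verts e by auto
    obtain p where p: "gwalk T p" "nonbacktracking p" "hd p = v" "last p = x" "length p = Suc (d v x)"
      using gdist_walk[OF v w(2)] .
    have wk: "gwalk T (p @ [w])"
      by (rule gwalk_append) (use p e w in \<open>auto simp: gwalk_def insert_commute\<close>)
    have "nonbacktracking (p @ [w])"
    proof (rule ccontr)
      assume "\<not> nonbacktracking (p @ [w])"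
      then obtain xs a b zs where z: "p @ [w] = xs @ a # b # a # zs" by (rule not_nonbacktrackingE)
      have wk': "gwalk T (xs @ a # zs)"
        using wk unfolding gwalk_def z by (auto simp: successively_append_iff successively_Cons)
      have "p \<noteq> []" using p(1) by (simp add: gwalk_def)
      then have "hd (xs @ a # zs) = v" "last (xs @ a # zs) = w"
        using p(3) arg_cong[OF z, of hd] arg_cong[OF z, of last]
        by (simp_all add: hd_append split: if_splits)
      with gdist_le[OF wk'] have "d v w \<le> length (xs @ a # zs) - 1" by simp
      then show False using arg_cong[OF z, of length] p dx by simp
    qed
    moreover obtain q where "p = q @ [x]" using p by (metis append_butlast_last_id gwalk_def)
    ultimately show ?thesis using wk p by (intro exI[of _ q]) (auto simp: hd_append)
  qed
  from *[OF e(1) assms(4)] *[OF e(2) assms(5)] obtain p q where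
    "gwalk T (p @ [x, w])" "nonbacktracking (p @ [x, w])" "hd (p @ [x, w]) = v"
    "gwalk T (q @ [y, w])" "nonbacktracking (q @ [y, w])" "hd (q @ [y, w]) = v" by blast
  then have "p @ [x, w] = q @ [y, w]"
    by (intro nonbacktracking_walk_unique) auto
  then show "x = y" by simp
qed

section \<open>Bi-infinite geodesics of a tree\<close>

definition gline :: "(int \<Rightarrow> 'v) \<Rightarrow> bool" where
  "gline a \<longleftrightarrow> range a \<subseteq> V \<and> (\<forall>i j. int (d (a i) (a j)) = \<bar>i - j\<bar>)"

lemma gline_vert: "gline a \<Longrightarrow> a i \<in> V"
  and gline_dist: "gline a \<Longrightarrow> int (d (a i) (a j)) = \<bar>i - j\<bar>"
  unfolding gline_def by auto

lemma gline_edge: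
  assumes "gline a" shows "{a i, a (i + 1)} \<in> E"
  by (rule gdist_eq_1) (use gline_dist[OF assms, of i "i + 1"] assms in \<open>simp_all add: gline_vert\<close>)

lemma gline_inj:
  assumes "gline a" shows "a i = a j \<longleftrightarrow> i = j"
  using gline_dist[OF assms, of i j] gdist_self[OF gline_vert[OF assms], of j] by auto

lemma gline_edge_iff:
  assumes "gline a" shows "{a i, a j} \<in> E \<longleftrightarrow> \<bar>i - j\<bar> = 1"
proof
  show "\<bar>i - j\<bar> = 1" if "{a i, a j} \<in> E"
    using gdist_edge[OF that] gline_dist[OF assms, of i j] by simp
  show "{a i, a j} \<in> E" if "\<bar>i - j\<bar> = 1"
    by (rule gdist_eq_1) (use that gline_dist[OF assms, of i j] assms in \<open>simp_all add: gline_vert\<close>)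
qed

text \<open>Local geodesics of a tree are global: if the distance from \<open>a i\<close> dropped at
  some step, the next and the previous vertex would both be the unique neighbour closer to
  \<open>a i\<close>, which \<open>nb\<close> forbids.\<close>

lemma glineI_local:
  assumes e: "\<And>i. {a i, a (i + 1)} \<in> E" and nb: "\<And>i. a i \<noteq> a (i + 2)"
  shows "gline a"
proof -
  have V: "a i \<in> V" for i using edge_verts(1)[OF e] .
  have *: "d (a i) (a (i + int n)) = n" for i n
  proof (induction n rule: less_induct)
    case (less n)
    consider "n = 0" | "n = 1" | m where "n = Suc (Suc m)"
      by (metis One_nat_def not0_implies_Suc)
    then show ?case
    proof cases
      case 3
      have 1: "d (a i) (a (i + int m)) = m" "d (a i) (a (i + int m + 1)) = Suc m"
        using less[of m] less[of "Suc m"] 3 by (auto simp: algebra_simps)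
      have "d (a i) (a (i + int m + 1 + 1)) = Suc (d (a i) (a (i + int m + 1)))"
      proof (rule ccontr)
        assume "\<not> ?thesis"
        then have "d (a i) (a (i + int m + 1)) = Suc (d (a i) (a (i + int m + 1 + 1)))"
          using gdist_neighbour[OF V[of i] e[of "i + int m + 1"]] by auto
        then have "a (i + int m) = a (i + int m + 1 + 1)"
          using 1 e[of "i + int m"] e[of "i + int m + 1"]
          by (intro gdist_closer_unique[OF V[of i], of "a (i + int m + 1)"]) (auto simp: insert_commute)
        then show False using nb[of "i + int m"] by (simp add: add.assoc)
      qed
      then show ?thesis using 1 3 by (simp add: algebra_simps)
    qed (use V gdist_edge e in auto)
  qed
  have "int (d (a i) (a j)) = \<bar>i - j\<bar>" if "i \<le> j" for i j
    using *[of i "nat (j - i)"] that by simp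
  moreover have "int (d (a i) (a j)) = \<bar>i - j\<bar>" if "j \<le> i" for i j
    using *[of j "nat (i - j)"] that gdist_commute[OF V V, of i j] by simp
  ultimately show ?thesis using V unfolding gline_def by (meson image_subsetI linear)
qed

text \<open>\<open>a k\<close> is a vertex of the line nearest to \<open>w\<close>. Moving away from
  it the distance must grow at every step, for a first drop would give a vertex of the line two
  neighbours closer to \<open>w\<close>.\<close>

lemma gline_projection:
  assumes a: "gline a" and w: "w \<in> V"
  obtains k where "\<And>i. int (d w (a i)) = int (d w (a k)) + \<bar>i - k\<bar>"
proof -
  have "\<exists>k. \<forall>i. d w (a k) \<le> d w (a i)"
    using ex_has_least_nat[of "\<lambda>_. True" 0 "\<lambda>i. d w (a i)"] by simp
  then obtain k where min: "\<And>i. d w (a k) \<le> d w (a i)" by blast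
  \<comment> \<open>Treats one ray starting at a nearest vertex; a shift and a reflection of
    \<open>a\<close> then cover both rays.\<close>
  have *: "d w (b (int n)) = d w (b 0) + n"
    if b: "gline b" and min: "\<And>i. d w (b 0) \<le> d w (b i)" for b n
  proof (induction n rule: less_induct)
    case (less n)
    consider "n = 0" | "n = 1" | m where "n = Suc (Suc m)"
      by (metis One_nat_def not0_implies_Suc)
    then show ?case
    proof cases
      case 2
      then show ?thesis using gdist_neighbour[OF w gline_edge[OF b, of 0]] min[of 1] by auto
    next
      case 3
      have 1: "d w (b (int m)) = d w (b 0) + m" "d w (b (int m + 1)) = Suc (d w (b 0) + m)"
        using less[of m] less[of "Suc m"] 3 by (auto simp: algebra_simps)
      have "d w (b (int m + 1 + 1)) = Suc (d w (b (int m + 1)))"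
      proof (rule ccontr)
        assume "\<not> ?thesis"
        then have "d w (b (int m + 1)) = Suc (d w (b (int m + 1 + 1)))"
          using gdist_neighbour[OF w gline_edge[OF b, of "int m + 1"]] by auto
        then have "b (int m) = b (int m + 1 + 1)"
          using 1 gline_edge[OF b, of "int m"] gline_edge[OF b, of "int m + 1"]
          by (intro gdist_closer_unique[OF w, of "b (int m + 1)"]) (auto simp: insert_commute)
        then show False using gline_inj[OF b] by auto
      qed
      then show ?thesis using 1 3 by (simp add: algebra_simps)
    qed auto
  qed
  have shift: "gline (\<lambda>i. a (k + i))" "gline (\<lambda>i. a (k - i))"
    using a unfolding gline_def by auto
  have "int (d w (a i)) = int (d w (a k)) + \<bar>i - k\<bar>" for i
  proof (cases "k \<le> i")
    case True
    then show ?thesis using *[OF shift(1), of "nat (i - k)"] min by simp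
  next
    case False
    then show ?thesis using *[OF shift(2), of "nat (k - i)"] min by simp
  qed
  then show ?thesis using that by blast
qed

end

section \<open>Lines in the geometric realization\<close>

text \<open>The value at \<open>p\<close> of the piecewise affine extension of the vertex function
  \<open>h\<close>.\<close>

definition barycentre :: "('v \<Rightarrow> real) \<Rightarrow> ('v \<Rightarrow> real) \<Rightarrow> real" where
  "barycentre p h = (\<Sum>v\<in>supp p. p v * h v)"

lemma barycentre_superset:
  assumes "finite A" "supp p \<subseteq> A" shows "barycentre p h = (\<Sum>v\<in>A. p v * h v)"
  unfolding barycentre_def by (rule sum.mono_neutral_left) (use assms in \<open>auto simp: supp_def\<close>)

text \<open>For integral \<open>t\<close> the second weight vanishes, so vertices and interior
  points of edges need no separate clauses.\<close>

definition line_point :: "(int \<Rightarrow> 'v) \<Rightarrow> real \<Rightarrow> 'v \<Rightarrow> real" where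
  "line_point a t = (\<lambda>v. (if v = a \<lfloor>t\<rfloor> then 1 - frac t else 0) + (if v = a (\<lfloor>t\<rfloor> + 1) then frac t else 0))"

lemma supp_line_point: "supp (line_point a t) \<subseteq> {a \<lfloor>t\<rfloor>, a (\<lfloor>t\<rfloor> + 1)}"
  unfolding supp_def line_point_def by auto

lemma line_point_nonneg: "0 \<le> line_point a t v"
  unfolding line_point_def using frac_ge_0[of t] frac_lt_1[of t] by auto

lemma line_point_of_int: "line_point a (of_int i) = (\<lambda>v. if v = a i then 1 else 0)"
  unfolding line_point_def by auto

context graph_tree begin

abbreviation "R \<equiv> realization T"

text \<open>Trades the cell of the definition, which a vertex point does not determine, for the
  support, which is intrinsic.\<close>

lemma realizationD:
  assumes "p \<in> R"
  shows "\<And>v. 0 \<le> p v" "finite (supp p)" "supp p \<subseteq> V" "(\<Sum>v\<in>supp p. p v) = 1"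
    "\<And>u v. u \<in> supp p \<Longrightarrow> v \<in> supp p \<Longrightarrow> u \<noteq> v \<Longrightarrow> {u, v} \<in> E \<and> supp p = {u, v}"
proof -
  obtain c where c: "c \<in> (\<lambda>v. {v}) ` V \<union> E" "supp p \<subseteq> c" "(\<Sum>v\<in>c. p v) = 1"
    and nn: "\<forall>v. 0 \<le> p v"
    using assms unfolding realization_def by auto
  then show "\<And>v. 0 \<le> p v" by blast
  obtain x y where xy: "c = {x, y}" "x \<in> V" "y \<in> V" "x = y \<or> {x, y} \<in> E"
  proof (cases "c \<in> E")
    case True
    then obtain x y where "c = {x, y}" by (rule edgeE)
    then show ?thesis using that edge_verts[of x y] True by auto
  qed (use c that in auto)
  then have fc: "finite c" by simp
  show "finite (supp p)" using c fc finite_subset by blast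
  show "supp p \<subseteq> V" using c xy by auto
  show "(\<Sum>v\<in>supp p. p v) = 1"
    using c(3) sum.mono_neutral_left[OF fc c(2), of p] by (auto simp: supp_def)
  show "{u, v} \<in> E \<and> supp p = {u, v}" if "u \<in> supp p" "v \<in> supp p" "u \<noteq> v" for u v
  proof -
    have "u \<in> {x, y}" "v \<in> {x, y}" using that c(2) xy(1) by auto
    then have uv: "{u, v} = {x, y}" "x \<noteq> y" using that(3) by auto
    then have "supp p = {u, v}" using that c(2) xy(1) by auto
    then show ?thesis using uv xy(4) by auto
  qed
qed

lemma realization_supp_nonempty: assumes "p \<in> R" shows "supp p \<noteq> {}"
  using realizationD(4)[OF assms] by auto

lemma realizationI:
  assumes "\<And>v. 0 \<le> p v" "finite (supp p)" "supp p \<subseteq> V" "(\<Sum>v\<in>supp p. p v) = 1"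
    "\<And>u v. u \<in> supp p \<Longrightarrow> v \<in> supp p \<Longrightarrow> u \<noteq> v \<Longrightarrow> {u, v} \<in> E \<and> supp p = {u, v}"
  shows "p \<in> R"
proof -
  have "supp p \<noteq> {}" using assms(4) by auto
  then obtain u where u: "u \<in> supp p" by blast
  have "supp p \<in> (\<lambda>v. {v}) ` V \<union> E"
  proof (cases "supp p = {u}")
    case True
    then show ?thesis using assms(3) by auto
  next
    case False
    then obtain v where "v \<in> supp p" "u \<noteq> v" using u by auto
    then show ?thesis using assms(5)[OF u, of v] by auto
  qed
  then show ?thesis unfolding realization_def using assms(1,4) by blast
qed

lemma rdist_common_edge:
  assumes "p \<in> R" "q \<in> R" "\<exists>e\<in>E. supp p \<union> supp q \<subseteq> e"
  shows "rdist T p q = (\<Sum>v\<in>supp p \<union> supp q. \<bar>p v - q v\<bar>) / 2"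
proof -
  have "\<not> (p \<notin> R \<or> q \<notin> R)" using assms by blast
  then show ?thesis unfolding rdist_def using assms(3) by (simp only: if_False if_True simp_thms)
qed

lemma rdist_no_common_edge:
  assumes "p \<in> R" "q \<in> R" "\<not> (\<exists>e\<in>E. supp p \<union> supp q \<subseteq> e)"
  shows "rdist T p q = Min ((\<lambda>(u, v). (1 - p u) + real (d u v) + (1 - q v)) ` (supp p \<times> supp q))"
proof -
  have "\<not> (p \<notin> R \<or> q \<notin> R)" using assms by blast
  then show ?thesis unfolding rdist_def using assms(3) by (simp only: if_False if_True simp_thms)
qed

text \<open>The mass \<open>1 - p u\<close> that is not at \<open>u\<close> sits at a neighbour of
  \<open>u\<close>, where \<open>h\<close> differs from \<open>h u\<close> by at most 1.\<close>

lemma barycentre_near_vertex: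
  assumes p: "p \<in> R" and u: "u \<in> supp p"
    and h: "\<And>u v. {u, v} \<in> E \<Longrightarrow> \<bar>h u - h v\<bar> \<le> 1"
  shows "\<bar>barycentre p h - h u\<bar> \<le> 1 - p u"
proof -
  note D = realizationD[OF p]
  have 1: "p u + (\<Sum>v\<in>supp p - {u}. p v) = 1"
    using D(4) sum.remove[OF D(2) u, of p] by simp
  have "barycentre p h - h u = barycentre p h - (\<Sum>v\<in>supp p. p v) * h u"
    using D(4) by simp
  also have "\<dots> = (\<Sum>v\<in>supp p. p v * (h v - h u))"
    unfolding barycentre_def by (simp add: sum_distrib_right sum_subtractf right_diff_distrib)
  also have "\<dots> = (\<Sum>v\<in>supp p - {u}. p v * (h v - h u))"
    using sum.remove[OF D(2) u, of "\<lambda>v. p v * (h v - h u)"] by simp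
  finally have "\<bar>barycentre p h - h u\<bar> \<le> (\<Sum>v\<in>supp p - {u}. \<bar>p v * (h v - h u)\<bar>)"
    by (simp only: sum_abs)
  also have "\<dots> \<le> (\<Sum>v\<in>supp p - {u}. p v)"
  proof (rule sum_mono)
    fix v assume "v \<in> supp p - {u}"
    then have "\<bar>h v - h u\<bar> \<le> 1" using D(5)[OF u, of v] h[of v u] by (auto simp: insert_commute)
    then show "\<bar>p v * (h v - h u)\<bar> \<le> p v"
      using D(1)[of v] by (simp add: abs_mult mult_left_le)
  qed
  finally show ?thesis using 1 by simp
qed

text \<open>
  Kantorovich duality, easy half. Together with explicit upper bounds for points of a line it
  replaces the general triangle inequality of \<open>rdist\<close>.
\<close>

lemma barycentre_diff_le_rdist:
  assumes p: "p \<in> R" and q: "q \<in> R"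
    and h: "\<And>u v. u \<in> V \<Longrightarrow> v \<in> V \<Longrightarrow> \<bar>h u - h v\<bar> \<le> real (d u v)"
  shows "\<bar>barycentre p h - barycentre q h\<bar> \<le> rdist T p q"
proof -
  note P = realizationD[OF p] and Q = realizationD[OF q]
  have hE: "\<bar>h u - h v\<bar> \<le> 1" if "{u, v} \<in> E" for u v
    using h[of u v] gdist_edge[OF that] edge_verts[OF that] by simp
  show ?thesis
  proof (cases "\<exists>e\<in>E. supp p \<union> supp q \<subseteq> e")
    case True
    then obtain x y where xy: "{x, y} \<in> E" "supp p \<union> supp q \<subseteq> {x, y}"
      using edgeE by metis
    have ne: "x \<noteq> y" using edge_verts[OF xy(1)] by simp
    have sum1: "f x + f y = 1" if f: "(\<Sum>v\<in>supp f. f v) = 1" "supp f \<subseteq> {x, y}" for f :: "'v \<Rightarrow> real"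
    proof -
      have "(\<Sum>v\<in>supp f. f v) = (\<Sum>v\<in>{x, y}. f v)"
        by (rule sum.mono_neutral_left) (use f in \<open>auto simp: supp_def\<close>)
      then show ?thesis using f ne by simp
    qed
    then have s: "p x + p y = 1" "q x + q y = 1" using P(4) Q(4) xy(2) by simp_all
    have "rdist T p q = (\<Sum>v\<in>supp p \<union> supp q. \<bar>p v - q v\<bar>) / 2"
      by (rule rdist_common_edge[OF p q True])
    also have "(\<Sum>v\<in>supp p \<union> supp q. \<bar>p v - q v\<bar>) = (\<Sum>v\<in>{x, y}. \<bar>p v - q v\<bar>)"
      by (rule sum.mono_neutral_left) (use xy(2) in \<open>auto simp: supp_def\<close>)
    also have "\<dots> = \<bar>p x - q x\<bar> + \<bar>p y - q y\<bar>" using ne by simp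
    also have "p y - q y = - (p x - q x)" using s by linarith
    finally have r: "rdist T p q = \<bar>p x - q x\<bar>" by simp
    have e: "p y = 1 - p x" "q y = 1 - q x" using s by linarith+
    have "barycentre p h = p x * h x + p y * h y" "barycentre q h = q x * h x + q y * h y"
      using barycentre_superset[of "{x, y}" p h] barycentre_superset[of "{x, y}" q h] xy(2) ne by simp_all
    then have "barycentre p h - barycentre q h = (p x - q x) * (h x - h y)"
      unfolding e by (simp add: algebra_simps)
    then have "\<bar>barycentre p h - barycentre q h\<bar> = \<bar>p x - q x\<bar> * \<bar>h x - h y\<bar>"
      by (simp add: abs_mult)
    also have "\<dots> \<le> \<bar>p x - q x\<bar>" using hE[OF xy(1)] by (simp add: mult_left_le)
    finally show ?thesis using r by simp
  next
    case False
    let ?f = "\<lambda>(u, v). (1 - p u) + real (d u v) + (1 - q v)"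
    have "rdist T p q = Min (?f ` (supp p \<times> supp q))"
      by (rule rdist_no_common_edge[OF p q False])
    moreover have "Min (?f ` (supp p \<times> supp q)) \<in> ?f ` (supp p \<times> supp q)"
      by (rule Min_in) (use P(2) Q(2) realization_supp_nonempty p q in auto)
    ultimately obtain u v where uv: "u \<in> supp p" "v \<in> supp q"
      "rdist T p q = (1 - p u) + real (d u v) + (1 - q v)" by auto
    have "\<bar>h u - h v\<bar> \<le> real (d u v)" using h uv P(3) Q(3) by blast
    moreover have "\<bar>barycentre p h - h u\<bar> \<le> 1 - p u" "\<bar>barycentre q h - h v\<bar> \<le> 1 - q v"
      using barycentre_near_vertex p q uv(1,2) hE by blast+
    ultimately show ?thesis using uv(3) by linarith
  qed
qed

lemma rdist_commute: "rdist T p q = rdist T q p"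
proof (cases "p \<in> R \<and> q \<in> R")
  case True
  then have V: "supp p \<subseteq> V" "supp q \<subseteq> V" using realizationD by blast+
  have "(\<lambda>(u, v). (1 - p u) + real (d u v) + (1 - q v)) ` (supp p \<times> supp q)
     = (\<lambda>(u, v). (1 - q u) + real (d u v) + (1 - p v)) ` (supp q \<times> supp p)" (is "?f ` _ = ?g ` _")
  proof -
    have "?f ` (supp p \<times> supp q) = (?g \<circ> prod.swap) ` (supp p \<times> supp q)"
      by (rule image_cong) (use V gdist_commute in \<open>auto simp: subset_iff\<close>)
    also have "\<dots> = ?g ` (supp q \<times> supp p)" by (simp only: image_comp[symmetric] product_swap)
    finally show ?thesis .
  qed
  moreover have "(\<Sum>v\<in>supp p \<union> supp q. \<bar>p v - q v\<bar>) = (\<Sum>v\<in>supp q \<union> supp p. \<bar>q v - p v\<bar>)"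
    by (simp add: Un_commute abs_minus_commute)
  ultimately show ?thesis
    using True rdist_common_edge[of p q] rdist_common_edge[of q p]
      rdist_no_common_edge[of p q] rdist_no_common_edge[of q p]
    by (cases "\<exists>e\<in>E. supp p \<union> supp q \<subseteq> e") (simp_all only: Un_commute[of "supp q"] simp_thms)
qed (auto simp: rdist_def)

section \<open>Distances between points of a line\<close>

lemma line_point_in_realization:
  assumes a: "gline a" shows "line_point a t \<in> R"
proof -
  have ne: "a \<lfloor>t\<rfloor> \<noteq> a (\<lfloor>t\<rfloor> + 1)" using gline_inj[OF a] by simp
  show ?thesis
    unfolding realization_def
  proof (intro CollectI conjI allI bexI[of _ "{a \<lfloor>t\<rfloor>, a (\<lfloor>t\<rfloor> + 1)}"])
    show "(\<Sum>v\<in>{a \<lfloor>t\<rfloor>, a (\<lfloor>t\<rfloor> + 1)}. line_point a t v) = 1"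
      using ne by (auto simp: line_point_def)
    show "supp (line_point a t) \<subseteq> {a \<lfloor>t\<rfloor>, a (\<lfloor>t\<rfloor> + 1)}" by (rule supp_line_point)
  qed (use line_point_nonneg gline_edge[OF a] in auto)
qed

lemma barycentre_line_point:
  assumes a: "gline a"
  shows "barycentre (line_point a t) h = (1 - frac t) * h (a \<lfloor>t\<rfloor>) + frac t * h (a (\<lfloor>t\<rfloor> + 1))"
  using barycentre_superset[OF _ supp_line_point, of a t h] gline_inj[OF a, of "\<lfloor>t\<rfloor>" "\<lfloor>t\<rfloor> + 1"]
  by (auto simp: line_point_def)

lemma gdist_lipschitz:
  assumes "w \<in> V" "u \<in> V" "v \<in> V" shows "\<bar>real (d u w) - real (d v w)\<bar> \<le> real (d u v)"
  using gdist_triangle[of u v w] gdist_triangle[of v u w] gdist_commute[of u v] assms by auto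

lemma barycentre_line_point_gdist_right:
  assumes a: "gline a" and "t \<le> of_int n"
  shows "barycentre (line_point a t) (\<lambda>w. real (d w (a n))) = of_int n - t"
proof -
  have D: "real (d (a i) (a n)) = \<bar>of_int i - of_int n\<bar>" for i
    using gline_dist[OF a, of i n] by linarith
  \<comment> \<open>For \<open>t = n\<close> the right endpoint of the edge lies beyond
    \<open>a n\<close>, but there its weight is zero.\<close>
  consider "\<lfloor>t\<rfloor> + 1 \<le> n" | "t = of_int n" using assms(2) by linarith
  then show ?thesis
    unfolding barycentre_line_point[OF a] D
  proof cases
    case 1
    then have "\<bar>of_int \<lfloor>t\<rfloor> - of_int n\<bar> = of_int n - real_of_int \<lfloor>t\<rfloor>"
      "\<bar>of_int (\<lfloor>t\<rfloor> + 1) - of_int n\<bar> = of_int n - real_of_int \<lfloor>t\<rfloor> - 1" by auto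
    then show "(1 - frac t) * \<bar>of_int \<lfloor>t\<rfloor> - of_int n\<bar> + frac t * \<bar>of_int (\<lfloor>t\<rfloor> + 1) - of_int n\<bar> = of_int n - t"
      by (simp add: algebra_simps) (simp add: frac_def)
  next
    case 2
    then show "(1 - frac t) * \<bar>of_int \<lfloor>t\<rfloor> - of_int n\<bar> + frac t * \<bar>of_int (\<lfloor>t\<rfloor> + 1) - of_int n\<bar> = of_int n - t"
      by simp
  qed
qed

lemma barycentre_line_point_gdist_left:
  assumes a: "gline a" and "of_int n \<le> t"
  shows "barycentre (line_point a t) (\<lambda>w. real (d w (a n))) = t - of_int n"
proof -
  have D: "real (d (a i) (a n)) = \<bar>of_int i - of_int n\<bar>" for i
    using gline_dist[OF a, of i n] by linarith
  have "n \<le> \<lfloor>t\<rfloor>" using assms(2) by (simp add: le_floor_iff)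
  then have "\<bar>of_int \<lfloor>t\<rfloor> - of_int n\<bar> = real_of_int \<lfloor>t\<rfloor> - of_int n"
    "\<bar>of_int (\<lfloor>t\<rfloor> + 1) - of_int n\<bar> = real_of_int \<lfloor>t\<rfloor> - of_int n + 1" by auto
  then show ?thesis
    unfolding barycentre_line_point[OF a] D by (simp add: algebra_simps) (simp add: frac_def)
qed

text \<open>Two points share an edge only if the floors of \<open>s\<close> and \<open>t\<close>
  agree or if \<open>t\<close> is the integer following the floor of \<open>s\<close>; there the sum
  formula is evaluated. In all other cases the path leaving \<open>s\<close> to the right and
  arriving through the floor of \<open>t\<close> competes in the minimum, and its length is
  \<open>t - s\<close>.\<close>

lemma rdist_line_point_le:
  assumes a: "gline a" and st: "s \<le> t"
  shows "rdist T (line_point a s) (line_point a t) \<le> t - s"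
proof -
  let ?p = "line_point a s" and ?q = "line_point a t"
  have R: "?p \<in> R" "?q \<in> R" using line_point_in_realization[OF a] by auto
  note P = realizationD[OF R(1)] and Q = realizationD[OF R(2)]
  have D: "real (d (a i) (a j)) = \<bar>of_int i - of_int j\<bar>" for i j
    using gline_dist[OF a, of i j] by linarith
  have inj: "a i = a j \<longleftrightarrow> i = j" for i j by (rule gline_inj[OF a])
  show ?thesis
  proof (cases "\<exists>e\<in>E. supp ?p \<union> supp ?q \<subseteq> e")
    case True
    then obtain x y where xy: "{x, y} \<in> E" "supp ?p \<union> supp ?q \<subseteq> {x, y}"
      using edgeE by metis
    have "x \<noteq> y" using edge_verts[OF xy(1)] by simp
    have q0: "a \<lfloor>t\<rfloor> \<in> supp ?q" "a \<lfloor>s\<rfloor> \<in> supp ?p"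
      using frac_lt_1[of t] frac_lt_1[of s] by (auto simp: supp_def line_point_def inj)
    have q1: "frac t \<noteq> 0 \<Longrightarrow> a (\<lfloor>t\<rfloor> + 1) \<in> supp ?q" "frac s \<noteq> 0 \<Longrightarrow> a (\<lfloor>s\<rfloor> + 1) \<in> supp ?p"
      using frac_ge_0[of t] frac_ge_0[of s] by (auto simp: supp_def line_point_def inj)
    have fl: "\<lfloor>s\<rfloor> \<le> \<lfloor>t\<rfloor>" using st by (rule floor_mono)
    have r: "rdist T ?p ?q = (\<Sum>v\<in>supp ?p \<union> supp ?q. \<bar>?p v - ?q v\<bar>) / 2"
      by (rule rdist_common_edge[OF R True])
    show ?thesis
    proof (cases "\<lfloor>s\<rfloor> = \<lfloor>t\<rfloor>")
      case True
      have "(\<Sum>v\<in>supp ?p \<union> supp ?q. \<bar>?p v - ?q v\<bar>) = (\<Sum>v\<in>{a \<lfloor>t\<rfloor>, a (\<lfloor>t\<rfloor> + 1)}. \<bar>?p v - ?q v\<bar>)"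
        by (rule sum.mono_neutral_left)
           (use supp_line_point[of a s] supp_line_point[of a t] True in \<open>auto simp: supp_def\<close>)
      also have "\<dots> = 2 * \<bar>frac s - frac t\<bar>"
        using True by (simp add: line_point_def inj)
      finally show ?thesis using r True st by (simp add: frac_def)
    next
      case False
      have "\<lfloor>s\<rfloor> < \<lfloor>t\<rfloor>" using False fl by simp
      have xy': "{x, y} = {a \<lfloor>s\<rfloor>, a \<lfloor>t\<rfloor>}"
      proof -
        have "a \<lfloor>s\<rfloor> \<in> {x, y}" "a \<lfloor>t\<rfloor> \<in> {x, y}" "a \<lfloor>s\<rfloor> \<noteq> a \<lfloor>t\<rfloor>"
          using xy(2) q0 False inj by auto
        then show ?thesis by auto
      qed
      then have adj: "\<lfloor>t\<rfloor> = \<lfloor>s\<rfloor> + 1" using xy(1) gline_edge_iff[OF a] \<open>\<lfloor>s\<rfloor> < \<lfloor>t\<rfloor>\<close> by auto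
      \<comment> \<open>Otherwise the two supports would contain three vertices of the line, too
        many for one edge.\<close>
      have ft: "frac t = 0"
      proof (rule ccontr)
        assume "frac t \<noteq> 0"
        then have "a (\<lfloor>t\<rfloor> + 1) \<in> {a \<lfloor>s\<rfloor>, a \<lfloor>t\<rfloor>}" using q1 xy(2) xy' by blast
        then show False using inj adj by auto
      qed
      have "(\<Sum>v\<in>supp ?p \<union> supp ?q. \<bar>?p v - ?q v\<bar>) = (\<Sum>v\<in>{a \<lfloor>s\<rfloor>, a \<lfloor>t\<rfloor>}. \<bar>?p v - ?q v\<bar>)"
        by (rule sum.mono_neutral_left) (use xy xy' in \<open>auto simp: supp_def\<close>)
      also have "\<dots> = 2 * (1 - frac s)"
        using adj frac_lt_1[of s] by (simp add: line_point_def inj ft)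
      finally show ?thesis using r adj ft by (simp add: frac_def)
    qed
  next
    case False
    have fl: "\<lfloor>s\<rfloor> < \<lfloor>t\<rfloor>"
    proof (rule ccontr)
      assume "\<not> ?thesis"
      then have "\<lfloor>s\<rfloor> = \<lfloor>t\<rfloor>" using floor_mono[OF st] by simp
      then have "supp ?p \<union> supp ?q \<subseteq> {a \<lfloor>t\<rfloor>, a (\<lfloor>t\<rfloor> + 1)}"
        using supp_line_point[of a s] supp_line_point[of a t] by auto
      then show False using False gline_edge[OF a] by blast
    qed
    let ?f = "\<lambda>(u, v). (1 - ?p u) + real (d u v) + (1 - ?q v)"
    have r: "rdist T ?p ?q = Min (?f ` (supp ?p \<times> supp ?q))"
      by (rule rdist_no_common_edge[OF R False])
    have le: "rdist T ?p ?q \<le> ?f (u, v)" if "u \<in> supp ?p" "v \<in> supp ?q" for u v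
      unfolding r by (rule Min_le) (use that P(2) Q(2) in auto)
    have vq: "a \<lfloor>t\<rfloor> \<in> supp ?q" and up: "a \<lfloor>s\<rfloor> \<in> supp ?p"
      using frac_lt_1[of t] frac_lt_1[of s] by (auto simp: supp_def line_point_def inj)
    show ?thesis
    proof (cases "frac s = 0")
      case True
      have "rdist T ?p ?q \<le> t - s"
        using le[OF up vq] True fl by (simp add: line_point_def inj D frac_def)
      then show ?thesis .
    next
      case f: False
      have "a (\<lfloor>s\<rfloor> + 1) \<in> supp ?p" using f by (auto simp: supp_def line_point_def inj)
      from le[OF this vq] show ?thesis using fl by (simp add: line_point_def inj D frac_def)
    qed
  qed
qed

lemma barycentre_gdist_diff_le_rdist:
  assumes "p \<in> R" "q \<in> R" "w \<in> V"
  shows "\<bar>barycentre p (\<lambda>u. real (d u w)) - barycentre q (\<lambda>u. real (d u w))\<bar> \<le> rdist T p q"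
  by (rule barycentre_diff_le_rdist) (use assms in \<open>simp_all add: gdist_lipschitz\<close>)

text \<open>For the lower bound the test function is the distance to a vertex of the line to the
  left of both points, along which it is affine.\<close>

lemma rdist_line_point:
  assumes a: "gline a" shows "rdist T (line_point a s) (line_point a t) = \<bar>s - t\<bar>"
proof -
  have *: "rdist T (line_point a s) (line_point a t) = t - s" if st: "s \<le> t" for s t
  proof -
    let ?n = "\<lfloor>s\<rfloor>"
    have "\<bar>barycentre (line_point a s) (\<lambda>w. real (d w (a ?n))) - barycentre (line_point a t) (\<lambda>w. real (d w (a ?n)))\<bar>
        \<le> rdist T (line_point a s) (line_point a t)"
      by (intro barycentre_gdist_diff_le_rdist line_point_in_realization a gline_vert)
    moreover have "?n \<le> s" "?n \<le> t" using st by linarith+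
    ultimately show ?thesis
      using rdist_line_point_le[OF a st] st by (simp add: barycentre_line_point_gdist_left[OF a])
  qed
  show ?thesis using *[of s t] *[of t s] rdist_commute[of "line_point a s" "line_point a t"] by (cases "s \<le> t") auto
qed

lemma realization_on_lineE:
  assumes a: "gline a" and x: "x \<in> R" and s: "supp x \<subseteq> range a"
  obtains t where "x = line_point a t"
proof -
  note X = realizationD[OF x]
  have inj: "a i = a j \<longleftrightarrow> i = j" for i j by (rule gline_inj[OF a])
  obtain i where i: "a i \<in> supp x" using s realization_supp_nonempty[OF x] by blast
  show ?thesis
  proof (cases "supp x = {a i}")
    case True
    then have "x (a i) = 1" using X(4) by simp
    moreover have "x v = 0" if "v \<noteq> a i" for v using True that unfolding supp_def by blast
    ultimately have "x = line_point a (of_int i)"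
      unfolding line_point_of_int by auto
    then show ?thesis using that by blast
  next
    case False
    with i obtain v where v: "v \<in> supp x" "v \<noteq> a i" by auto
    with s obtain j where "v = a j" by auto
    with v have j: "a j \<in> supp x" "a i \<noteq> a j" by simp_all
    have ij: "{a i, a j} \<in> E" "supp x = {a i, a j}" using X(5)[OF i j] by simp_all
    define m where "m = min i j"
    have m: "supp x = {a m, a (m + 1)}"
    proof (cases "i < j")
      case True
      then have "m = i" "j = i + 1" using ij(1) gline_edge_iff[OF a, of i j] unfolding m_def by auto
      then show ?thesis using ij(2) by simp
    next
      case False
      then have "m = j" "i = j + 1" using ij(1) gline_edge_iff[OF a, of i j] unfolding m_def by auto
      then show ?thesis using ij(2) by (simp add: insert_commute)
    qed
    \<comment> \<open>The left endpoint belongs to the support, so the weight of the right endpoint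
      is less than 1 and \<open>m\<close> is the floor of \<open>t\<close>.\<close>
    define t where "t = of_int m + x (a (m + 1))"
    have sum1: "x (a m) + x (a (m + 1)) = 1" using X(4) m inj by simp
    have "x (a m) \<noteq> 0" using m by (auto simp: supp_def)
    then have "x (a (m + 1)) < 1" using sum1 X(1)[of "a m"] by linarith
    then have fl: "\<lfloor>t\<rfloor> = m" using X(1)[of "a (m + 1)"] unfolding t_def by (simp add: floor_eq_iff)
    have "x = line_point a t"
    proof
      fix v
      have "v \<notin> supp x \<Longrightarrow> x v = 0" by (simp add: supp_def)
      then show "x v = line_point a t v"
        using sum1 m unfolding line_point_def frac_def fl by (auto simp: t_def inj)
    qed
    then show ?thesis using that by blast
  qed
qed

text \<open>
  The sum of the distances to two vertices of the line is minimal only at the vertices between them.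
\<close>

lemma between_on_line:
  assumes a: "gline a" and x: "x \<in> R"
    and eq: "rdist T (line_point a s) x + rdist T x (line_point a t) \<le> \<bar>s - t\<bar>"
  obtains r where "x = line_point a r"
proof -
  note X = realizationD[OF x]
  have *: "supp x \<subseteq> range a"
    if st: "s \<le> t" and eq: "rdist T (line_point a s) x + rdist T x (line_point a t) \<le> t - s" for s t
  proof
    fix u assume u: "u \<in> supp x"
    \<comment> \<open>Integers enclosing both parameters, so that the two distance functions take
      the exact values \<open>s - m\<close> and \<open>n - t\<close> at the end points.\<close>
    define m where "m = \<lfloor>s\<rfloor>"
    define n where "n = \<lceil>t\<rceil>"
    have mn: "of_int m \<le> s" "t \<le> of_int n" unfolding m_def n_def by linarith+
    let ?hm = "\<lambda>w. real (d w (a m))" and ?hn = "\<lambda>w. real (d w (a n))"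
    have "\<bar>barycentre (line_point a s) ?hm - barycentre x ?hm\<bar> \<le> rdist T (line_point a s) x"
      by (intro barycentre_gdist_diff_le_rdist line_point_in_realization a gline_vert x)
    moreover have "\<bar>barycentre x ?hn - barycentre (line_point a t) ?hn\<bar> \<le> rdist T x (line_point a t)"
      by (intro barycentre_gdist_diff_le_rdist line_point_in_realization a gline_vert x)
    ultimately have le: "barycentre x ?hm + barycentre x ?hn \<le> of_int n - of_int m"
      using eq mn by (simp add: barycentre_line_point_gdist_left[OF a] barycentre_line_point_gdist_right[OF a])
    have sum: "?hm w + ?hn w \<ge> of_int n - of_int m" if "w \<in> V" for w
    proof -
      have "d (a m) (a n) \<le> d (a m) w + d w (a n)"
        using gdist_triangle that gline_vert[OF a] by blast
      moreover have "d (a m) w = d w (a m)" using gdist_commute that gline_vert[OF a] by blast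
      ultimately show ?thesis using gline_dist[OF a, of m n] by linarith
    qed
    \<comment> \<open>The excess in the triangle inequality is nonnegative at every vertex, and its
      mean with respect to \<open>x\<close> is at most 0. Hence it vanishes on the support.\<close>
    have "(\<Sum>w\<in>supp x. x w * (?hm w + ?hn w - (of_int n - of_int m)))
      = (\<Sum>w\<in>supp x. x w * ?hm w) + (\<Sum>w\<in>supp x. x w * ?hn w) - (\<Sum>w\<in>supp x. x w) * (of_int n - of_int m)"
      by (simp add: algebra_simps sum.distrib sum_subtractf sum_distrib_right sum_distrib_left)
    also have "\<dots> \<le> 0" using le X(4) unfolding barycentre_def by simp
    finally have "(\<Sum>w\<in>supp x. x w * (?hm w + ?hn w - (of_int n - of_int m))) = 0"
      using X(1,3) sum by (intro antisym sum_nonneg mult_nonneg_nonneg) auto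
    then have "x u * (?hm u + ?hn u - (of_int n - of_int m)) = 0"
      by (subst (asm) sum_nonneg_eq_0_iff) (use X(1,2,3) sum u in auto)
    then have z: "?hm u + ?hn u = of_int n - of_int m" using u by (auto simp: supp_def)
    \<comment> \<open>Measured through the projection \<open>a k\<close>, the excess at
      \<open>u\<close> is at least twice the distance from \<open>u\<close> to the line.\<close>
    obtain k where k: "\<And>i. int (d u (a i)) = int (d u (a k)) + \<bar>i - k\<bar>"
      using gline_projection[OF a, of u] u X(3) by blast
    have "d u (a k) = 0" using k[of m] k[of n] z by linarith
    then show "u \<in> range a" using gdist_eq_0[of u "a k"] u X(3) gline_vert[OF a] by auto
  qed
  have "supp x \<subseteq> range a"
  proof (cases "s \<le> t")
    case True
    then show ?thesis using * eq by simp
  next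
    case False
    then show ?thesis
      using *[of t s] eq rdist_commute[of x "line_point a s"] rdist_commute[of x "line_point a t"] by simp
  qed
  then show ?thesis using realization_on_lineE[OF a x] that by blast
qed

end

section \<open>Group actions on trees\<close>

text \<open>An abstract group with a homomorphism, because the lattice acts on each tree through a
  projection that need not be injective.\<close>

locale tree_action = graph_tree T + group H
  for T :: "'v ugraph" and H :: "('h, 'k) monoid_scheme" (structure) +
  fixes \<rho> :: "'h \<Rightarrow> 'v \<Rightarrow> 'v"
  assumes hom: "\<rho> \<in> hom H (aut_group T)"
begin

lemma act_Bij: "g \<in> carrier H \<Longrightarrow> \<rho> g \<in> Bij V"
  and act_edge: "g \<in> carrier H \<Longrightarrow> u \<in> V \<Longrightarrow> v \<in> V \<Longrightarrow> {\<rho> g u, \<rho> g v} \<in> E \<longleftrightarrow> {u, v} \<in> E"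
  using hom unfolding hom_def aut_group_def by auto

lemma act_closed [simp]: "g \<in> carrier H \<Longrightarrow> v \<in> V \<Longrightarrow> \<rho> g v \<in> V"
  using act_Bij Bij_imp_funcset by blast

lemma act_mult:
  assumes "g \<in> carrier H" "h \<in> carrier H" "v \<in> V"
  shows "\<rho> (g \<otimes> h) v = \<rho> g (\<rho> h v)"
proof -
  have "\<rho> (g \<otimes> h) = \<rho> g \<otimes>\<^bsub>aut_group T\<^esub> \<rho> h"
    using hom assms unfolding hom_def by auto
  then show ?thesis
    using act_Bij assms by (simp add: aut_group_def BijGroup_def compose_def)
qed

lemma act_inj: "g \<in> carrier H \<Longrightarrow> u \<in> V \<Longrightarrow> v \<in> V \<Longrightarrow> \<rho> g u = \<rho> g v \<longleftrightarrow> u = v"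
  using act_Bij[of g] unfolding Bij_def bij_betw_def inj_on_def by auto

lemma act_one [simp]:
  assumes "v \<in> V" shows "\<rho> \<one> v = v"
proof -
  have "\<rho> \<one> (\<rho> \<one> v) = \<rho> \<one> v" using act_mult[of \<one> \<one> v] assms by simp
  then show ?thesis using act_inj[of \<one> "\<rho> \<one> v" v] assms by simp
qed

lemma act_inv_cancel [simp]:
  assumes "g \<in> carrier H" "v \<in> V"
  shows "\<rho> (inv g) (\<rho> g v) = v" "\<rho> g (\<rho> (inv g) v) = v"
  using act_mult[of "inv g" g v] act_mult[of g "inv g" v] assms by simp_all

lemma gdist_act:
  assumes g: "g \<in> carrier H" and uv: "u \<in> V" "v \<in> V"
  shows "d (\<rho> g u) (\<rho> g v) = d u v"
proof -
  have *: "d (\<rho> g u) (\<rho> g v) \<le> d u v" if g: "g \<in> carrier H" and uv: "u \<in> V" "v \<in> V" for g u v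
  proof -
    obtain p where p: "gwalk T p" "hd p = u" "last p = v" "length p = Suc (d u v)"
      using gdist_walk[OF uv] by blast
    have "successively (\<lambda>u v. {\<rho> g u, \<rho> g v} \<in> E) p"
      by (rule successively_mono[of "\<lambda>u v. {u, v} \<in> E"])
         (use p(1) act_edge[OF g] in \<open>auto simp: gwalk_def subset_iff\<close>)
    then have "gwalk T (map (\<rho> g) p)"
      using p(1) g unfolding gwalk_def by (auto simp: successively_map)
    from gdist_le[OF this] show ?thesis
      using p by (auto simp: hd_map last_map gwalk_def)
  qed
  from *[OF assms] *[of "inv g" "\<rho> g u" "\<rho> g v"] show ?thesis using assms by simp
qed

section \<open>Pointwise stabilizers and local actions\<close>

definition fixator :: "'v set \<Rightarrow> 'h set" where
  "fixator W = {g \<in> carrier H. \<forall>w\<in>W. \<rho> g w = w}"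

lemma fixator_iff: "g \<in> fixator W \<longleftrightarrow> g \<in> carrier H \<and> (\<forall>w\<in>W. \<rho> g w = w)"
  unfolding fixator_def by simp

lemma fixator_subgroup: assumes "W \<subseteq> V" shows "subgroup (fixator W) H"
proof
  fix g h assume gh: "g \<in> fixator W" "h \<in> fixator W"
  then show "g \<otimes> h \<in> fixator W" using act_mult assms by (auto simp: fixator_iff subset_iff)
next
  fix g assume g: "g \<in> fixator W"
  have "\<rho> (inv g) w = w" if w: "w \<in> W" for w
  proof -
    have "\<rho> (inv g) (\<rho> g w) = w" by (rule act_inv_cancel) (use g w assms in \<open>auto simp: fixator_iff\<close>)
    then show ?thesis using g w by (simp add: fixator_iff)
  qed
  then show "inv g \<in> fixator W" using g by (simp add: fixator_iff)
qed (use assms in \<open>auto simp: fixator_iff\<close>)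

lemma fixator_pow: "W \<subseteq> V \<Longrightarrow> g \<in> fixator W \<Longrightarrow> g [^] (n::nat) \<in> fixator W"
  by (induction n) (simp_all add: subgroup.m_closed[OF fixator_subgroup] subgroup.one_closed[OF fixator_subgroup])

text \<open>Bezout in the form \<open>m * x = n * y + gcd m n\<close> stays within natural
  exponents: the powers with exponents \<open>m * x\<close> and \<open>n * y\<close> both fix
  \<open>w\<close>, so their quotient does.\<close>

lemma fixator_gcd:
  assumes g: "g \<in> carrier H" and w: "w \<in> V" and m: "g [^] (m::nat) \<in> fixator {w}" and n: "g [^] (n::nat) \<in> fixator {w}"
  shows "g [^] (gcd m n) \<in> fixator {w}"
proof (cases "m = 0")
  case False
  obtain x y where xy: "m * x = n * y + gcd m n" using bezout_nat[OF False] by blast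
  have "g [^] (m * x) \<in> fixator {w}" "g [^] (n * y) \<in> fixator {w}"
    using fixator_pow[of "{w}", OF _ m, of x] fixator_pow[of "{w}", OF _ n, of y] w g
    by (simp_all add: nat_pow_pow)
  then have "\<rho> (g [^] (n * y)) (\<rho> (g [^] gcd m n) w) = \<rho> (g [^] (n * y)) w"
    using act_mult[of "g [^] (n * y)" "g [^] gcd m n" w] g w xy by (simp add: nat_pow_mult fixator_iff)
  then show ?thesis using act_inj[of "g [^] (n * y)"] g w by (simp add: fixator_iff)
qed (use n in simp)

text \<open>The permutation occurring in \<open>local_action\<close>, indexed by elements of
  \<open>H\<close> instead of automorphisms, so that it becomes a homomorphism on the stabilizer of
  \<open>v\<close>.\<close>

definition edge_perm :: "'v \<Rightarrow> 'h \<Rightarrow> 'v set \<Rightarrow> 'v set" where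
  "edge_perm v g = restrict (\<lambda>e. \<rho> g ` e) (edges_at T v)"

lemma edge_perm_closed:
  assumes g: "g \<in> fixator {v}" and e: "e \<in> edges_at T v"
  shows "\<rho> g ` e \<in> edges_at T v"
proof -
  obtain u w where uw: "e = {u, w}" using edgeE e unfolding edges_at_def by blast
  then have "u \<in> V" "w \<in> V" using edge_verts e unfolding edges_at_def by blast+
  then have "\<rho> g ` e \<in> E" using act_edge[of g u w] g e uw unfolding edges_at_def fixator_iff by simp
  moreover have "\<rho> g v \<in> \<rho> g ` e" using e unfolding edges_at_def by blast
  ultimately show ?thesis using g unfolding edges_at_def fixator_iff by simp
qed

lemma edge_verts_subset: "e \<in> E \<Longrightarrow> e \<subseteq> V"
  using edge_verts by (metis edgeE empty_subsetI insert_subset)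

lemma edge_perm_mult:
  assumes "v \<in> V" "g \<in> fixator {v}" "h \<in> fixator {v}" "e \<in> edges_at T v"
  shows "\<rho> (g \<otimes> h) ` e = \<rho> g ` \<rho> h ` e"
  unfolding image_image
proof (rule image_cong[OF refl])
  fix w assume "w \<in> e"
  then have "w \<in> V" using assms(4) edge_verts_subset[of e] by (auto simp: edges_at_def)
  then show "\<rho> (g \<otimes> h) w = \<rho> g (\<rho> h w)" using act_mult assms(2,3) by (simp add: fixator_iff)
qed

lemma edge_perm_Bij:
  assumes v: "v \<in> V" and g: "g \<in> fixator {v}"
  shows "edge_perm v g \<in> Bij (edges_at T v)"
proof -
  have ig: "inv g \<in> fixator {v}" using subgroup.m_inv_closed[OF fixator_subgroup] v g by simp
  have gc: "g \<in> carrier H" using g by (simp add: fixator_iff)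
  have one: "\<rho> \<one> ` e = e" if "e \<in> edges_at T v" for e
    using edge_verts_subset[of e] that by (force simp: edges_at_def)
  have 1: "\<rho> (inv g) ` \<rho> g ` e = e" if "e \<in> edges_at T v" for e
    using edge_perm_mult[OF v ig g that] one[OF that] gc by simp
  have 2: "\<rho> g ` \<rho> (inv g) ` e = e" if "e \<in> edges_at T v" for e
    using edge_perm_mult[OF v g ig that] one[OF that] gc by simp
  have "bij_betw (edge_perm v g) (edges_at T v) (edges_at T v)"
    by (rule bij_betw_byWitness[where f' = "\<lambda>e. \<rho> (inv g) ` e"])
       (simp_all add: edge_perm_def 1 2 edge_perm_closed[OF g] edge_perm_closed[OF ig] image_subset_iff)
  moreover have "edge_perm v g \<in> extensional (edges_at T v)" unfolding edge_perm_def by simp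
  ultimately show ?thesis unfolding Bij_def by simp
qed

lemma edge_perm_hom:
  assumes v: "v \<in> V"
  shows "edge_perm v \<in> hom (H\<lparr>carrier := fixator {v}\<rparr>) (BijGroup (edges_at T v))"
proof (rule homI)
  fix g assume "g \<in> carrier (H\<lparr>carrier := fixator {v}\<rparr>)"
  then show "edge_perm v g \<in> carrier (BijGroup (edges_at T v))"
    using edge_perm_Bij[OF v] by (simp add: BijGroup_def)
next
  fix g h assume "g \<in> carrier (H\<lparr>carrier := fixator {v}\<rparr>)" "h \<in> carrier (H\<lparr>carrier := fixator {v}\<rparr>)"
  then have gh: "g \<in> fixator {v}" "h \<in> fixator {v}" by simp_all
  have "edge_perm v (g \<otimes> h) = compose (edges_at T v) (edge_perm v g) (edge_perm v h)"
  proof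
    fix e
    show "edge_perm v (g \<otimes> h) e = compose (edges_at T v) (edge_perm v g) (edge_perm v h) e"
      using edge_perm_mult[OF v gh, of e] edge_perm_closed[OF gh(2), of e]
      by (simp add: edge_perm_def compose_def)
  qed
  then show "edge_perm v (g \<otimes>\<^bsub>H\<lparr>carrier := fixator {v}\<rparr>\<^esub> h)
      = edge_perm v g \<otimes>\<^bsub>BijGroup (edges_at T v)\<^esub> edge_perm v h"
    using edge_perm_Bij[OF v] gh by (simp add: BijGroup_def)
qed

lemma local_action_eq:
  "local_action T (\<rho> ` carrier H) v = BijGroup (edges_at T v) \<lparr>carrier := edge_perm v ` fixator {v}\<rparr>"
proof -
  have "(\<lambda>g. restrict (\<lambda>e. g ` e) (edges_at T v)) ` {g \<in> \<rho> ` carrier H. g v = v} = edge_perm v ` fixator {v}"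
    unfolding edge_perm_def fixator_def by auto
  then show ?thesis unfolding local_action_def by simp
qed

text \<open>By Lagrange the power acts trivially on the edges at \<open>v\<close>; an automorphism
  fixing an edge and its end \<open>v\<close> fixes the other end. If the local action is infinite
  its \<open>order\<close> is 0 and the power is the identity.\<close>

lemma pow_order_local_action:
  assumes v: "v \<in> V" and g: "g \<in> fixator {v}" and e: "{v, w} \<in> E"
  shows "\<rho> (g [^] order (local_action T (\<rho> ` carrier H) v)) w = w"
proof -
  let ?S = "H\<lparr>carrier := fixator {v}\<rparr>" and ?B = "BijGroup (edges_at T v)"
  let ?L = "local_action T (\<rho> ` carrier H) v"
  have gS: "group ?S" by (rule subgroup.subgroup_is_group[OF fixator_subgroup is_group]) (use v in simp)
  have "group_hom ?S ?B (edge_perm v)"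
    using gS group_BijGroup edge_perm_hom[OF v] by (intro group_hom.intro group_hom_axioms.intro)
  then have "subgroup (edge_perm v ` carrier ?S) ?B" by (rule group_hom.img_is_subgroup)
  then have L: "group ?L"
    unfolding local_action_eq using subgroup.subgroup_is_group group_BijGroup by fastforce
  have "edge_perm v \<in> hom ?S ?L"
    using edge_perm_hom[OF v] unfolding local_action_eq hom_def by auto
  then interpret h: group_hom ?S ?L "edge_perm v"
    using gS L by (intro group_hom.intro group_hom_axioms.intro)
  let ?n = "order ?L"
  have gn: "g [^] ?n \<in> fixator {v}" using fixator_pow v g by simp
  have "edge_perm v (g [^]\<^bsub>?S\<^esub> ?n) = edge_perm v g [^]\<^bsub>?L\<^esub> ?n"
    by (rule h.hom_nat_pow) (use g in simp)
  also have "\<dots> = \<one>\<^bsub>?L\<^esub>"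
    by (rule group.pow_order_eq_1[OF L]) (use g local_action_eq in simp)
  also have "\<dots> = (\<lambda>e\<in>edges_at T v. e)" by (simp add: local_action_eq BijGroup_def)
  finally have "edge_perm v (g [^] ?n) = (\<lambda>e\<in>edges_at T v. e)" by (simp add: nat_pow_def)
  moreover have "{v, w} \<in> edges_at T v" using e by (simp add: edges_at_def)
  ultimately have "\<rho> (g [^] ?n) ` {v, w} = {v, w}"
    unfolding edge_perm_def by (metis restrict_apply')
  then have "{v, \<rho> (g [^] ?n) w} = {v, w}" using gn by (simp add: fixator_iff)
  then show ?thesis by (auto simp: doubleton_eq_iff)
qed

end

section \<open>Powers fixing vertex sets of a locally finite tree\<close>

locale lf_tree_action = tree_action T H \<rho>
  for T :: "'v ugraph" and H :: "('h, 'k) monoid_scheme" (structure) and \<rho> +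
  assumes lf: "locally_finite T"
begin

lemma order_local_action_pos:
  assumes "v \<in> V" shows "order (local_action T (\<rho> ` carrier H) v) > 0"
proof -
  have fin: "finite (edges_at T v)" using lf assms by (simp add: locally_finite_def)
  have "edge_perm v ` fixator {v} \<subseteq> edges_at T v \<rightarrow>\<^sub>E edges_at T v"
    unfolding PiE_def
    using Bij_imp_funcset[OF edge_perm_Bij[OF assms]] Bij_imp_extensional[OF edge_perm_Bij[OF assms]]
    by blast
  then have "finite (edge_perm v ` fixator {v})"
    using finite_PiE[OF fin] fin by (meson finite_subset)
  moreover have "edge_perm v \<one> \<in> edge_perm v ` fixator {v}" using assms by (simp add: fixator_iff)
  ultimately show ?thesis unfolding order_def local_action_eq by (auto simp: card_gt_0_iff)
qed

definition vball :: "'v \<Rightarrow> nat \<Rightarrow> 'v set" where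
  "vball p n = {v \<in> V. d p v \<le> n}"

lemma vball_step:
  assumes p: "p \<in> V" and w: "w \<in> vball p (Suc n)" "w \<notin> vball p n"
  obtains v where "v \<in> vball p n" "{v, w} \<in> E"
proof -
  have w': "w \<in> V" "d p w = Suc n" using w unfolding vball_def by auto
  then have "d w p = Suc n" using gdist_commute p by simp
  then obtain q where q: "gwalk T q" "hd q = w" "last q = p" "length q = Suc (Suc n)"
    using gdist_walk[OF w'(1) p] by metis
  then obtain v q' where q': "q = w # v # q'" by (cases q; cases "tl q") auto
  have e: "{w, v} \<in> E" and wk: "gwalk T (v # q')" using q(1) q' by (auto simp: gwalk_def)
  have "d v p \<le> n" using gdist_le[OF wk] q q' by (auto split: if_splits)
  then have "v \<in> vball p n" using edge_verts[OF e] gdist_commute[of v p] p by (simp add: vball_def)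
  then show ?thesis using that e by (simp add: insert_commute)
qed

lemma finite_vball: assumes p: "p \<in> V" shows "finite (vball p n)"
proof (induction n)
  case 0
  have "vball p 0 \<subseteq> {p}" using gdist_eq_0 p by (auto simp: vball_def)
  then show ?case by (rule finite_subset) simp
next
  case (Suc n)
  have *: "vball p (Suc n) \<subseteq> vball p n \<union> (\<Union>v\<in>vball p n. \<Union>(edges_at T v))"
  proof
    fix w assume w: "w \<in> vball p (Suc n)"
    show "w \<in> vball p n \<union> (\<Union>v\<in>vball p n. \<Union>(edges_at T v))"
    proof (cases "w \<in> vball p n")
      case False
      obtain v where "v \<in> vball p n" "{v, w} \<in> E" using vball_step[OF p w False] .
      then show ?thesis by (auto simp: edges_at_def)
    qed simp
  qed
  have "finite e" if "e \<in> edges_at T v" for e v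
  proof -
    have "e \<in> E" using that by (simp add: edges_at_def)
    then obtain u v where "e = {u, v}" by (rule edgeE)
    then show ?thesis by simp
  qed
  moreover have "finite (edges_at T v)" if "v \<in> vball p n" for v
    using that lf by (simp add: vball_def locally_finite_def)
  ultimately have "finite (vball p n \<union> (\<Union>v\<in>vball p n. \<Union>(edges_at T v)))"
    using Suc by (intro finite_UnI finite_UN_I finite_Union) auto
  then show ?case by (rule finite_subset[OF *])
qed

text \<open>
  Fixing the ball of radius \<open>n\<close> costs a power, coprime to \<open>q\<close>: one local order for each
  vertex of the previous ball.
\<close>

lemma coprime_power_fixes_vball:
  assumes g: "g \<in> carrier H" and p: "p \<in> V" "\<rho> g p = p"
    and q: "\<And>v. v \<in> V \<Longrightarrow> coprime q (order (local_action T (\<rho> ` carrier H) v))"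
  shows "\<exists>k>0. coprime k q \<and> g [^] (k::nat) \<in> fixator (vball p n)"
proof (induction n)
  case 0
  have "vball p 0 \<subseteq> {p}" using gdist_eq_0 p by (auto simp: vball_def)
  then have "g [^] (1::nat) \<in> fixator (vball p 0)" using g p by (auto simp: fixator_iff)
  then show ?case by (intro exI[of _ 1]) simp
next
  case (Suc n)
  then obtain k where k: "k > 0" "coprime k q" "g [^] k \<in> fixator (vball p n)" by blast
  let ?o = "\<lambda>v. order (local_action T (\<rho> ` carrier H) v)"
  define m where "m = (\<Prod>v\<in>vball p n. ?o v)"
  have V: "vball p n \<subseteq> V" "vball p (Suc n) \<subseteq> V" by (auto simp: vball_def)
  have fin: "finite (vball p n)" using finite_vball p by blast
  have "m > 0" unfolding m_def using order_local_action_pos V by (auto intro!: prod_pos)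
  moreover have "coprime m q"
    unfolding m_def by (rule prod_coprime_left) (use V q in \<open>auto simp: coprime_commute\<close>)
  moreover have "g [^] (k * m) \<in> fixator (vball p (Suc n))"
    unfolding fixator_iff
  proof (intro conjI ballI)
    fix w assume w: "w \<in> vball p (Suc n)"
    have km: "(g [^] k) [^] m = g [^] (k * m)" using g by (simp add: nat_pow_pow)
    show "\<rho> (g [^] (k * m)) w = w"
    proof (cases "w \<in> vball p n")
      case True
      then show ?thesis using fixator_pow[OF V(1) k(3), of m] km by (simp add: fixator_iff)
    next
      case False
      obtain v where v: "v \<in> vball p n" "{v, w} \<in> E" using vball_step[OF p(1) w False] .
      have vV: "v \<in> V" "w \<in> V" using edge_verts[OF v(2)] by simp_all
      have "?o v dvd m" unfolding m_def using dvd_prodI[OF fin v(1)] .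
      then obtain c where c: "m = ?o v * c" by (rule dvdE)
      have "g [^] k \<in> fixator {v}" using k v by (simp add: fixator_iff)
      then have "(g [^] k) [^] ?o v \<in> fixator {w}"
        using pow_order_local_action[OF vV(1) _ v(2)] g by (simp add: fixator_iff)
      from fixator_pow[OF _ this, of c] show ?thesis
        using vV g c km by (simp add: nat_pow_pow fixator_iff mult.assoc)
    qed
  qed (use g in simp)
  ultimately show ?case using k by (intro exI[of _ "k * m"]) simp
qed

lemma finite_subset_vball:
  assumes "finite W" "W \<subseteq> V" obtains n where "W \<subseteq> vball p n"
proof
  show "W \<subseteq> vball p (Max (d p ` W))" using assms by (auto simp: vball_def)
qed

lemma coprime_power_fixes:
  assumes "g \<in> carrier H" "p \<in> V" "\<rho> g p = p" "finite W" "W \<subseteq> V"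
    and "\<And>v. v \<in> V \<Longrightarrow> coprime q (order (local_action T (\<rho> ` carrier H) v))"
  shows "\<exists>k>0. coprime k q \<and> g [^] (k::nat) \<in> fixator W"
proof -
  obtain n where "W \<subseteq> vball p n" using finite_subset_vball assms by blast
  moreover obtain k where "k > 0" "coprime k q" "g [^] (k::nat) \<in> fixator (vball p n)"
    using coprime_power_fixes_vball[of g p q n] assms by blast
  ultimately show ?thesis by (intro exI[of _ k]) (auto simp: fixator_iff)
qed

text \<open>Dividing \<open>m\<close> by \<open>gcd m q\<close> until the quotient is coprime to
  \<open>q\<close> leaves the part of \<open>m\<close> prime to \<open>q\<close>; a divisor coprime
  to \<open>q\<close> survives every division.\<close>

lemma coprime_part_exists:
  fixes m q :: nat assumes "m > 0"
  shows "\<exists>k>0. coprime k q \<and> (\<forall>j. j dvd m \<and> coprime j q \<longrightarrow> j dvd k)"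
  using assms
proof (induction m rule: less_induct)
  case (less m)
  show ?case
  proof (cases "coprime m q")
    case True
    then show ?thesis using less.prems by blast
  next
    case False
    define c where "c = gcd m q"
    have c: "c > 1" using False less.prems unfolding c_def by (metis coprime_iff_gcd_eq_1 gcd_pos_nat less_one nat_neq_iff)
    obtain m' where m': "m = c * m'" using gcd_dvd1[of m q] unfolding c_def by (rule dvdE)
    then have "0 < m'" "m' < m" using c less.prems by auto
    then obtain k where k: "k > 0" "coprime k q" "\<forall>j. j dvd m' \<and> coprime j q \<longrightarrow> j dvd k"
      using less.IH by blast
    have "j dvd m'" if "j dvd m" "coprime j q" for j
    proof -
      have "coprime j c" using that(2) unfolding c_def by (meson coprime_divisors dvd_refl gcd_dvd2)
      then show ?thesis using that(1) m' by (simp add: coprime_dvd_mult_right_iff)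
    qed
    then show ?thesis using k by blast
  qed
qed

text \<open>
  On the tree \<open>g\<close> generates a group which is residually of order coprime to \<open>q\<close>, so passing to
  a power whose exponent divides a power of \<open>q\<close> does not change the fixed points.
\<close>

lemma coprime_power_fixes_of_power:
  assumes g: "g \<in> carrier H" and p: "p \<in> V" "\<rho> g p = p" and W: "W \<subseteq> V"
    and m: "m > 0" "g [^] (m::nat) \<in> fixator W"
    and q: "\<And>v. v \<in> V \<Longrightarrow> coprime q (order (local_action T (\<rho> ` carrier H) v))"
  shows "\<exists>k>0. coprime k q \<and> g [^] (k::nat) \<in> fixator W"
proof -
  \<comment> \<open>\<open>k\<close> depends on \<open>m\<close> but not on a vertex, so a single
    exponent serves all of \<open>W\<close>, which may be infinite.\<close>
  obtain k where k: "k > 0" "coprime k q" "\<And>j. j dvd m \<Longrightarrow> coprime j q \<Longrightarrow> j dvd k"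
    using coprime_part_exists[OF m(1), of q] by blast
  have "\<rho> (g [^] k) w = w" if w: "w \<in> W" for w
  proof -
    have wV: "w \<in> V" using w W by blast
    obtain l where l: "coprime l q" "g [^] (l::nat) \<in> fixator {w}"
      using coprime_power_fixes[OF g p, of "{w}" q] q wV by blast
    have "g [^] m \<in> fixator {w}" using m w by (simp add: fixator_iff)
    then have f: "g [^] gcd m l \<in> fixator {w}" using fixator_gcd[OF g wV] l by blast
    have "gcd m l dvd k"
      by (rule k(3)) (use l(1) coprime_divisors[of "gcd m l" l q q] in auto)
    then obtain c where "k = gcd m l * c" by (rule dvdE)
    then show ?thesis using fixator_pow[OF _ f, of c] g wV by (simp add: nat_pow_pow fixator_iff)
  qed
  then show ?thesis using k g by (auto simp: fixator_iff)
qed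

text \<open>A multiple of \<open>k\<close> is congruent to 1 modulo \<open>q\<close>. When
  \<open>q\<close> is the order of the image of \<open>g\<close> under a homomorphism, the power so
  obtained has the same image as \<open>g\<close>.\<close>

lemma cong_1_power:
  assumes g: "g \<in> carrier H" and W: "W \<subseteq> V"
    and k: "k > 0" "coprime k (q::nat)" "g [^] (k::nat) \<in> fixator W"
  obtains y where "g [^] (q * y + 1) \<in> fixator W"
proof -
  obtain x y where xy: "k * x = q * y + gcd k q" using bezout_nat[of k q] k(1) by auto
  have "g [^] (k * x) \<in> fixator W" using fixator_pow[OF W k(3), of x] g by (simp add: nat_pow_pow)
  then show ?thesis using that xy k(2) by simp
qed

end

context tree_action begin

text \<open>
  A vertex of minimal displacement lies on an axis: backtracking where two translates of its
  displacement path meet yields a vertex of smaller displacement, or an edge inverted by \<open>g\<close>.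
\<close>

lemma axis_exists:
  assumes g: "g \<in> carrier H"
    and nofix: "\<And>v. v \<in> V \<Longrightarrow> \<rho> g v \<noteq> v" "\<And>v. v \<in> V \<Longrightarrow> \<rho> (g \<otimes> g) v \<noteq> v"
  obtains a l where "gline a" "l > 0" "\<And>i. \<rho> g (a i) = a (i + l)"
proof -
  obtain v0 where "v0 \<in> V" using tree unfolding tree_def gconnected_def by blast
  then obtain v where v: "v \<in> V" and min: "\<And>w. w \<in> V \<Longrightarrow> d v (\<rho> g v) \<le> d w (\<rho> g w)"
    using ex_has_least_nat[of "\<lambda>v. v \<in> V" v0 "\<lambda>v. d v (\<rho> g v)"] by blast
  define n where "n = d v (\<rho> g v)"
  obtain p where p: "gwalk T p" "nonbacktracking p" "hd p = v" "last p = \<rho> g v" "length p = Suc n"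
    using gdist_walk[of v "\<rho> g v"] v g unfolding n_def by auto
  have n0: "n > 0" using gdist_eq_0[of v "\<rho> g v"] nofix(1)[of v] v g unfolding n_def by (cases "d v (\<rho> g v) = 0") auto
  have pV: "p ! i \<in> V" if "i \<le> n" for i using p(1,5) that by (auto simp: gwalk_def subset_iff)
  have p0: "p ! 0 = v" "p ! n = \<rho> g v" using p by (auto simp: hd_conv_nth last_conv_nth gwalk_def)
  have pE: "{p ! i, p ! Suc i} \<in> E" if "i < n" for i
    using p(1,5) that unfolding gwalk_def by (auto simp: successively_conv_nth)
  \<comment> \<open>The translates of the path \<open>p\<close> under the powers of
    \<open>g\<close>, put end to end: the quotient by \<open>n\<close> selects the translate and the
    remainder the position in it.\<close>
  define a where "a i = \<rho> (g [^] (i div int n)) (p ! nat (i mod int n))" for i :: int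
  have nm: "nat (i mod int n) \<le> n" for i using n0 by (simp add: nat_le_iff order.strict_implies_order)
  have per: "\<rho> g (a i) = a (i + int n)" for i
  proof -
    have "g \<otimes> g [^] (i div int n) = g [^] (i div int n + 1)"
      using g int_pow_mult[of g 1 "i div int n"] by (simp add: add.commute)
    then show ?thesis
      unfolding a_def using act_mult[OF g _ pV[OF nm], of "g [^] (i div int n)" i] g n0 by simp
  qed
  have aV: "a i \<in> V" for i unfolding a_def using g pV nm by simp
  have a_p: "a (int i) = p ! i" if "i \<le> n" for i
  proof (cases "i = n")
    case True
    have "a (int n) = \<rho> g (a 0)" using per[of 0] by simp
    also have "a 0 = p ! 0" unfolding a_def using pV[of 0] by simp
    finally show ?thesis using True p0 by simp
  qed (use that pV[of i] n0 in \<open>simp add: a_def\<close>)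
  \<comment> \<open>A \<open>g\<close>-invariant relation between three successive vertices holds
    along all of \<open>a\<close> once it holds over one period.\<close>
  have shift: "P (a i) (a (i + 1)) (a (i + 2))"
    if base: "\<And>i. 0 \<le> i \<Longrightarrow> i < int n \<Longrightarrow> P (a i) (a (i + 1)) (a (i + 2))"
      and inv: "\<And>u v w. u \<in> V \<Longrightarrow> v \<in> V \<Longrightarrow> w \<in> V \<Longrightarrow> P (\<rho> g u) (\<rho> g v) (\<rho> g w) \<longleftrightarrow> P u v w"
    for P i
  proof -
    have st: "P (a (j + int n)) (a (j + int n + 1)) (a (j + int n + 2)) \<longleftrightarrow> P (a j) (a (j + 1)) (a (j + 2))" for j
      using inv[OF aV aV aV, of j "j + 1" "j + 2"] per[of j] per[of "j + 1"] per[of "j + 2"]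
      by (simp add: algebra_simps)
    have "P (a (j + int n * k)) (a (j + int n * k + 1)) (a (j + int n * k + 2)) \<longleftrightarrow> P (a j) (a (j + 1)) (a (j + 2))" for j k
    proof (induction k rule: int_induct[where k = 0])
      case (step1 k)
      then show ?case using st[of "j + int n * k"] by (simp add: algebra_simps)
    next
      case (step2 k)
      then show ?case using st[of "j + int n * (k - 1)"] by (simp add: algebra_simps)
    qed simp
    from this[of "i mod int n" "i div int n"] base[of "i mod int n"] n0 show ?thesis by simp
  qed
  have "gline a"
  proof (rule glineI_local)
    fix i
    show "{a i, a (i + 1)} \<in> E"
    proof (rule shift[where P = "\<lambda>u v w. {u, v} \<in> E"])
      fix i :: int assume i: "0 \<le> i" "i < int n"
      define j where "j = nat i"
      have "i = int j" "j < n" using i unfolding j_def by auto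
      then show "{a i, a (i + 1)} \<in> E" using pE[of j] a_p[of j] a_p[of "Suc j"] by (simp add: add.commute)
    qed (use act_edge[OF g] in blast)
    show "a i \<noteq> a (i + 2)"
    proof (rule shift[where P = "\<lambda>u v w. u \<noteq> w"])
      fix i :: int assume i: "0 \<le> i" "i < int n"
      define j where "j = nat i"
      have j: "i = int j" "j < n" using i unfolding j_def by auto
      show "a i \<noteq> a (i + 2)"
      proof (cases "j + 2 \<le> n")
        case True
        then show ?thesis
          using nonbacktracking_nth[OF p(2), of j] p(5) a_p[of j] a_p[of "j + 2"] j by (simp add: add.commute)
      next
        case False
        then have jn: "n = Suc j" using j by simp
        have a2: "a (i + 2) = \<rho> g (a 1)" using per[of 1] jn j by (simp add: add.commute)
        show ?thesis
        \<comment> \<open>Only the joint of two translates is left. If the displacement is 1, a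
          backtrack there says that \<open>g \<otimes> g\<close> fixes \<open>a 0\<close>, the case
          of an inverted edge.\<close>
        proof (cases "j = 0")
          case True
          then have "a 1 = \<rho> g (a 0)" using per[of 0] jn by simp
          then show ?thesis
            using nofix(2)[OF aV, of 0] act_mult[OF g g aV, of 0] a2 j True by simp
        next
          case False
          \<comment> \<open>\<open>q\<close> is the interior of \<open>p\<close>, leading from
            \<open>a 1\<close> to \<open>a i\<close> in \<open>n - 2\<close> steps. A backtrack
            would mean \<open>\<rho> g (a 1) = a i\<close>, a displacement smaller than the minimum
            \<open>n\<close>.\<close>
          define q where "q = butlast (tl p)"
          obtain x where pq: "p = v # q @ [x]"
            using p jn False unfolding q_def
            by (cases p; cases "tl p" rule: rev_cases) auto
          have ql: "length q = j" using pq p(5) jn by simp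
          have qw: "gwalk T q"
            using gwalk_appendD1[of T q "[x]"] gwalk_appendD2[of T "[v]" "q @ [x]"] p(1) pq ql False by auto
          have "q \<noteq> []" using ql False by auto
          then have "hd q = a 1" using a_p[of 1] pq ql False jn by (simp add: nth_append hd_conv_nth)
          moreover have "last q = a i" using a_p[of j] pq ql False jn j \<open>q \<noteq> []\<close> by (simp add: nth_append last_conv_nth)
          ultimately have "d (a 1) (a i) \<le> j - 1" using gdist_le[OF qw] ql by simp
          then have "d (a 1) (a i) < n" using jn by simp
          moreover have "n \<le> d (a 1) (\<rho> g (a 1))" using min[OF aV, of 1] n_def by simp
          ultimately show ?thesis using a2 by auto
        qed
      qed
    qed (use act_inj[OF g] in blast)
  qed
  then show ?thesis using that[of a "int n"] per n0 by simp
qed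

subsection \<open>The action on the realization\<close>

lemma inv_into_act:
  assumes "g \<in> carrier H" "v \<in> V" shows "inv_into V (\<rho> g) v = \<rho> (inv g) v"
proof -
  have "inj_on (\<rho> g) V" using act_inj assms by (auto simp: inj_on_def)
  then have "inv_into V (\<rho> g) (\<rho> g (\<rho> (inv g) v)) = \<rho> (inv g) v"
    using assms by (intro inv_into_f_f) auto
  then show ?thesis using assms by simp
qed

lemma raction_eq:
  assumes "g \<in> carrier H"
  shows "raction T (\<rho> g) p v = (if v \<in> V then p (\<rho> (inv g) v) else 0)"
  using inv_into_act[OF assms] unfolding raction_def by simp

lemma raction_act:
  assumes "g \<in> carrier H" "v \<in> V" shows "raction T (\<rho> g) p (\<rho> g v) = p v"
  using raction_eq assms by simp

lemma supp_raction:
  assumes g: "g \<in> carrier H" and p: "supp p \<subseteq> V"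
  shows "supp (raction T (\<rho> g) p) = \<rho> g ` supp p"
proof (intro equalityI subsetI)
  fix v assume v: "v \<in> supp (raction T (\<rho> g) p)"
  then have V: "v \<in> V" by (auto simp: supp_def raction_def split: if_splits)
  then have "\<rho> (inv g) v \<in> supp p" using v raction_eq[OF g] by (simp add: supp_def)
  then show "v \<in> \<rho> g ` supp p" using act_inv_cancel(2)[OF g V] by force
next
  fix v assume "v \<in> \<rho> g ` supp p"
  then show "v \<in> supp (raction T (\<rho> g) p)" using raction_act[OF g] p by (auto simp: supp_def)
qed

lemma inj_on_act: "g \<in> carrier H \<Longrightarrow> A \<subseteq> V \<Longrightarrow> inj_on (\<rho> g) A"
  using act_inj by (auto simp: inj_on_def subset_iff)

lemma raction_mult:
  assumes "g \<in> carrier H" "h \<in> carrier H"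
  shows "raction T (\<rho> (g \<otimes> h)) p = raction T (\<rho> g) (raction T (\<rho> h) p)"
proof
  fix v
  show "raction T (\<rho> (g \<otimes> h)) p v = raction T (\<rho> g) (raction T (\<rho> h) p) v"
    using assms act_mult[of "inv h" "inv g" v] by (simp add: raction_eq inv_mult_group)
qed

lemma raction_one:
  assumes "supp p \<subseteq> V" shows "raction T (\<rho> \<one>) p = p"
proof
  fix v
  show "raction T (\<rho> \<one>) p v = p v" using assms by (auto simp: raction_eq supp_def)
qed

lemma barycentre_raction:
  assumes g: "g \<in> carrier H" and p: "p \<in> R"
  shows "barycentre (raction T (\<rho> g) p) h = barycentre p (\<lambda>v. h (\<rho> g v))"
proof -
  note P = realizationD[OF p]
  show ?thesis
    unfolding barycentre_def supp_raction[OF g P(3)] sum.reindex[OF inj_on_act[OF g P(3)]]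
    by (rule sum.cong) (use raction_act[OF g] P(3) in auto)
qed

lemma act_common_edge:
  assumes g: "g \<in> carrier H" and S: "S \<subseteq> V"
  shows "(\<exists>e\<in>E. \<rho> g ` S \<subseteq> e) \<longleftrightarrow> (\<exists>e\<in>E. S \<subseteq> e)"
proof -
  have *: "\<exists>e\<in>E. \<rho> g ` S \<subseteq> e" if g: "g \<in> carrier H" and S: "\<exists>e\<in>E. S \<subseteq> e" for g S
  proof -
    obtain u v where uv: "{u, v} \<in> E" "S \<subseteq> {u, v}" using S edgeE by metis
    then have "{\<rho> g u, \<rho> g v} \<in> E" using act_edge[OF g] edge_verts[OF uv(1)] by simp
    moreover have "\<rho> g ` S \<subseteq> {\<rho> g u, \<rho> g v}" using uv(2) by auto
    ultimately show ?thesis by blast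
  qed
  have "\<rho> (inv g) ` \<rho> g ` S = S" using S g by (force simp: image_image subset_iff)
  then show ?thesis using *[OF g, of S] *[of "inv g" "\<rho> g ` S"] g by auto
qed

lemma raction_realization:
  assumes g: "g \<in> carrier H" and p: "p \<in> R" shows "raction T (\<rho> g) p \<in> R"
proof (rule realizationI)
  note P = realizationD[OF p]
  note S = supp_raction[OF g P(3)]
  show "0 \<le> raction T (\<rho> g) p v" for v using P(1) by (simp add: raction_eq[OF g])
  show "finite (supp (raction T (\<rho> g) p))" "supp (raction T (\<rho> g) p) \<subseteq> V"
    unfolding S using P(2,3) g by auto
  show "(\<Sum>v\<in>supp (raction T (\<rho> g) p). raction T (\<rho> g) p v) = 1"
    using barycentre_raction[OF g p, of "\<lambda>_. 1"] P(4) by (simp add: barycentre_def)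
  fix u v assume uv: "u \<in> supp (raction T (\<rho> g) p)" "v \<in> supp (raction T (\<rho> g) p)" "u \<noteq> v"
  then obtain u' v' where u': "u = \<rho> g u'" "v = \<rho> g v'" "u' \<in> supp p" "v' \<in> supp p" "u' \<noteq> v'"
    unfolding S by auto
  from P(5)[OF u'(3,4,5)] have "{u', v'} \<in> E" "supp p = {u', v'}" by simp_all
  then show "{u, v} \<in> E \<and> supp (raction T (\<rho> g) p) = {u, v}"
    using act_edge[OF g] edge_verts[of u' v'] unfolding S u'(1,2) by simp
qed

lemma rdist_raction:
  assumes g: "g \<in> carrier H" and p: "p \<in> R" and q: "q \<in> R"
  shows "rdist T (raction T (\<rho> g) p) (raction T (\<rho> g) q) = rdist T p q"
proof -
  let ?g = "raction T (\<rho> g)"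
  note P = realizationD[OF p] and Q = realizationD[OF q]
  note SP = supp_raction[OF g P(3)] and SQ = supp_raction[OF g Q(3)]
  have PQ: "supp p \<union> supp q \<subseteq> V" using P(3) Q(3) by simp
  have R: "?g p \<in> R" "?g q \<in> R" using raction_realization g p q by simp_all
  have U: "supp (?g p) \<union> supp (?g q) = \<rho> g ` (supp p \<union> supp q)" unfolding SP SQ by blast
  have iff: "(\<exists>e\<in>E. supp (?g p) \<union> supp (?g q) \<subseteq> e) \<longleftrightarrow> (\<exists>e\<in>E. supp p \<union> supp q \<subseteq> e)"
    unfolding U by (rule act_common_edge[OF g PQ])
  show ?thesis
  proof (cases "\<exists>e\<in>E. supp p \<union> supp q \<subseteq> e")
    case True
    have "(\<Sum>v\<in>supp (?g p) \<union> supp (?g q). \<bar>?g p v - ?g q v\<bar>) = (\<Sum>v\<in>supp p \<union> supp q. \<bar>p v - q v\<bar>)"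
      unfolding U sum.reindex[OF inj_on_act[OF g PQ]]
      by (rule sum.cong) (use PQ raction_act[OF g] in auto)
    then show ?thesis using rdist_common_edge[OF p q True] rdist_common_edge[OF R] iff True by simp
  next
    case False
    have eq: "(\<lambda>(u, v). (1 - ?g p u) + real (d u v) + (1 - ?g q v)) ` (supp (?g p) \<times> supp (?g q))
      = (\<lambda>(u, v). (1 - p u) + real (d u v) + (1 - q v)) ` (supp p \<times> supp q)"
    proof -
      have "supp (?g p) \<times> supp (?g q) = (\<lambda>(u, v). (\<rho> g u, \<rho> g v)) ` (supp p \<times> supp q)"
        unfolding SP SQ by auto
      then show ?thesis unfolding image_image
        using P(3) Q(3) raction_act[OF g] gdist_act[OF g]
        by (simp only: image_image) (rule image_cong, auto simp: subset_iff)
    qed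
    have F: "\<not> (\<exists>e\<in>E. supp (?g p) \<union> supp (?g q) \<subseteq> e)" using iff False by blast
    show ?thesis
      unfolding rdist_no_common_edge[OF p q False] rdist_no_common_edge[OF R F] eq ..
  qed
qed

lemma raction_bij:
  assumes g: "g \<in> carrier H" shows "bij_betw (raction T (\<rho> g)) R R"
proof (rule bij_betw_byWitness[where f' = "raction T (\<rho> (inv g))"])
  show "\<forall>p\<in>R. raction T (\<rho> (inv g)) (raction T (\<rho> g) p) = p"
    using g raction_mult[of "inv g" g] raction_one realizationD(3) by simp
  show "\<forall>p\<in>R. raction T (\<rho> g) (raction T (\<rho> (inv g)) p) = p"
    using g raction_mult[of g "inv g"] raction_one realizationD(3) by simp
qed (use g raction_realization in auto)

lemma raction_line_point:
  assumes g: "g \<in> carrier H" and a: "gline a"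
  shows "raction T (\<rho> g) (line_point a t) = line_point (\<lambda>i. \<rho> g (a i)) t"
proof
  fix v
  have *: "\<rho> (inv g) v = a i \<longleftrightarrow> v = \<rho> g (a i)" if "v \<in> V" for i
    using g that gline_vert[OF a, of i] act_inv_cancel by metis
  show "raction T (\<rho> g) (line_point a t) v = line_point (\<lambda>i. \<rho> g (a i)) t v"
    using * gline_vert[OF a] g by (auto simp: raction_eq line_point_def)
qed

lemma raction_line_point_translation:
  assumes g: "g \<in> carrier H" and a: "gline a" and tr: "\<And>i. \<rho> g (a i) = a (i + l)"
  shows "raction T (\<rho> g) (line_point a t) = line_point a (t + of_int l)"
proof -
  have frac: "frac (t + of_int l) = frac t" by (simp add: frac_def)
  have "line_point (\<lambda>i. a (i + l)) t = line_point a (t + of_int l)"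
    unfolding line_point_def frac by (simp add: algebra_simps)
  then show ?thesis unfolding raction_line_point[OF g a] tr .
qed

text \<open>
  The lower bound comes from the Busemann function of the repelling end of the axis, realized as
  the distance to a far away vertex of the axis.
\<close>

lemma translation_le_rdist:
  assumes g: "g \<in> carrier H" and a: "gline a" and l: "l > 0" and tr: "\<And>i. \<rho> g (a i) = a (i + l)"
    and p: "p \<in> R"
  shows "of_int l \<le> rdist T p (raction T (\<rho> g) p)"
proof -
  note P = realizationD[OF p]
  have "\<exists>k. \<forall>i. int (d w (a i)) = int (d w (a k)) + \<bar>i - k\<bar>" if "w \<in> V" for w
    using gline_projection[OF a that] by metis
  then obtain k where k: "\<And>w i. w \<in> V \<Longrightarrow> int (d w (a i)) = int (d w (a (k w))) + \<bar>i - k w\<bar>" by metis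
  \<comment> \<open>\<open>a n\<close> lies to the left of the projections of all vertices in the
    support, so moving the reference vertex from \<open>n\<close> to \<open>n - l\<close> increases
    each distance by exactly \<open>l\<close>.\<close>
  define n where "n = Min (k ` supp p)"
  have n: "n \<le> k w" if "w \<in> supp p" for w unfolding n_def using that P(2) by simp
  have "real (d (\<rho> g w) (a n)) = real (d w (a n)) + of_int l" if w: "w \<in> supp p" for w
  proof -
    have wV: "w \<in> V" using w P(3) by blast
    have "d (\<rho> g w) (a n) = d w (a (n - l))"
      using gdist_act[OF g wV, of "a (n - l)"] tr[of "n - l"] gline_vert[OF a] by simp
    then show ?thesis using k[OF wV, of n] k[OF wV, of "n - l"] n[OF w] l by linarith
  qed
  then have "barycentre p (\<lambda>w. real (d (\<rho> g w) (a n))) = (\<Sum>w\<in>supp p. p w * (real (d w (a n)) + of_int l))"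
    unfolding barycentre_def by (intro sum.cong) auto
  also have "\<dots> = barycentre p (\<lambda>w. real (d w (a n))) + of_int l * (\<Sum>w\<in>supp p. p w)"
    unfolding barycentre_def by (simp add: distrib_left sum.distrib sum_distrib_left mult.commute)
  also have "\<dots> = barycentre p (\<lambda>w. real (d w (a n))) + of_int l" using P(4) by simp
  finally have "barycentre (raction T (\<rho> g) p) (\<lambda>w. real (d w (a n))) - barycentre p (\<lambda>w. real (d w (a n))) = of_int l"
    using barycentre_raction[OF g p] by simp
  then show ?thesis
    using barycentre_gdist_diff_le_rdist[OF p raction_realization[OF g p] gline_vert[OF a, of n]] by linarith
qed

section \<open>Elements preserving a line\<close>

definition translates :: "'h \<Rightarrow> (int \<Rightarrow> 'v) \<Rightarrow> int \<Rightarrow> bool" where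
  "translates g a u \<longleftrightarrow> (\<forall>i. \<rho> g (a i) = a (i + u))"

lemma translatesD: "translates g a u \<Longrightarrow> \<rho> g (a i) = a (i + u)"
  unfolding translates_def by simp

lemma translates_mult:
  assumes "g \<in> carrier H" "h \<in> carrier H" "gline a" "translates g a u" "translates h a w"
  shows "translates (g \<otimes> h) a (u + w)"
  using assms act_mult[of g h] gline_vert[of a] unfolding translates_def by (simp add: algebra_simps)

lemma translates_inv:
  assumes "g \<in> carrier H" "gline a" "translates g a u"
  shows "translates (inv g) a (- u)"
  unfolding translates_def
proof
  fix i
  have "\<rho> g (a (i + - u)) = a i" using translatesD[OF assms(3), of "i - u"] by simp
  then show "\<rho> (inv g) (a i) = a (i + - u)"
    using act_inv_cancel(1)[OF assms(1) gline_vert[OF assms(2)], of "i + - u"] by simp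
qed

lemma translates_pow:
  assumes "g \<in> carrier H" "gline a" "translates g a u"
  shows "translates (g [^] (n::nat)) a (int n * u)"
proof (induction n)
  case 0
  then show ?case using gline_vert[OF assms(2)] by (simp add: translates_def)
next
  case (Suc n)
  have "translates (g [^] n \<otimes> g) a (int n * u + u)"
    by (rule translates_mult) (use assms Suc in auto)
  then show ?case by (simp add: algebra_simps)
qed

text \<open>The induced map \<open>f\<close> of the integers is an isometry:
  \<open>f 1 - f 0\<close> gives the sign \<open>s\<close>, and the distances to \<open>f 0\<close>
  and \<open>f 1\<close> determine every other value.\<close>

lemma line_preserving:
  assumes g: "g \<in> carrier H" and a: "gline a" and pres: "\<And>i. \<rho> g (a i) \<in> range a"
  obtains s u where "s \<in> {1, -1}" "\<And>i. \<rho> g (a i) = a (s * i + u)"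
proof -
  have "\<exists>f. \<forall>i. \<rho> g (a i) = a (f i)" using pres by (intro choice) auto
  then obtain f where f: "\<And>i. \<rho> g (a i) = a (f i)" by blast
  have iso: "\<bar>f i - f j\<bar> = \<bar>i - j\<bar>" for i j
    using gline_dist[OF a, of "f i" "f j"] gline_dist[OF a, of i j] gdist_act[OF g, of "a i" "a j"]
      gline_vert[OF a] f by simp
  define s where "s = f 1 - f 0"
  have s: "s = 1 \<or> s = -1" using iso[of 1 0] unfolding s_def by arith
  have "f i = s * i + f 0" for i
  proof (cases "s = 1")
    case True
    then have "f 1 = f 0 + 1" unfolding s_def by simp
    then have "f i = i + f 0" using iso[of i 0] iso[of i 1] by arith
    then show ?thesis using True by simp
  next
    case False
    then have "f 1 = f 0 - 1" "s = -1" using s unfolding s_def by simp_all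
    then have "f i = - i + f 0" using iso[of i 0] iso[of i 1] by arith
    then show ?thesis using \<open>s = -1\<close> by simp
  qed
  then have "\<rho> g (a i) = a (s * i + f 0)" for i using f[of i] by metis
  then show ?thesis using that[of s "f 0"] s by blast
qed

end

section \<open>Groups acting discretely on a product of two trees\<close>

text \<open>\<open>discrete\<close> expresses discreteness for pointwise convergence on vertices:
  some neighbourhood of the identity, given by finitely many vertices of the two trees together,
  contains no other element.\<close>

locale tree_pair_action = group H + A1: lf_tree_action T1 H \<rho>1 + A2: lf_tree_action T2 H \<rho>2
  for T1 :: "'v ugraph" and T2 :: "'w ugraph" and H :: "('h, 'k) monoid_scheme" (structure)
    and \<rho>1 and \<rho>2 +
  assumes discrete: "\<exists>F1 F2. finite F1 \<and> F1 \<subseteq> verts T1 \<and> finite F2 \<and> F2 \<subseteq> verts T2 \<and>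
    A1.fixator F1 \<inter> A2.fixator F2 \<subseteq> {\<one>}"
begin

text \<open>Allows results about one factor to be read off for the other.\<close>

lemma swap: "tree_pair_action T2 T1 H \<rho>2 \<rho>1"
proof
  show "\<exists>F2 F1. finite F2 \<and> F2 \<subseteq> verts T2 \<and> finite F1 \<and> F1 \<subseteq> verts T1 \<and>
      A2.fixator F2 \<inter> A1.fixator F1 \<subseteq> {\<one>}"
    using discrete by (metis Int_commute)
qed

lemma discreteE:
  obtains F1 F2 where "finite F1" "F1 \<subseteq> verts T1" "finite F2" "F2 \<subseteq> verts T2"
    "\<And>g h. g \<in> carrier H \<Longrightarrow> h \<in> carrier H \<Longrightarrow> (\<And>v. v \<in> F1 \<Longrightarrow> \<rho>1 g v = \<rho>1 h v) \<Longrightarrow>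
      (\<And>v. v \<in> F2 \<Longrightarrow> \<rho>2 g v = \<rho>2 h v) \<Longrightarrow> g = h"
proof -
  obtain F1 F2 where F: "finite F1" "F1 \<subseteq> verts T1" "finite F2" "F2 \<subseteq> verts T2"
    "A1.fixator F1 \<inter> A2.fixator F2 \<subseteq> {\<one>}" using discrete by blast
  have "g = h" if gh: "g \<in> carrier H" "h \<in> carrier H" and e1: "\<And>v. v \<in> F1 \<Longrightarrow> \<rho>1 g v = \<rho>1 h v"
    and e2: "\<And>v. v \<in> F2 \<Longrightarrow> \<rho>2 g v = \<rho>2 h v" for g h
  proof -
    have "\<rho>1 (inv g \<otimes> h) v = v" if "v \<in> F1" for v
    proof -
      have v: "v \<in> verts T1" using that F by blast
      then have "\<rho>1 (inv g \<otimes> h) v = \<rho>1 (inv g) (\<rho>1 g v)" using A1.act_mult e1[OF that] gh by simp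
      also have "\<dots> = v" using A1.act_inv_cancel(1) gh v by blast
      finally show ?thesis .
    qed
    moreover have "\<rho>2 (inv g \<otimes> h) v = v" if "v \<in> F2" for v
    proof -
      have v: "v \<in> verts T2" using that F by blast
      then have "\<rho>2 (inv g \<otimes> h) v = \<rho>2 (inv g) (\<rho>2 g v)" using A2.act_mult e2[OF that] gh by simp
      also have "\<dots> = v" using A2.act_inv_cancel(1) gh v by blast
      finally show ?thesis .
    qed
    ultimately have "inv g \<otimes> h \<in> A1.fixator F1 \<inter> A2.fixator F2"
      using gh by (simp add: A1.fixator_iff A2.fixator_iff)
    then have "inv g \<otimes> h = \<one>" using F(5) by blast
    then show ?thesis using gh by (metis inv_closed inv_equality inv_inv)
  qed
  then show ?thesis using that F by blast
qed

text \<open>An element fixing \<open>x\<close> and \<open>y\<close> maps \<open>F1\<close> and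
  \<open>F2\<close> into finite balls around these vertices, and by discreteness it is determined by
  its restrictions to \<open>F1\<close> and \<open>F2\<close>.\<close>

lemma finite_stabilizer:
  assumes x: "x \<in> verts T1" and y: "y \<in> verts T2"
  shows "finite {g \<in> carrier H. \<rho>1 g x = x \<and> \<rho>2 g y = y}" (is "finite ?S")
proof -
  obtain F1 F2 where F: "finite F1" "F1 \<subseteq> verts T1" "finite F2" "F2 \<subseteq> verts T2"
    "\<And>g h. g \<in> carrier H \<Longrightarrow> h \<in> carrier H \<Longrightarrow> (\<And>v. v \<in> F1 \<Longrightarrow> \<rho>1 g v = \<rho>1 h v) \<Longrightarrow>
      (\<And>v. v \<in> F2 \<Longrightarrow> \<rho>2 g v = \<rho>2 h v) \<Longrightarrow> g = h"
    by (rule discreteE) blast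
  obtain n1 where n1: "F1 \<subseteq> A1.vball x n1" using A1.finite_subset_vball F by blast
  obtain n2 where n2: "F2 \<subseteq> A2.vball y n2" using A2.finite_subset_vball F by blast
  define f where "f g = (restrict (\<rho>1 g) F1, restrict (\<rho>2 g) F2)" for g
  have "inj_on f ?S"
  proof (rule inj_onI)
    fix g h assume gh: "g \<in> ?S" "h \<in> ?S" "f g = f h"
    show "g = h"
    proof (rule F(5))
      show "\<rho>1 g v = \<rho>1 h v" if "v \<in> F1" for v
        using gh(3) that unfolding f_def by (metis prod.inject restrict_apply')
      show "\<rho>2 g v = \<rho>2 h v" if "v \<in> F2" for v
        using gh(3) that unfolding f_def by (metis prod.inject restrict_apply')
    qed (use gh in auto)
  qed
  moreover have "f ` ?S \<subseteq> (F1 \<rightarrow>\<^sub>E A1.vball x n1) \<times> (F2 \<rightarrow>\<^sub>E A2.vball y n2)"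
  proof
    fix z assume "z \<in> f ` ?S"
    then obtain g where g: "g \<in> carrier H" "\<rho>1 g x = x" "\<rho>2 g y = y" "z = f g" by blast
    have "\<rho>1 g v \<in> A1.vball x n1" if "v \<in> F1" for v
      using A1.gdist_act[OF g(1) x, of v] g n1 that by (auto simp: A1.vball_def)
    moreover have "\<rho>2 g v \<in> A2.vball y n2" if "v \<in> F2" for v
      using A2.gdist_act[OF g(1) y, of v] g n2 that by (auto simp: A2.vball_def)
    ultimately show "z \<in> (F1 \<rightarrow>\<^sub>E A1.vball x n1) \<times> (F2 \<rightarrow>\<^sub>E A2.vball y n2)"
      unfolding g(4) f_def by auto
  qed
  moreover have "finite ((F1 \<rightarrow>\<^sub>E A1.vball x n1) \<times> (F2 \<rightarrow>\<^sub>E A2.vball y n2))"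
    using F A1.finite_vball[OF x] A2.finite_vball[OF y] by (intro finite_cartesian_product finite_PiE)
  ultimately show ?thesis by (meson finite_imageD finite_subset)
qed

text \<open>The elements \<open>g^t h^-t\<close> lie in a finite stabilizer, so two of them
  coincide. Cancelling \<open>g^s\<close> on the left and \<open>h^-t\<close> on the right, which is
  valid for noncommuting \<open>g\<close> and \<open>h\<close>, leaves a common power with exponent
  \<open>r = t - s\<close>.\<close>

lemma powers_agree:
  assumes g: "g \<in> carrier H" and h: "h \<in> carrier H" and x: "x \<in> verts T1" and y: "y \<in> verts T2"
    and "\<And>t::nat. \<rho>1 (g [^] t \<otimes> inv (h [^] t)) x = x" "\<And>t::nat. \<rho>2 (g [^] t \<otimes> inv (h [^] t)) y = y"
  obtains r :: nat where "r > 0" "g [^] r = h [^] r"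
proof -
  define f where "f t = g [^] t \<otimes> inv (h [^] t)" for t :: nat
  have "range f \<subseteq> {g \<in> carrier H. \<rho>1 g x = x \<and> \<rho>2 g y = y}"
    using assms unfolding f_def by auto
  then have "finite (range f)" using finite_stabilizer[OF x y] by (rule finite_subset)
  then have "\<not> inj f" using finite_imageD by blast
  then obtain s t where "s \<noteq> t" "f s = f t" unfolding inj_def by blast
  then obtain s t where st: "s < t" "f s = f t" by (metis nat_neq_iff)
  define r where "r = t - s"
  have t: "t = s + r" using st unfolding r_def by simp
  have "g [^] s \<otimes> inv (h [^] s) = g [^] s \<otimes> (g [^] r \<otimes> inv (h [^] t))"
    using st(2) g h unfolding f_def t by (simp add: nat_pow_mult[symmetric] m_assoc)
  then have "inv (h [^] s) = g [^] r \<otimes> inv (h [^] t)" using g h by simp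
  then have "inv (h [^] s) \<otimes> h [^] t = g [^] r" using g h by (simp add: m_assoc)
  moreover have "inv (h [^] s) \<otimes> h [^] t = h [^] r"
    using h unfolding t by (simp add: nat_pow_mult[symmetric] m_assoc[symmetric])
  ultimately show ?thesis using that[of r] st unfolding r_def by simp
qed

lemma conj_pow:
  assumes "g \<in> carrier H" "h \<in> carrier H"
  shows "(g \<otimes> h \<otimes> inv g) [^] (n::nat) = g \<otimes> h [^] n \<otimes> inv g"
proof (induction n)
  case (Suc n)
  have "(g \<otimes> h \<otimes> inv g) [^] Suc n = g \<otimes> h [^] n \<otimes> inv g \<otimes> (g \<otimes> h \<otimes> inv g)"
    using Suc by simp
  also have "\<dots> = g \<otimes> (h [^] n \<otimes> (inv g \<otimes> g) \<otimes> h) \<otimes> inv g"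
    using assms by (simp only: m_assoc m_closed inv_closed nat_pow_closed)
  finally show ?case using assms by (simp add: m_assoc)
qed (use assms in simp)

lemma commuting_pows:
  assumes "g \<in> carrier H" "h \<in> carrier H" "g \<otimes> h = h \<otimes> g"
  shows "g [^] (m::nat) \<otimes> h [^] (n::nat) = h [^] n \<otimes> g [^] m"
proof -
  have "g [^] m \<otimes> h = h \<otimes> g [^] m" using group_commutes_pow assms by blast
  then have "h \<otimes> g [^] m = g [^] m \<otimes> h" by simp
  then show ?thesis using group_commutes_pow[of h "g [^] m" n] assms by simp
qed

end

text \<open>
  The homomorphism \<open>\<phi>\<close> of the theorem enters only through the assumption \<open>noncomm\<close>, which is symmetric
  in the two trees.
\<close>

locale anti_torus_pair = tree_pair_action T1 T2 H \<rho>1 \<rho>2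
  for T1 :: "'v ugraph" and T2 :: "'w ugraph" and H :: "('h, 'k) monoid_scheme" (structure)
    and \<rho>1 and \<rho>2 +
  fixes \<gamma>1 \<gamma>2 :: 'h and x1 :: 'v and x2 :: 'w and q1 q2 :: nat
  assumes \<gamma>: "\<gamma>1 \<in> carrier H" "\<gamma>2 \<in> carrier H"
    and x: "x1 \<in> verts T1" "x2 \<in> verts T2" "\<rho>1 \<gamma>1 x1 = x1" "\<rho>2 \<gamma>2 x2 = x2"
    and q1: "\<And>v. v \<in> verts T1 \<Longrightarrow> coprime q1 (order (local_action T1 (\<rho>1 ` carrier H) v))"
    and q2: "\<And>v. v \<in> verts T2 \<Longrightarrow> coprime q2 (order (local_action T2 (\<rho>2 ` carrier H) v))"
    and noncomm: "\<And>a b. \<gamma>1 [^] (q1 * a + 1) \<otimes> \<gamma>2 [^] (q2 * b + 1) \<noteq> \<gamma>2 [^] (q2 * b + 1) \<otimes> \<gamma>1 [^] (q1 * a + 1)"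
begin

section \<open>Noncommuting powers and their consequences\<close>

lemma swap_anti_torus_pair: "anti_torus_pair T2 T1 H \<rho>2 \<rho>1 \<gamma>2 \<gamma>1 x2 x1 q2 q1"
  using swap \<gamma> x q1 q2 noncomm
  by (intro anti_torus_pair.intro anti_torus_pair_axioms.intro) (auto simp: eq_commute)

text \<open>Some power of \<open>\<gamma>1\<close> fixes the finite set \<open>B\<close> of the
  first \<open>n\<close> translates of \<open>F\<close>. Its \<open>m\<close>-th power commutes with
  \<open>\<gamma>2 [^] n\<close>, and hence fixes every translate of \<open>B\<close> by a power of
  that element. These translates exhaust the orbit, since an exponent \<open>l\<close> splits into
  quotient and remainder modulo \<open>n\<close>.\<close>

lemma fixes_orbit:
  assumes F: "finite F" "F \<subseteq> verts T1" and mn: "m > 0" "n > 0"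
    and comm: "\<gamma>1 [^] (m::nat) \<otimes> \<gamma>2 [^] (n::nat) = \<gamma>2 [^] n \<otimes> \<gamma>1 [^] m"
  shows "\<exists>a. \<gamma>1 [^] (q1 * a + 1) \<in> A1.fixator (\<Union>l::nat. \<rho>1 (\<gamma>2 [^] l) ` F)"
proof -
  define B where "B = (\<Union>r<n. \<rho>1 (\<gamma>2 [^] r) ` F)"
  define W where "W = (\<Union>l::nat. \<rho>1 (\<gamma>2 [^] l) ` F)"
  have BV: "finite B" "B \<subseteq> verts T1" "W \<subseteq> verts T1"
    using F \<gamma> unfolding B_def W_def by auto
  obtain k where k: "k > 0" "\<gamma>1 [^] (k::nat) \<in> A1.fixator B"
    using A1.coprime_power_fixes[OF \<gamma>(1) x(1,3) BV(1,2) q1] by blast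
  have "\<gamma>1 [^] (m * k) \<in> A1.fixator W"
    unfolding A1.fixator_iff
  proof (intro conjI ballI)
    fix w assume "w \<in> W"
    then obtain l f where lf: "w = \<rho>1 (\<gamma>2 [^] (l::nat)) f" "f \<in> F" unfolding W_def by blast
    have f: "f \<in> verts T1" using lf F by blast
    let ?b = "\<rho>1 (\<gamma>2 [^] (l mod n)) f" and ?t = "(\<gamma>2 [^] n) [^] (l div n)"
    have "l mod n < n" using mn by simp
    then have b: "?b \<in> B" using lf unfolding B_def by blast
    have bV: "?b \<in> verts T1" using b BV by blast
    have tc: "?t \<in> carrier H" using \<gamma> by simp
    have "\<gamma>2 [^] l = ?t \<otimes> \<gamma>2 [^] (l mod n)"
      using \<gamma> by (simp add: nat_pow_pow nat_pow_mult)
    then have w: "w = \<rho>1 ?t ?b" using A1.act_mult \<gamma> f lf by simp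
    have s: "\<gamma>1 [^] (m * k) = (\<gamma>1 [^] m) [^] k" "\<gamma>1 [^] (m * k) = (\<gamma>1 [^] k) [^] m"
      using \<gamma> by (simp_all add: nat_pow_pow mult.commute)
    have "\<rho>1 (\<gamma>1 [^] (m * k)) w = \<rho>1 (\<gamma>1 [^] (m * k) \<otimes> ?t) ?b"
      using A1.act_mult[OF _ tc bV] \<gamma> w by simp
    also have "\<gamma>1 [^] (m * k) \<otimes> ?t = ?t \<otimes> \<gamma>1 [^] (m * k)"
      unfolding s(1) by (rule commuting_pows) (use \<gamma> comm in auto)
    also have "\<rho>1 (?t \<otimes> \<gamma>1 [^] (m * k)) ?b = \<rho>1 ?t (\<rho>1 (\<gamma>1 [^] (m * k)) ?b)"
      using A1.act_mult[OF tc _ bV] \<gamma> by simp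
    also have "\<rho>1 (\<gamma>1 [^] (m * k)) ?b = ?b"
      using A1.fixator_pow[OF BV(2) k(2), of m] b unfolding s(2) A1.fixator_iff by blast
    finally show "\<rho>1 (\<gamma>1 [^] (m * k)) w = w" using w by simp
  qed (use \<gamma> in simp)
  then obtain j where "j > 0" "coprime j q1" "\<gamma>1 [^] (j::nat) \<in> A1.fixator W"
    using A1.coprime_power_fixes_of_power[OF \<gamma>(1) x(1,3) BV(3) _ _ q1] mn k by (metis nat_0_less_mult_iff)
  then show ?thesis using A1.cong_1_power[OF \<gamma>(1) BV(3)] unfolding W_def by metis
qed

lemma no_commuting_powers:
  assumes mn: "m > 0" "n > 0"
  shows "\<gamma>1 [^] (m::nat) \<otimes> \<gamma>2 [^] (n::nat) \<noteq> \<gamma>2 [^] n \<otimes> \<gamma>1 [^] m"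
proof
  assume comm: "\<gamma>1 [^] m \<otimes> \<gamma>2 [^] n = \<gamma>2 [^] n \<otimes> \<gamma>1 [^] m"
  interpret S: anti_torus_pair T2 T1 H \<rho>2 \<rho>1 \<gamma>2 \<gamma>1 x2 x1 q2 q1 by (rule swap_anti_torus_pair)
  obtain F1 F2 where F: "finite F1" "F1 \<subseteq> verts T1" "finite F2" "F2 \<subseteq> verts T2"
    "\<And>g h. g \<in> carrier H \<Longrightarrow> h \<in> carrier H \<Longrightarrow> (\<And>v. v \<in> F1 \<Longrightarrow> \<rho>1 g v = \<rho>1 h v) \<Longrightarrow>
      (\<And>v. v \<in> F2 \<Longrightarrow> \<rho>2 g v = \<rho>2 h v) \<Longrightarrow> g = h"
    by (rule discreteE) blast
  obtain a where a: "\<gamma>1 [^] (q1 * a + 1) \<in> A1.fixator (\<Union>l::nat. \<rho>1 (\<gamma>2 [^] l) ` F1)"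
    using fixes_orbit[OF F(1,2) mn comm] by blast
  obtain b where b: "\<gamma>2 [^] (q2 * b + 1) \<in> A2.fixator (\<Union>l::nat. \<rho>2 (\<gamma>1 [^] l) ` F2)"
    using S.fixes_orbit[OF F(3,4) mn(2,1) comm[symmetric]] by blast
  let ?\<alpha> = "\<gamma>1 [^] (q1 * a + 1)" and ?\<beta> = "\<gamma>2 [^] (q2 * b + 1)"
  have c: "?\<alpha> \<in> carrier H" "?\<beta> \<in> carrier H" using \<gamma> by (simp_all del: nat_pow_Suc)
  \<comment> \<open>Holds for every exponent \<open>l\<close>, hence also for the exponent of
    \<open>?\<beta>\<close>, which was obtained independently of \<open>?\<alpha>\<close>.\<close>
  have fa: "\<rho>1 ?\<alpha> (\<rho>1 (\<gamma>2 [^] l) v) = \<rho>1 (\<gamma>2 [^] l) v" if "v \<in> F1" for l :: nat and v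
    using a that unfolding A1.fixator_iff by blast
  have fb: "\<rho>2 ?\<beta> (\<rho>2 (\<gamma>1 [^] l) v) = \<rho>2 (\<gamma>1 [^] l) v" if "v \<in> F2" for l :: nat and v
    using b that unfolding A2.fixator_iff by blast
  have "?\<alpha> \<otimes> ?\<beta> = ?\<beta> \<otimes> ?\<alpha>"
  proof (rule F(5))
    fix v assume v: "v \<in> F1"
    then have vV: "v \<in> verts T1" using F by blast
    have "\<rho>1 ?\<alpha> v = v" using fa[OF v, of 0] vV by simp
    moreover have "\<rho>1 ?\<alpha> (\<rho>1 ?\<beta> v) = \<rho>1 ?\<beta> v" by (rule fa[OF v])
    ultimately show "\<rho>1 (?\<alpha> \<otimes> ?\<beta>) v = \<rho>1 (?\<beta> \<otimes> ?\<alpha>) v"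
      unfolding A1.act_mult[OF c vV] A1.act_mult[OF c(2,1) vV] by (simp only:)
  next
    fix v assume v: "v \<in> F2"
    then have vV: "v \<in> verts T2" using F by blast
    have "\<rho>2 ?\<beta> v = v" using fb[OF v, of 0] vV by simp
    moreover have "\<rho>2 ?\<beta> (\<rho>2 ?\<alpha> v) = \<rho>2 ?\<alpha> v" by (rule fb[OF v])
    ultimately show "\<rho>2 (?\<alpha> \<otimes> ?\<beta>) v = \<rho>2 (?\<beta> \<otimes> ?\<alpha>) v"
      unfolding A2.act_mult[OF c vV] A2.act_mult[OF c(2,1) vV] by (simp only:)
  qed (use c in \<open>simp_all only: m_closed\<close>)
  then show False using noncomm by blast
qed

text \<open>If \<open>?\<alpha>\<close> acted trivially on the first tree, it would commute there
  with everything. A power of \<open>\<gamma>2\<close> fixing \<open>F2\<close> and its image under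
  \<open>?\<alpha>\<close> commutes with it on \<open>F2\<close> too, which
  \<open>no_commuting_powers\<close> excludes.\<close>

lemma infinite_order:
  assumes k: "k > 0" shows "\<exists>v\<in>verts T1. \<rho>1 (\<gamma>1 [^] (k::nat)) v \<noteq> v"
proof (rule ccontr)
  assume "\<not> ?thesis"
  then have triv: "\<rho>1 (\<gamma>1 [^] k) v = v" if "v \<in> verts T1" for v using that by blast
  let ?\<alpha> = "\<gamma>1 [^] k"
  have c: "?\<alpha> \<in> carrier H" using \<gamma> by simp
  obtain F1 F2 where F: "finite F1" "F1 \<subseteq> verts T1" "finite F2" "F2 \<subseteq> verts T2"
    "\<And>g h. g \<in> carrier H \<Longrightarrow> h \<in> carrier H \<Longrightarrow> (\<And>v. v \<in> F1 \<Longrightarrow> \<rho>1 g v = \<rho>1 h v) \<Longrightarrow>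
      (\<And>v. v \<in> F2 \<Longrightarrow> \<rho>2 g v = \<rho>2 h v) \<Longrightarrow> g = h"
    by (rule discreteE) blast
  have fin: "finite (F2 \<union> \<rho>2 ?\<alpha> ` F2)" using F by simp
  have sub: "F2 \<union> \<rho>2 ?\<alpha> ` F2 \<subseteq> verts T2"
    using F(4) A2.act_closed[OF c] by (auto simp: subset_iff)
  obtain n where n: "n > 0" "\<gamma>2 [^] (n::nat) \<in> A2.fixator (F2 \<union> \<rho>2 ?\<alpha> ` F2)"
    using A2.coprime_power_fixes[OF \<gamma>(2) x(2,4) fin sub q2] by blast
  let ?\<beta> = "\<gamma>2 [^] n"
  have c': "?\<beta> \<in> carrier H" using \<gamma> by simp
  have "?\<alpha> \<otimes> ?\<beta> = ?\<beta> \<otimes> ?\<alpha>"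
  proof (rule F(5))
    show "\<rho>1 (?\<alpha> \<otimes> ?\<beta>) v = \<rho>1 (?\<beta> \<otimes> ?\<alpha>) v" if "v \<in> F1" for v
    proof -
      have "v \<in> verts T1" using that F by blast
      then show ?thesis using A1.act_mult c c' triv by simp
    qed
    show "\<rho>2 (?\<alpha> \<otimes> ?\<beta>) v = \<rho>2 (?\<beta> \<otimes> ?\<alpha>) v" if "v \<in> F2" for v
    proof -
      have "v \<in> verts T2" using that F by blast
      moreover have "\<rho>2 ?\<beta> v = v" "\<rho>2 ?\<beta> (\<rho>2 ?\<alpha> v) = \<rho>2 ?\<alpha> v"
        using n(2) that unfolding A2.fixator_iff by blast+
      ultimately show ?thesis using A2.act_mult c c' by simp
    qed
  qed (use c c' in auto)
  then show False using no_commuting_powers k n by blast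
qed

text \<open>A power of \<open>\<gamma>1\<close> fixing \<open>y\<close> also fixes
  \<open>x1\<close>, so it lies in a finite stabilizer. Comparing its powers with those of
  \<open>\<one>\<close> shows that it is torsion, against \<open>infinite_order\<close>.\<close>

lemma powers_no_fixed_vertex:
  assumes k: "k > 0" and y: "y \<in> verts T2" shows "\<rho>2 (\<gamma>1 [^] (k::nat)) y \<noteq> y"
proof
  assume fixed: "\<rho>2 (\<gamma>1 [^] k) y = y"
  have c: "\<gamma>1 [^] k \<in> carrier H" using \<gamma> by simp
  have "\<gamma>1 \<in> A1.fixator {x1}" using x \<gamma> by (simp add: A1.fixator_iff)
  then have "(\<gamma>1 [^] k) [^] t \<in> A1.fixator {x1}" for t :: nat
    using A1.fixator_pow x by simp
  moreover have "\<gamma>1 [^] k \<in> A2.fixator {y}" using c fixed by (simp add: A2.fixator_iff)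
  then have "(\<gamma>1 [^] k) [^] t \<in> A2.fixator {y}" for t :: nat using A2.fixator_pow y by simp
  ultimately have "\<rho>1 ((\<gamma>1 [^] k) [^] t \<otimes> inv (\<one> [^] t)) x1 = x1"
    "\<rho>2 ((\<gamma>1 [^] k) [^] t \<otimes> inv (\<one> [^] t)) y = y" for t :: nat
    using c by (simp_all add: A1.fixator_iff A2.fixator_iff)
  then obtain r where r: "r > 0" "(\<gamma>1 [^] k) [^] r = \<one> [^] (r::nat)"
    by (rule powers_agree[OF c one_closed x(1) y])
  then have "\<gamma>1 [^] (k * r) = \<one>" using \<gamma> by (simp add: nat_pow_pow)
  then show False using infinite_order[of "k * r"] k r by auto
qed

text \<open>The exponents 1 and 2 in \<open>powers_no_fixed_vertex\<close> rule out fixed vertices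
  and inverted edges respectively.\<close>

lemma axis:
  obtains a l where "A2.gline a" "l > 0" "A2.translates \<gamma>1 a l"
proof -
  have "\<rho>2 \<gamma>1 v \<noteq> v" "\<rho>2 (\<gamma>1 \<otimes> \<gamma>1) v \<noteq> v" if "v \<in> verts T2" for v
    using powers_no_fixed_vertex[of 1 v] powers_no_fixed_vertex[of 2 v] that \<gamma>
    by (simp_all add: numeral_2_eq_2)
  then obtain a l where "A2.gline a" "l > 0" "\<And>i. \<rho>2 \<gamma>1 (a i) = a (i + l)"
    using A2.axis_exists[OF \<gamma>(1)] by blast
  then show ?thesis using that[of a l] unfolding A2.translates_def by simp
qed

text \<open>The exponents are taken crosswise, \<open>nat w\<close> for \<open>\<gamma>1\<close> and
  \<open>nat l\<close> for \<open>h\<close>, so that \<open>g\<close> and \<open>h'\<close>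
  translate \<open>a2\<close> by the same amount while both fix \<open>a1 0\<close>. The products in
  \<open>powers_agree\<close> then fix \<open>a1 0\<close> and \<open>a2 0\<close>.\<close>

lemma power_of_flat_translation:
  assumes a: "A1.gline a1" "A2.gline a2" and l: "l > 0" "A2.translates \<gamma>1 a2 l"
    and h: "h \<in> carrier H" "A1.translates h a1 0" "A2.translates h a2 w" "w > 0"
  obtains m n :: nat where "m > 0" "\<gamma>1 [^] m = h [^] n"
proof -
  have V: "a1 0 \<in> verts T1" "a2 0 \<in> verts T2" using A1.gline_vert A2.gline_vert a by blast+
  have fin: "finite {a1 0}" and sub: "{a1 0} \<subseteq> verts T1" using V by simp_all
  obtain k where k: "k > 0" "\<gamma>1 [^] (k::nat) \<in> A1.fixator {a1 0}"
    using A1.coprime_power_fixes[OF \<gamma>(1) x(1,3) fin sub q1] by blast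
  define g where "g = \<gamma>1 [^] (k * nat w)"
  define h' where "h' = h [^] (k * nat l)"
  have c: "g \<in> carrier H" "h' \<in> carrier H" using \<gamma> h unfolding g_def h'_def by simp_all
  have g1: "g \<in> A1.fixator {a1 0}"
    using A1.fixator_pow[OF _ k(2), of "nat w"] V \<gamma> unfolding g_def by (simp add: nat_pow_pow)
  have g2: "A2.translates g a2 (int (k * nat w) * l)"
    unfolding g_def by (rule A2.translates_pow[OF \<gamma>(1) a(2) l(2)])
  have h1: "A1.translates h' a1 0"
    using A1.translates_pow[OF h(1) a(1) h(2)] unfolding h'_def by simp
  have h2: "A2.translates h' a2 (int (k * nat w) * l)"
    using A2.translates_pow[OF h(1) a(2) h(3), of "k * nat l"] h(4) l unfolding h'_def by (simp add: ac_simps)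
  obtain r where "r > 0" "g [^] r = h' [^] (r::nat)"
  proof (rule powers_agree[OF c V])
    fix t :: nat
    have gt: "g [^] t \<in> A1.fixator {a1 0}" using A1.fixator_pow[OF _ g1] V by simp
    have "A1.translates (inv (h' [^] t)) a1 0"
      using A1.translates_inv[OF _ a(1) A1.translates_pow[OF c(2) a(1) h1, of t]] c by simp
    then have "\<rho>1 (inv (h' [^] t)) (a1 0) = a1 0" using A1.translatesD[of _ a1 0 0] by simp
    then show "\<rho>1 (g [^] t \<otimes> inv (h' [^] t)) (a1 0) = a1 0"
      using A1.act_mult[of "g [^] t" "inv (h' [^] t)" "a1 0"] gt c V by (simp add: A1.fixator_iff)
    let ?u = "int t * (int (k * nat w) * l)"
    have "A2.translates (g [^] t \<otimes> inv (h' [^] t)) a2 (?u + - ?u)"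
      by (intro A2.translates_mult A2.translates_inv A2.translates_pow a c g2 h2 nat_pow_closed inv_closed)
    then show "\<rho>2 (g [^] t \<otimes> inv (h' [^] t)) (a2 0) = a2 0" using A2.translatesD[of _ a2 _ 0] by simp
  qed
  then show ?thesis
    using that[of "k * nat w * r" "k * nat l * r"] k h(4) \<gamma> h(1) unfolding g_def h'_def by (simp add: nat_pow_pow)
qed

end

section \<open>Symmetries of the flat on its vertices\<close>

context tree_pair_action begin

text \<open>
  What a cocompact stabilizer of the flat spanned by \<open>a1\<close> and \<open>a2\<close> gives on its vertices, which
  are indexed by pairs of integers.
\<close>

definition covers_flat :: "(int \<Rightarrow> 'v) \<Rightarrow> (int \<Rightarrow> 'w) \<Rightarrow> (int \<times> int) set \<Rightarrow> bool" where
  "covers_flat a1 a2 C \<longleftrightarrow> (\<forall>i j. \<exists>g\<in>carrier H. \<exists>(c1, c2)\<in>C. \<rho>1 g (a1 c1) = a1 i \<and> \<rho>2 g (a2 c2) = a2 j \<and>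
     (\<forall>k. \<rho>1 g (a1 k) \<in> range a1 \<and> \<rho>2 g (a2 k) \<in> range a2))"

text \<open>
  By pigeonhole, two elements carry the same vertex to the vertices of index \<open>(m, 0)\<close> and \<open>(n, 0)\<close>
  with the same effect on the orientations of both lines; their quotient is a translation.
\<close>

lemma horizontal_translation:
  assumes a: "A1.gline a1" "A2.gline a2" and C: "finite C" "covers_flat a1 a2 C"
  obtains h u where "h \<in> carrier H" "u > 0" "A1.translates h a1 u" "A2.translates h a2 0"
proof -
  \<comment> \<open>Records an element reaching \<open>(n, 0)\<close>, the vertex of
    \<open>C\<close> it starts from, and its action on the two lines as a sign and an offset for
    each.\<close>
  define good where "good n = (\<lambda>(g, c1, c2, s1, s2, u1, u2). g \<in> carrier H \<and> (c1, c2) \<in> C \<and>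
    s1 \<in> {1, -1} \<and> s2 \<in> {1, -1} \<and> (\<forall>i. \<rho>1 g (a1 i) = a1 (s1 * i + u1)) \<and>
    (\<forall>j. \<rho>2 g (a2 j) = a2 (s2 * j + u2)) \<and> s1 * c1 + u1 = int n \<and> s2 * c2 + u2 = 0)" for n
  have "\<exists>z. good n z" for n
  proof -
    obtain g c1 c2 where g: "g \<in> carrier H" "(c1, c2) \<in> C" "\<rho>1 g (a1 c1) = a1 (int n)" "\<rho>2 g (a2 c2) = a2 0"
      "\<And>k. \<rho>1 g (a1 k) \<in> range a1" "\<And>k. \<rho>2 g (a2 k) \<in> range a2"
      using C(2)[unfolded covers_flat_def, rule_format, of "int n" 0] by blast
    obtain s1 u1 where 1: "s1 \<in> {1, -1}" "\<And>i. \<rho>1 g (a1 i) = a1 (s1 * i + u1)"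
      using A1.line_preserving[OF g(1) a(1) g(5)] by blast
    obtain s2 u2 where 2: "s2 \<in> {1, -1}" "\<And>i. \<rho>2 g (a2 i) = a2 (s2 * i + u2)"
      using A2.line_preserving[OF g(1) a(2) g(6)] by blast
    have "s1 * c1 + u1 = int n" "s2 * c2 + u2 = 0"
      using g(3,4) 1(2)[of c1] 2(2)[of c2] A1.gline_inj[OF a(1)] A2.gline_inj[OF a(2)] by simp_all
    then have "good n (g, c1, c2, s1, s2, u1, u2)" using g(1,2) 1 2 unfolding good_def by simp
    then show ?thesis by blast
  qed
  then obtain z where z: "\<And>n. good n (z n)" by metis
  \<comment> \<open>The offsets are left out because start, sign and target determine them; what
    remains ranges over a finite set.\<close>
  define key where "key n = (case z n of (g, c1, c2, s1, s2, u1, u2) \<Rightarrow> (c1, c2, s1, s2))" for n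
  have "range key \<subseteq> (\<lambda>((c1, c2), s1, s2). (c1, c2, s1, s2)) ` (C \<times> {1, -1} \<times> {1, -1})"
  proof
    fix k assume "k \<in> range key"
    then obtain n where n: "k = key n" by blast
    obtain g c1 c2 s1 s2 u1 u2 where zn: "z n = (g, c1, c2, s1, s2, u1, u2)" by (metis surj_pair)
    then have "((c1, c2), s1, s2) \<in> C \<times> {1, -1} \<times> {1, -1}" "k = (c1, c2, s1, s2)"
      using z[of n] n unfolding good_def key_def by auto
    then show "k \<in> (\<lambda>((c1, c2), s1, s2). (c1, c2, s1, s2)) ` (C \<times> {1, -1} \<times> {1, -1})" by force
  qed
  then have "finite (range key)" using C(1) by (meson finite.emptyI finite_SigmaI finite_imageI finite_insert finite_subset)
  then have "\<not> inj key" using finite_imageD by blast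
  then obtain m n where "m \<noteq> n" "key m = key n" unfolding inj_def by blast
  then obtain m n where mn: "m < n" "key m = key n" by (metis nat_neq_iff)
  obtain g c1 c2 s1 s2 u1 u2 where zm: "z m = (g, c1, c2, s1, s2, u1, u2)" by (metis surj_pair)
  obtain g' v1 v2 where zn: "z n = (g', c1, c2, s1, s2, v1, v2)"
    using mn zm unfolding key_def by (cases "z n") auto
  have gm: "g \<in> carrier H" "s1 * s1 = 1" "s2 * s2 = 1" "\<And>i. \<rho>1 g (a1 i) = a1 (s1 * i + u1)"
    "\<And>i. \<rho>2 g (a2 i) = a2 (s2 * i + u2)" "s1 * c1 + u1 = int m" "s2 * c2 + u2 = 0"
    using z[of m] zm unfolding good_def by auto
  have gn: "g' \<in> carrier H" "\<And>i. \<rho>1 g' (a1 i) = a1 (s1 * i + v1)"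
    "\<And>i. \<rho>2 g' (a2 i) = a2 (s2 * i + v2)" "s1 * c1 + v1 = int n" "s2 * c2 + v2 = 0"
    using z[of n] zn unfolding good_def by auto
  \<comment> \<open>The equal signs cancel in the quotient, and equal starting vertices make the
    offsets differ by \<open>n - m\<close> on the first line and by 0 on the second.\<close>
  define h where "h = g' \<otimes> inv g"
  have "A1.translates h a1 (v1 - u1)"
    unfolding A1.translates_def
  proof
    fix i
    have ss: "s1 * (s1 * (i - u1)) = i - u1" using gm(2) by (simp add: mult.assoc[symmetric])
    have "\<rho>1 g (a1 (s1 * (i - u1))) = a1 i"
      unfolding gm(4) ss by simp
    then have "\<rho>1 (inv g) (a1 i) = a1 (s1 * (i - u1))"
      using A1.act_inv_cancel(1)[OF gm(1) A1.gline_vert[OF a(1)], of "s1 * (i - u1)"] by simp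
    then have "\<rho>1 h (a1 i) = \<rho>1 g' (a1 (s1 * (i - u1)))"
      unfolding h_def using A1.act_mult gm(1) gn(1) A1.gline_vert[OF a(1)] by simp
    also have "\<dots> = a1 (i + (v1 - u1))"
      unfolding gn(2) ss by (simp add: algebra_simps)
    finally show "\<rho>1 h (a1 i) = a1 (i + (v1 - u1))" .
  qed
  moreover have "A2.translates h a2 (v2 - u2)"
    unfolding A2.translates_def
  proof
    fix i
    have ss: "s2 * (s2 * (i - u2)) = i - u2" using gm(3) by (simp add: mult.assoc[symmetric])
    have "\<rho>2 g (a2 (s2 * (i - u2))) = a2 i"
      unfolding gm(5) ss by simp
    then have "\<rho>2 (inv g) (a2 i) = a2 (s2 * (i - u2))"
      using A2.act_inv_cancel(1)[OF gm(1) A2.gline_vert[OF a(2)], of "s2 * (i - u2)"] by simp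
    then have "\<rho>2 h (a2 i) = \<rho>2 g' (a2 (s2 * (i - u2)))"
      unfolding h_def using A2.act_mult gm(1) gn(1) A2.gline_vert[OF a(2)] by simp
    also have "\<dots> = a2 (i + (v2 - u2))"
      unfolding gn(3) ss by (simp add: algebra_simps)
    finally show "\<rho>2 h (a2 i) = a2 (i + (v2 - u2))" .
  qed
  moreover have "v1 - u1 > 0" "v2 - u2 = 0" using gm(6,7) gn(4,5) mn(1) by linarith+
  ultimately show ?thesis using that[of h "v1 - u1"] gm(1) gn(1) unfolding h_def by simp
qed

end

context anti_torus_pair begin

text \<open>The pigeonhole argument yields \<open>h\<close> translating \<open>a1\<close> and
  \<open>h'\<close> translating \<open>a2\<close>, each fixing the other line pointwise. Conjugating
  \<open>h'\<close> by \<open>h\<close> does not change its action on the lines, so by finiteness of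
  stabilizers the conjugate shares a power with \<open>h'\<close>, and \<open>h\<close> commutes
  with \<open>h' [^] e\<close>. Powers of \<open>\<gamma>1\<close> and \<open>\<gamma>2\<close> that
  are powers of \<open>h' [^] e\<close> and of \<open>h\<close> then commute.\<close>

lemma not_covers_flat:
  assumes a: "A1.gline a1" "A2.gline a2" and l: "l1 > 0" "A1.translates \<gamma>2 a1 l1" "l2 > 0" "A2.translates \<gamma>1 a2 l2"
    and C: "finite C"
  shows "\<not> covers_flat a1 a2 C"
proof
  assume cov: "covers_flat a1 a2 C"
  interpret S: anti_torus_pair T2 T1 H \<rho>2 \<rho>1 \<gamma>2 \<gamma>1 x2 x1 q2 q1 by (rule swap_anti_torus_pair)
  have V: "a1 0 \<in> verts T1" "a2 0 \<in> verts T2" using A1.gline_vert A2.gline_vert a by blast+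
  have cov': "S.covers_flat a2 a1 (prod.swap ` C)"
    unfolding S.covers_flat_def
  proof (intro allI)
    fix i j
    obtain g c1 c2 where g: "g \<in> carrier H" "(c1, c2) \<in> C" "\<rho>1 g (a1 c1) = a1 j" "\<rho>2 g (a2 c2) = a2 i"
      "\<forall>k. \<rho>1 g (a1 k) \<in> range a1 \<and> \<rho>2 g (a2 k) \<in> range a2"
      using cov[unfolded covers_flat_def, rule_format, of j i] by blast
    then show "\<exists>g\<in>carrier H. \<exists>(c1, c2)\<in>prod.swap ` C. \<rho>2 g (a2 c1) = a2 i \<and> \<rho>1 g (a1 c2) = a1 j \<and>
       (\<forall>k. \<rho>2 g (a2 k) \<in> range a2 \<and> \<rho>1 g (a1 k) \<in> range a1)"
      by (intro bexI[of _ g] bexI[of _ "(c2, c1)"]) force+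
  qed
  obtain h u where h: "h \<in> carrier H" "u > 0" "A1.translates h a1 u" "A2.translates h a2 0"
    using horizontal_translation[OF a C cov] .
  obtain h' w where h': "h' \<in> carrier H" "w > 0" "A2.translates h' a2 w" "A1.translates h' a1 0"
    using S.horizontal_translation[OF a(2,1) _ cov'] C by blast
  define g where "g = h \<otimes> h' \<otimes> inv h"
  have g: "g \<in> carrier H" "A1.translates g a1 0" "A2.translates g a2 w"
  proof -
    have "A1.translates g a1 (u + 0 + - u)"
      unfolding g_def by (intro A1.translates_mult A1.translates_inv a h h' m_closed inv_closed)
    moreover have "A2.translates g a2 (0 + w + - 0)"
      unfolding g_def by (intro A2.translates_mult A2.translates_inv a h h' m_closed inv_closed)
    ultimately show "A1.translates g a1 0" "A2.translates g a2 w" by simp_all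
  qed (use h h' in \<open>simp add: g_def\<close>)
  obtain e where e: "e > 0" "g [^] e = h' [^] (e::nat)"
  proof (rule powers_agree[OF g(1) h'(1) V])
    fix t :: nat
    have "A1.translates (g [^] t \<otimes> inv (h' [^] t)) a1 (int t * 0 + - (int t * 0))"
      by (intro A1.translates_mult A1.translates_inv A1.translates_pow a g h' nat_pow_closed inv_closed)
    then show "\<rho>1 (g [^] t \<otimes> inv (h' [^] t)) (a1 0) = a1 0" using A1.translatesD[of _ a1 _ 0] by simp
    have "A2.translates (g [^] t \<otimes> inv (h' [^] t)) a2 (int t * w + - (int t * w))"
      by (intro A2.translates_mult A2.translates_inv A2.translates_pow a g h' nat_pow_closed inv_closed)
    then show "\<rho>2 (g [^] t \<otimes> inv (h' [^] t)) (a2 0) = a2 0" using A2.translatesD[of _ a2 _ 0] by simp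
  qed
  have "h \<otimes> h' [^] e \<otimes> inv h = h' [^] e" using e conj_pow[OF h(1) h'(1)] unfolding g_def by simp
  then have comm: "h \<otimes> h' [^] e = h' [^] e \<otimes> h"
    using h(1) h'(1) by (metis inv_closed inv_solve_right m_closed nat_pow_closed)
  obtain m n where m: "m > 0" "\<gamma>1 [^] (m::nat) = h' [^] (n::nat)"
    using power_of_flat_translation[OF a l(3,4) h'(1,4,3,2)] .
  obtain m' n' where m': "m' > 0" "\<gamma>2 [^] (m'::nat) = h [^] (n'::nat)"
    using S.power_of_flat_translation[OF a(2,1) l(1,2) h(1,4,3,2)] .
  have "\<gamma>1 [^] (m * e) = (h' [^] e) [^] n"
    using m \<gamma> h'(1) nat_pow_pow[of \<gamma>1 m e] by (simp add: nat_pow_pow mult.commute)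
  moreover have "(h' [^] e) [^] n \<otimes> h [^] n' = h [^] n' \<otimes> (h' [^] e) [^] n"
    by (rule commuting_pows) (use h h' comm in auto)
  ultimately show False using no_commuting_powers[of "m * e" m'] m m' e by simp
qed

end

section \<open>Points and vertices of lines under isometries\<close>

context graph_tree begin

text \<open>The instance of the triangle inequality on which convexity of the flat rests. The test
  function is the distance to a vertex of the line to the left of both parameters.\<close>

lemma line_point_triangle:
  assumes a: "gline a" and x: "x \<in> R"
  shows "\<bar>s - t\<bar> \<le> rdist T (line_point a s) x + rdist T x (line_point a t)"
proof -
  define m where "m = min \<lfloor>s\<rfloor> \<lfloor>t\<rfloor>"
  have m: "of_int m \<le> s" "of_int m \<le> t" unfolding m_def by linarith+
  have "\<bar>barycentre (line_point a s) (\<lambda>w. real (d w (a m))) - barycentre x (\<lambda>w. real (d w (a m)))\<bar>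
      \<le> rdist T (line_point a s) x"
    by (intro barycentre_gdist_diff_le_rdist line_point_in_realization a gline_vert x)
  moreover have "\<bar>barycentre x (\<lambda>w. real (d w (a m))) - barycentre (line_point a t) (\<lambda>w. real (d w (a m)))\<bar>
      \<le> rdist T x (line_point a t)"
    by (intro barycentre_gdist_diff_le_rdist line_point_in_realization a gline_vert x)
  ultimately show ?thesis
    using barycentre_line_point_gdist_left[OF a m(1)] barycentre_line_point_gdist_left[OF a m(2)] by linarith
qed

end

context tree_action begin

lemma raction_fixed_line_vertex:
  assumes g: "g \<in> carrier H" and a: "gline a" and fixed: "\<rho> g (a 0) = a 0"
  shows "raction T (\<rho> g) (line_point a 0) = line_point a 0"
  using raction_line_point[OF g a, of 0] fixed line_point_of_int[of a 0] line_point_of_int[of "\<lambda>i. \<rho> g (a i)" 0]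
  by simp

text \<open>The coordinate at the image of the left endpoint is \<open>1 - frac s\<close>, which is
  positive, whereas a vertex point has only the coordinates 0 and 1.\<close>

lemma raction_line_point_eq_vertex:
  assumes g: "g \<in> carrier H" and a: "gline a"
    and eq: "raction T (\<rho> g) (line_point a s) = line_point a (of_int i)"
  shows "s = of_int \<lfloor>s\<rfloor>" "\<rho> g (a \<lfloor>s\<rfloor>) = a i"
proof -
  have "raction T (\<rho> g) (line_point a s) (\<rho> g (a \<lfloor>s\<rfloor>)) = 1 - frac s"
    using raction_act[OF g gline_vert[OF a]] gline_inj[OF a] by (simp add: line_point_def)
  then have *: "1 - frac s = (if \<rho> g (a \<lfloor>s\<rfloor>) = a i then 1 else 0)"
    unfolding eq line_point_of_int by (rule sym)
  then show 1: "\<rho> g (a \<lfloor>s\<rfloor>) = a i" using frac_lt_1[of s] by (auto split: if_splits)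
  show "s = of_int \<lfloor>s\<rfloor>" using * unfolding 1 frac_def by auto
qed

lemma raction_vertex_eq_line_point:
  assumes g: "g \<in> carrier H" and a: "gline a"
    and eq: "raction T (\<rho> g) (line_point a (of_int i)) = line_point a s"
  shows "\<rho> g (a i) = a \<lfloor>s\<rfloor>"
proof -
  have "line_point a s = (\<lambda>v. if v = \<rho> g (a i) then 1 else 0)"
    using raction_line_point[OF g a, of "of_int i"] eq line_point_of_int[of "\<lambda>i. \<rho> g (a i)" i] by simp
  moreover have "line_point a s (a \<lfloor>s\<rfloor>) = 1 - frac s" using gline_inj[OF a] by (simp add: line_point_def)
  ultimately show ?thesis using frac_lt_1[of s] by (auto split: if_splits)
qed

end

section \<open>The flat spanned by two axes\<close>

context tree_pair_action begin

abbreviation "X \<equiv> A1.R \<times> A2.R"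
abbreviation "D \<equiv> prod_dist (rdist T1) (rdist T2)"

definition flat_point :: "(int \<Rightarrow> 'v) \<Rightarrow> (int \<Rightarrow> 'w) \<Rightarrow> real \<times> real \<Rightarrow> ('v \<Rightarrow> real) \<times> ('w \<Rightarrow> real)" where
  "flat_point a1 a2 = map_prod (line_point a1) (line_point a2)"

text \<open>Becomes \<open>product_action\<close> when \<open>H\<close> is the lattice and the two
  actions are the projections.\<close>

definition pair_act :: "'h \<Rightarrow> ('v \<Rightarrow> real) \<times> ('w \<Rightarrow> real) \<Rightarrow> ('v \<Rightarrow> real) \<times> ('w \<Rightarrow> real)" where
  "pair_act g = map_prod (raction T1 (\<rho>1 g)) (raction T2 (\<rho>2 g))"

lemma prod_dist_nonneg: "0 \<le> D p q"
  and prod_dist_commute: "D p q = D q p"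
  by (simp_all add: prod_dist_def case_prod_unfold A1.rdist_commute[of "fst p"] A2.rdist_commute[of "snd p"])

lemma pair_act_isometry:
  assumes "g \<in> carrier H" "p \<in> X" "q \<in> X" shows "D (pair_act g p) (pair_act g q) = D p q"
  using assms A1.rdist_raction A2.rdist_raction by (auto simp: pair_act_def prod_dist_def)

lemma pair_act_bij: "g \<in> carrier H \<Longrightarrow> bij_betw (pair_act g) X X"
  unfolding pair_act_def using A1.raction_bij A2.raction_bij by (intro bij_betw_map_prod) auto

context
  fixes a1 :: "int \<Rightarrow> 'v" and a2 :: "int \<Rightarrow> 'w"
  assumes a: "A1.gline a1" "A2.gline a2"
begin

abbreviation "f \<equiv> flat_point a1 a2"

lemma flat_point_in: "f z \<in> X"
  using A1.line_point_in_realization[OF a(1)] A2.line_point_in_realization[OF a(2)]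
  by (cases z) (simp add: flat_point_def)

lemma flat_point_isometry: "D (f y) (f z) = dist y z"
  by (cases y; cases z)
     (simp add: flat_point_def prod_dist_def A1.rdist_line_point[OF a(1)] A2.rdist_line_point[OF a(2)]
        dist_prod_def dist_real_def)

lemma flat2_flat: "flat2 X D (range f)"
  unfolding flat2_def using flat_point_in flat_point_isometry by blast

text \<open>For \<open>p\<close> on a geodesic between points of the flat, Minkowski's inequality
  bounds the coordinatewise sums \<open>b + b'\<close> and \<open>e + e'\<close> together, while the
  triangle inequality in each factor bounds them from below. Both are therefore equalities, and
  \<open>between_on_line\<close> puts each coordinate of \<open>p\<close> on its line.\<close>

lemma geodesically_convex_flat: "geodesically_convex X D (range f)"
  unfolding geodesically_convex_def
proof (intro conjI allI impI)
  show "range f \<subseteq> X" using flat_point_in by blast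
  fix l c assume *: "geodesic_segment X D l c \<and> c 0 \<in> range f \<and> c l \<in> range f"
  then have l: "0 \<le> l" "c ` {0..l} \<subseteq> X"
    and geo: "\<And>s t. s \<in> {0..l} \<Longrightarrow> t \<in> {0..l} \<Longrightarrow> D (c s) (c t) = \<bar>s - t\<bar>"
    unfolding geodesic_segment_def by blast+
  obtain s0 t0 s1 t1 where st: "c 0 = f (s0, t0)" "c l = f (s1, t1)" using * by (metis imageE surj_pair)
  show "c ` {0..l} \<subseteq> range f"
  proof
    fix p assume "p \<in> c ` {0..l}"
    then obtain \<tau> where \<tau>: "\<tau> \<in> {0..l}" "p = c \<tau>" by blast
    obtain x y where xy: "p = (x, y)" by (cases p)
    have "p \<in> X" using l(2) \<tau> by blast
    then have X: "x \<in> A1.R" "y \<in> A2.R" using xy by simp_all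
    define b where "b = rdist T1 (line_point a1 s0) x"
    define b' where "b' = rdist T1 x (line_point a1 s1)"
    define e where "e = rdist T2 (line_point a2 t0) y"
    define e' where "e' = rdist T2 y (line_point a2 t1)"
    have d0: "D (c 0) p = sqrt (b\<^sup>2 + e\<^sup>2)"
      unfolding st(1) xy b_def e_def by (simp add: flat_point_def prod_dist_def)
    have d1: "D p (c l) = sqrt (b'\<^sup>2 + e'\<^sup>2)"
      unfolding st(2) xy b'_def e'_def by (simp add: flat_point_def prod_dist_def)
    have "sqrt ((b + b')\<^sup>2 + (e + e')\<^sup>2) \<le> D (c 0) p + D p (c l)"
      unfolding d0 d1 by (rule real_sqrt_sum_squares_triangle_ineq)
    also have "\<dots> = l" using geo[of 0 \<tau>] geo[of \<tau> l] \<tau> l(1) by simp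
    also have "\<dots> = D (c 0) (c l)" using geo[of 0 l] l(1) by simp
    also have "\<dots> = sqrt (\<bar>s0 - s1\<bar>\<^sup>2 + \<bar>t0 - t1\<bar>\<^sup>2)"
      unfolding st flat_point_isometry by (simp add: dist_prod_def dist_real_def)
    finally have le: "(b + b')\<^sup>2 + (e + e')\<^sup>2 \<le> \<bar>s0 - s1\<bar>\<^sup>2 + \<bar>t0 - t1\<bar>\<^sup>2"
      by (simp only: real_sqrt_le_iff)
    have tri: "\<bar>s0 - s1\<bar> \<le> b + b'" "\<bar>t0 - t1\<bar> \<le> e + e'"
      unfolding b_def b'_def e_def e'_def
      using A1.line_point_triangle[OF a(1) X(1)] A2.line_point_triangle[OF a(2) X(2)] by blast+
    have "b + b' \<le> \<bar>s0 - s1\<bar>"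
    proof (rule ccontr)
      assume "\<not> ?thesis"
      then have "\<bar>s0 - s1\<bar>\<^sup>2 < (b + b')\<^sup>2" by (intro power_strict_mono) auto
      moreover have "\<bar>t0 - t1\<bar>\<^sup>2 \<le> (e + e')\<^sup>2" using tri(2) by (intro power_mono) auto
      ultimately show False using le by linarith
    qed
    then obtain r where r: "x = line_point a1 r"
      using A1.between_on_line[OF a(1) X(1), of s0 s1] unfolding b_def b'_def by blast
    have "e + e' \<le> \<bar>t0 - t1\<bar>"
    proof (rule ccontr)
      assume "\<not> ?thesis"
      then have "\<bar>t0 - t1\<bar>\<^sup>2 < (e + e')\<^sup>2" by (intro power_strict_mono) auto
      moreover have "\<bar>s0 - s1\<bar>\<^sup>2 \<le> (b + b')\<^sup>2" using tri(1) by (intro power_mono) auto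
      ultimately show False using le by linarith
    qed
    then obtain r' where r': "y = line_point a2 r'"
      using A2.between_on_line[OF a(2) X(2), of t0 t1] unfolding e_def e'_def by blast
    have "p = f (r, r')" using r r' xy by (simp add: flat_point_def)
    then show "p \<in> range f" by blast
  qed
qed

text \<open>The point with parameters \<open>(s, t)\<close> is the midpoint of
  \<open>(0, 2 * t)\<close> and \<open>(2 * s, 0)\<close>, which lie on the two lines. One segment
  per point is enough.\<close>

lemma geodesic_hull_flat:
  "geodesic_hull X D (range (\<lambda>t. f (0, t)) \<union> range (\<lambda>s. f (s, 0))) = range f"
  (is "geodesic_hull X D ?L = _")
proof
  have "?L \<subseteq> range f" by blast
  then show "geodesic_hull X D ?L \<subseteq> range f"
    unfolding geodesic_hull_def using geodesically_convex_flat by blast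
  show "range f \<subseteq> geodesic_hull X D ?L"
    unfolding geodesic_hull_def
  proof (rule Inter_greatest, elim CollectE conjE, rule subsetI)
    fix C p assume C: "geodesically_convex X D C" "?L \<subseteq> C" and "p \<in> range f"
    then obtain s t where p: "p = f (s, t)" by auto
    define u where "u = (2 * s, 0::real)"
    define v where "v = (0::real, 2 * t)"
    define l where "l = dist v u"
    define c where "c \<tau> = f (v + (\<tau> / l) *\<^sub>R (u - v))" for \<tau>
    show "p \<in> C"
    proof (cases "l = 0")
      case True
      then have "s = 0" "t = 0" unfolding l_def u_def v_def by auto
      then show ?thesis using C(2) p by blast
    next
      case False
      then have l: "l > 0" unfolding l_def by simp
      have "D (c \<sigma>) (c \<tau>) = \<bar>\<sigma> - \<tau>\<bar>" for \<sigma> \<tau>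
      proof -
        have "v + (\<sigma> / l) *\<^sub>R (u - v) - (v + (\<tau> / l) *\<^sub>R (u - v)) = ((\<sigma> - \<tau>) / l) *\<^sub>R (u - v)"
          by (simp add: diff_divide_distrib scaleR_left_diff_distrib)
        then have "D (c \<sigma>) (c \<tau>) = \<bar>(\<sigma> - \<tau>) / l\<bar> * norm (u - v)"
          unfolding c_def flat_point_isometry dist_norm by (simp only: norm_scaleR)
        moreover have "norm (u - v) = l" unfolding l_def by (simp add: dist_norm norm_minus_commute)
        ultimately show ?thesis using l by (simp add: abs_divide)
      qed
      moreover have "c ` {0..l} \<subseteq> X" unfolding c_def using flat_point_in by blast
      ultimately have seg: "geodesic_segment X D l c"
        unfolding geodesic_segment_def using l by simp
      have "c 0 = f (0, 2 * t)" "c l = f (2 * s, 0)" using l unfolding c_def u_def v_def by simp_all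
      then have "c 0 \<in> C" "c l \<in> C" using C(2) by blast+
      then have "c ` {0..l} \<subseteq> C" using C(1) seg unfolding geodesically_convex_def by blast
      moreover have "p = c (l / 2)"
        using l unfolding p c_def u_def v_def by simp
      ultimately show ?thesis using l by auto
    qed
  qed
qed

lemma flat_lines_not_parallel:
  "\<not> parallel_lines D (range (\<lambda>t. f (0, t))) (range (\<lambda>s. f (s, 0)))"
proof
  assume "parallel_lines D (range (\<lambda>t. f (0, t))) (range (\<lambda>s. f (s, 0)))"
  then obtain K where K: "\<And>t. \<exists>s. D (f (0, t)) (f (s, 0)) \<le> K" unfolding parallel_lines_def by blast
  obtain s where "D (f (0, \<bar>K\<bar> + 1)) (f (s, 0)) \<le> K" using K by blast
  moreover have "\<bar>K\<bar> + 1 \<le> dist (0::real, \<bar>K\<bar> + 1) (s, 0)"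
    using dist_snd_le[of "(0::real, \<bar>K\<bar> + 1)" "(s, 0::real)"] by (simp add: dist_real_def)
  ultimately show False unfolding flat_point_isometry by linarith
qed

text \<open>Fixing the single vertex \<open>a1 0\<close> suffices, as the axis lies over it. The
  displacement is minimal there because the second factor alone contributes at least
  \<open>l\<close> at every point.\<close>

lemma vertical_translation_axis:
  assumes g: "g \<in> carrier H" and g1: "\<rho>1 g (a1 0) = a1 0" and g2: "A2.translates g a2 l" "l > 0"
  shows "hyperbolic_isometry X D (pair_act g)"
    and "translation_axis X D (pair_act g) (range (\<lambda>t. f (0, t)))"
proof -
  have act: "pair_act g (f (0, t)) = f (0, t + of_int l)" for t
    using A1.raction_fixed_line_vertex[OF g a(1) g1]
      A2.raction_line_point_translation[OF g a(2) A2.translatesD[OF g2(1)], of t]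
    by (simp add: pair_act_def flat_point_def)
  have disp: "D (f (0, 0)) (pair_act g (f (0, 0))) = of_int l"
    unfolding act flat_point_isometry using g2(2) by (simp add: dist_prod_def dist_real_def)
  have "of_int l \<le> D y (pair_act g y)" if y: "y \<in> X" for y
  proof -
    have "of_int l \<le> rdist T2 (snd y) (raction T2 (\<rho>2 g) (snd y))"
      using A2.translation_le_rdist[OF g a(2) g2(2) A2.translatesD[OF g2(1)]] y by auto
    also have "\<dots> \<le> D y (pair_act g y)"
      by (simp add: pair_act_def prod_dist_def case_prod_unfold)
    finally show ?thesis .
  qed
  then show "hyperbolic_isometry X D (pair_act g)"
    unfolding hyperbolic_isometry_def
    using pair_act_bij[OF g] pair_act_isometry[OF g] disp g2(2) flat_point_in
    by (intro conjI bexI[of _ "f (0, 0)"]) auto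
  show "translation_axis X D (pair_act g) (range (\<lambda>t. f (0, t)))"
    unfolding translation_axis_def geodesic_line_def
  proof (intro exI conjI allI)
    show "range (\<lambda>t. f (0, t)) \<subseteq> X" using flat_point_in by blast
    show "D (f (0, r)) (f (0, t)) = \<bar>r - t\<bar>" for r t
      unfolding flat_point_isometry by (simp add: dist_prod_def dist_real_def)
    show "pair_act g (f (0, t)) = f (0, t + of_int l)" for t by (rule act)
  qed (use g2(2) in simp_all)
qed

lemma horizontal_translation_axis:
  assumes g: "g \<in> carrier H" and g2: "\<rho>2 g (a2 0) = a2 0" and g1: "A1.translates g a1 l" "l > 0"
  shows "hyperbolic_isometry X D (pair_act g)"
    and "translation_axis X D (pair_act g) (range (\<lambda>s. f (s, 0)))"
proof -
  have act: "pair_act g (f (t, 0)) = f (t + of_int l, 0)" for t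
    using A2.raction_fixed_line_vertex[OF g a(2) g2]
      A1.raction_line_point_translation[OF g a(1) A1.translatesD[OF g1(1)], of t]
    by (simp add: pair_act_def flat_point_def)
  have disp: "D (f (0, 0)) (pair_act g (f (0, 0))) = of_int l"
    unfolding act flat_point_isometry using g1(2) by (simp add: dist_prod_def dist_real_def)
  have "of_int l \<le> D y (pair_act g y)" if y: "y \<in> X" for y
  proof -
    have "of_int l \<le> rdist T1 (fst y) (raction T1 (\<rho>1 g) (fst y))"
      using A1.translation_le_rdist[OF g a(1) g1(2) A1.translatesD[OF g1(1)]] y by auto
    also have "\<dots> \<le> D y (pair_act g y)"
      by (simp add: pair_act_def prod_dist_def case_prod_unfold)
    finally show ?thesis .
  qed
  then show "hyperbolic_isometry X D (pair_act g)"
    unfolding hyperbolic_isometry_def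
    using pair_act_bij[OF g] pair_act_isometry[OF g] disp g1(2) flat_point_in
    by (intro conjI bexI[of _ "f (0, 0)"]) auto
  show "translation_axis X D (pair_act g) (range (\<lambda>s. f (s, 0)))"
    unfolding translation_axis_def geodesic_line_def
  proof (intro exI conjI allI)
    show "range (\<lambda>s. f (s, 0)) \<subseteq> X" using flat_point_in by blast
    show "D (f (r, 0)) (f (s, 0)) = \<bar>r - s\<bar>" for r s
      unfolding flat_point_isometry by (simp add: dist_prod_def dist_real_def)
    show "pair_act g (f (s, 0)) = f (s + of_int l, 0)" for s by (rule act)
  qed (use g1(2) in simp_all)
qed

text \<open>In \<open>anti_torus\<close> compactness refers to the topology of the flat itself, so
  the metric axioms are inherited from the Euclidean plane through \<open>f\<close>.\<close>

lemma Metric_space_flat: "Metric_space (range f) D"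
proof
  show "0 \<le> D p q" "D p q = D q p" for p q by (fact prod_dist_nonneg prod_dist_commute)+
  show "D p q = 0 \<longleftrightarrow> p = q" if pq: "p \<in> range f" "q \<in> range f" for p q
  proof -
    obtain y z where "p = f y" "q = f z" using pq by blast
    moreover have "y = z" if "f y = f z" using flat_point_isometry[of y z] flat_point_isometry[of y y] that by simp
    ultimately show ?thesis using flat_point_isometry[of y z] by auto
  qed
  show "D p r \<le> D p q + D q r" if pqr: "p \<in> range f" "q \<in> range f" "r \<in> range f" for p q r
  proof -
    obtain x y z where "p = f x" "q = f y" "r = f z" using pqr by blast
    then show ?thesis using flat_point_isometry dist_triangle by simp
  qed
qed

text \<open>A compact set is bounded, so its parameters lie in a square, and \<open>C\<close>
  consists of the integral points of that square. Whatever is carried to a vertex of the flat is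
  itself a vertex, so integral points are enough.\<close>

lemma cocompact_imp_covers_flat:
  assumes "cocompact_action (range f) D {g \<in> carrier H. pair_act g ` range f = range f} pair_act"
  obtains C where "finite C" "covers_flat a1 a2 C"
proof -
  interpret M: Metric_space "range f" D by (rule Metric_space_flat)
  obtain K where K: "compactin M.mtopology K"
    "(\<Union>g\<in>{g \<in> carrier H. pair_act g ` range f = range f}. pair_act g ` K) = range f"
    using assms unfolding cocompact_action_def by blast
  have "M.mbounded K" by (rule M.compactin_imp_mbounded[OF K(1)])
  then obtain p B where pB: "K \<subseteq> M.mcball p B" unfolding M.mbounded_def by blast
  have "K \<noteq> {}" using K(2) by auto
  then have "p \<in> range f" using pB unfolding M.mcball_def by auto
  then obtain s0 t0 where p: "p = f (s0, t0)" by (metis imageE surj_pair)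
  have KB: "\<exists>s t. k = f (s, t) \<and> \<bar>s - s0\<bar> \<le> B \<and> \<bar>t - t0\<bar> \<le> B" if k: "k \<in> K" for k
  proof -
    have "k \<in> range f" "D p k \<le> B" using k pB unfolding M.mcball_def by auto
    then obtain s t where st: "k = f (s, t)" "dist (s0, t0) (s, t) \<le> B"
      using p flat_point_isometry by (metis imageE surj_pair)
    then show ?thesis
      using dist_fst_le[of "(s0, t0)" "(s, t)"] dist_snd_le[of "(s0, t0)" "(s, t)"]
      by (intro exI[of _ s] exI[of _ t]) (auto simp: dist_real_def)
  qed
  define C where "C = {\<lceil>s0 - B\<rceil>..\<lfloor>s0 + B\<rfloor>} \<times> {\<lceil>t0 - B\<rceil>..\<lfloor>t0 + B\<rfloor>}"
  have "covers_flat a1 a2 C"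
    unfolding covers_flat_def
  proof (intro allI)
    fix i j
    have "f (of_int i, of_int j) \<in> (\<Union>g\<in>{g \<in> carrier H. pair_act g ` range f = range f}. pair_act g ` K)"
      unfolding K(2) by simp
    then obtain g k where g: "g \<in> carrier H" "pair_act g ` range f = range f" "k \<in> K"
      "f (of_int i, of_int j) = pair_act g k" by blast
    obtain s t where st: "k = f (s, t)" "\<bar>s - s0\<bar> \<le> B" "\<bar>t - t0\<bar> \<le> B" using KB[OF g(3)] by blast
    have e: "raction T1 (\<rho>1 g) (line_point a1 s) = line_point a1 (of_int i)"
      "raction T2 (\<rho>2 g) (line_point a2 t) = line_point a2 (of_int j)"
      using g(4) unfolding st(1) by (simp_all add: pair_act_def flat_point_def)
    note 1 = A1.raction_line_point_eq_vertex[OF g(1) a(1) e(1)]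
    note 2 = A2.raction_line_point_eq_vertex[OF g(1) a(2) e(2)]
    have "(\<lfloor>s\<rfloor>, \<lfloor>t\<rfloor>) \<in> C"
    proof -
      have "s0 - B \<le> of_int \<lfloor>s\<rfloor>" "of_int \<lfloor>s\<rfloor> \<le> s0 + B" "t0 - B \<le> of_int \<lfloor>t\<rfloor>" "of_int \<lfloor>t\<rfloor> \<le> t0 + B"
        using st(2,3) 1(1) 2(1) by linarith+
      then have "\<lceil>s0 - B\<rceil> \<le> \<lfloor>s\<rfloor>" "\<lceil>t0 - B\<rceil> \<le> \<lfloor>t\<rfloor>" "\<lfloor>s\<rfloor> \<le> \<lfloor>s0 + B\<rfloor>" "\<lfloor>t\<rfloor> \<le> \<lfloor>t0 + B\<rfloor>"
        by (blast intro: ceiling_le iffD2[OF le_floor_iff])+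
      then show ?thesis unfolding C_def by (simp only: mem_Times_iff fst_conv snd_conv atLeastAtMost_iff)
    qed
    moreover have "\<rho>1 g (a1 k) \<in> range a1 \<and> \<rho>2 g (a2 k) \<in> range a2" for k
    proof -
      \<comment> \<open>A diagonal point tests both lines at once.\<close>
      have "pair_act g (f (of_int k, of_int k)) \<in> range f" using g(2) by blast
      then obtain s t where "pair_act g (f (of_int k, of_int k)) = f (s, t)" by (metis imageE surj_pair)
      then have "raction T1 (\<rho>1 g) (line_point a1 (of_int k)) = line_point a1 s"
        "raction T2 (\<rho>2 g) (line_point a2 (of_int k)) = line_point a2 t"
        by (simp_all add: pair_act_def flat_point_def)
      then show ?thesis
        using A1.raction_vertex_eq_line_point[OF g(1) a(1)] A2.raction_vertex_eq_line_point[OF g(1) a(2)] by blast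
    qed
    ultimately show "\<exists>g\<in>carrier H. \<exists>(c1, c2)\<in>C. \<rho>1 g (a1 c1) = a1 i \<and> \<rho>2 g (a2 c2) = a2 j \<and>
     (\<forall>k. \<rho>1 g (a1 k) \<in> range a1 \<and> \<rho>2 g (a2 k) \<in> range a2)"
      using g(1) 1(2) 2(2) by (intro bexI[of _ g] bexI[of _ "(\<lfloor>s\<rfloor>, \<lfloor>t\<rfloor>)"]) auto
  qed
  moreover have "finite C" unfolding C_def by simp
  ultimately show ?thesis using that by blast
qed

end

end

section \<open>The anti-torus and irreducibility\<close>

context anti_torus_pair begin

text \<open>Powers are taken because \<open>a1\<close> is an axis of \<open>\<gamma>2\<close>, and
  \<open>\<gamma>1\<close>, which fixes \<open>x1\<close>, may move \<open>a1 0\<close>; its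
  \<open>m\<close>-th power fixes that vertex and therefore has an axis inside the flat. The same
  holds for \<open>\<gamma>2\<close> with the factors exchanged.\<close>

lemma anti_torus_exists:
  "\<exists>(m::nat) (n::nat) P. anti_torus X D (carrier H) pair_act (\<gamma>1 [^] m) (\<gamma>2 [^] n) P"
proof -
  interpret S: anti_torus_pair T2 T1 H \<rho>2 \<rho>1 \<gamma>2 \<gamma>1 x2 x1 q2 q1 by (rule swap_anti_torus_pair)
  obtain a2 l2 where a2: "A2.gline a2" "l2 > 0" "A2.translates \<gamma>1 a2 l2" by (rule axis)
  obtain a1 l1 where a1: "A1.gline a1" "l1 > 0" "A1.translates \<gamma>2 a1 l1" by (rule S.axis)
  note a = a1(1) a2(1)
  have fin: "finite {a1 0}" "{a1 0} \<subseteq> verts T1" "finite {a2 0}" "{a2 0} \<subseteq> verts T2"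
    using A1.gline_vert[OF a1(1)] A2.gline_vert[OF a2(1)] by simp_all
  obtain m where m: "m > 0" "\<gamma>1 [^] (m::nat) \<in> A1.fixator {a1 0}"
    using A1.coprime_power_fixes[OF \<gamma>(1) x(1,3) fin(1,2) q1] by blast
  obtain n where n: "n > 0" "\<gamma>2 [^] (n::nat) \<in> A2.fixator {a2 0}"
    using A2.coprime_power_fixes[OF \<gamma>(2) x(2,4) fin(3,4) q2] by blast
  let ?f = "flat_point a1 a2"
  have g1: "\<gamma>1 [^] m \<in> carrier H" "\<rho>1 (\<gamma>1 [^] m) (a1 0) = a1 0"
    "A2.translates (\<gamma>1 [^] m) a2 (int m * l2)" "int m * l2 > 0"
    using m A2.translates_pow[OF \<gamma>(1) a(2) a2(3)] a2(2) by (simp_all add: A1.fixator_iff)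
  have g2: "\<gamma>2 [^] n \<in> carrier H" "\<rho>2 (\<gamma>2 [^] n) (a2 0) = a2 0"
    "A1.translates (\<gamma>2 [^] n) a1 (int n * l1)" "int n * l1 > 0"
    using n A1.translates_pow[OF \<gamma>(2) a(1) a1(3)] a1(2) by (simp_all add: A2.fixator_iff)
  have "\<not> cocompact_action (range ?f) D {g \<in> carrier H. pair_act g ` range ?f = range ?f} pair_act"
  proof
    assume "cocompact_action (range ?f) D {g \<in> carrier H. pair_act g ` range ?f = range ?f} pair_act"
    then obtain C where "finite C" "covers_flat a1 a2 C" by (rule cocompact_imp_covers_flat[OF a])
    then show False using not_covers_flat[OF a a1(2,3) a2(2,3)] by blast
  qed
  then have "anti_torus X D (carrier H) pair_act (\<gamma>1 [^] m) (\<gamma>2 [^] n) (range ?f)"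
    unfolding anti_torus_def
    using flat2_flat[OF a] g1(1) g2(1) vertical_translation_axis[OF a g1] horizontal_translation_axis[OF a g2]
      flat_lines_not_parallel[OF a] geodesic_hull_flat[OF a, symmetric] by blast
  then show ?thesis by blast
qed

text \<open>Finite index puts a positive power of \<open>\<gamma>1\<close> into
  \<open>\<Lambda>\<close>. By \<open>split\<close> its action on the first tree is also that of an
  element \<open>h\<close> trivial on the second tree. This \<open>h\<close> fixes \<open>x1\<close>
  and \<open>x2\<close>, so it is torsion, and a positive power of \<open>\<gamma>1\<close> would
  act trivially on the first tree.\<close>

lemma no_split_finite_index:
  assumes L: "subgroup \<Lambda> H" "finite (rcosets \<Lambda>)"
    and split: "\<And>g. g \<in> \<Lambda> \<Longrightarrow> \<exists>h\<in>carrier H. (\<forall>v\<in>verts T1. \<rho>1 h v = \<rho>1 g v) \<and> (\<forall>v\<in>verts T2. \<rho>2 h v = v)"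
  shows False
proof -
  have "range (\<lambda>n::nat. \<Lambda> #> \<gamma>1 [^] n) \<subseteq> rcosets \<Lambda>"
    using \<gamma> subgroup.subset[OF L(1)] by (auto intro: rcosetsI)
  then have "finite (range (\<lambda>n::nat. \<Lambda> #> \<gamma>1 [^] n))" using L(2) by (rule finite_subset)
  then have "\<not> inj (\<lambda>n::nat. \<Lambda> #> \<gamma>1 [^] n)" using finite_imageD by blast
  then obtain i j where "i \<noteq> j" "\<Lambda> #> \<gamma>1 [^] (i::nat) = \<Lambda> #> \<gamma>1 [^] (j::nat)" unfolding inj_def by blast
  then obtain i j where ij: "i < j" "\<Lambda> #> \<gamma>1 [^] (i::nat) = \<Lambda> #> \<gamma>1 [^] (j::nat)" by (metis nat_neq_iff)
  have "\<gamma>1 [^] j \<in> \<Lambda> #> \<gamma>1 [^] i" unfolding ij(2) using rcos_self[OF _ L(1)] \<gamma> by simp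
  then obtain g where g: "g \<in> \<Lambda>" "\<gamma>1 [^] j = g \<otimes> \<gamma>1 [^] i" unfolding r_coset_def by blast
  have gc: "g \<in> carrier H" using g subgroup.subset[OF L(1)] by blast
  have "\<gamma>1 [^] (j - i) \<otimes> \<gamma>1 [^] i = g \<otimes> \<gamma>1 [^] i"
    using g(2) ij(1) \<gamma> by (simp add: nat_pow_mult)
  then have gpow: "g = \<gamma>1 [^] (j - i)" using gc \<gamma> by simp
  obtain h where h: "h \<in> carrier H" "\<And>v. v \<in> verts T1 \<Longrightarrow> \<rho>1 h v = \<rho>1 g v"
    "\<And>v. v \<in> verts T2 \<Longrightarrow> \<rho>2 h v = v" using split[OF g(1)] by blast
  have "\<gamma>1 \<in> A1.fixator {x1}" using x \<gamma> by (simp add: A1.fixator_iff)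
  then have "g \<in> A1.fixator {x1}" unfolding gpow using A1.fixator_pow x by simp
  then have "h \<in> A1.fixator {x1}" using h x by (simp add: A1.fixator_iff)
  then have h1: "h [^] t \<in> A1.fixator {x1}" for t :: nat using A1.fixator_pow x by simp
  have "h \<in> A2.fixator {x2}" using h x by (simp add: A2.fixator_iff)
  then have h2: "h [^] t \<in> A2.fixator {x2}" for t :: nat using A2.fixator_pow x by simp
  have "\<rho>1 (h [^] t \<otimes> inv (\<one> [^] t)) x1 = x1" "\<rho>2 (h [^] t \<otimes> inv (\<one> [^] t)) x2 = x2" for t :: nat
    using h(1) h1[of t] h2[of t] by (simp_all add: A1.fixator_iff A2.fixator_iff)
  then obtain r where r: "r > 0" "h [^] r = \<one> [^] (r::nat)"
    by (rule powers_agree[OF h(1) one_closed x(1,2)])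
  have eq: "\<rho>1 (h [^] t) v = \<rho>1 (g [^] t) v" if "v \<in> verts T1" for t :: nat and v
    using that
  proof (induction t arbitrary: v)
    case (Suc t)
    then show ?case using A1.act_mult h(1,2) gc by simp
  qed simp
  have "\<rho>1 (\<gamma>1 [^] ((j - i) * r)) v = v" if "v \<in> verts T1" for v
    using eq[OF that, of r] r(2) that \<gamma> unfolding gpow by (simp add: nat_pow_pow)
  then show False using infinite_order[of "(j - i) * r"] ij(1) r(1) by auto
qed

end

section \<open>Lattices in products of automorphism groups\<close>

lemma group_aut_group: "group (aut_group T)"
proof -
  let ?A = "{g \<in> Bij (verts T). \<forall>u\<in>verts T. \<forall>v\<in>verts T. {g u, g v} \<in> edges T \<longleftrightarrow> {u, v} \<in> edges T}"
  have "subgroup ?A (BijGroup (verts T))"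
  proof
    fix g assume g: "g \<in> ?A"
    then have B: "g \<in> Bij (verts T)" by simp
    have "{inv_into (verts T) g u, inv_into (verts T) g v} \<in> edges T \<longleftrightarrow> {u, v} \<in> edges T"
      if uv: "u \<in> verts T" "v \<in> verts T" for u v
    proof -
      have "g ` verts T = verts T" using B by (simp add: Bij_def bij_betw_def)
      then have "g (inv_into (verts T) g u) = u" "g (inv_into (verts T) g v) = v"
        using uv f_inv_into_f[of _ g "verts T"] by simp_all
      then show ?thesis using g Bij_inv_into_mem[OF B] uv by (metis (mono_tags, lifting) mem_Collect_eq)
    qed
    then show "inv\<^bsub>BijGroup (verts T)\<^esub> g \<in> ?A"
      using restrict_inv_into_Bij[OF B] by (simp add: inv_BijGroup[OF B])
  next
    fix g h assume gh: "g \<in> ?A" "h \<in> ?A"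
    then have "compose (verts T) g h \<in> Bij (verts T)" by (simp add: compose_Bij)
    then have "compose (verts T) g h \<in> ?A"
      using gh Bij_imp_funcset[of h "verts T"] by (auto simp: compose_def Pi_iff)
    then show "g \<otimes>\<^bsub>BijGroup (verts T)\<^esub> h \<in> ?A" using gh by (simp add: BijGroup_def)
  qed (auto simp: BijGroup_def id_Bij)
  then show ?thesis
    unfolding aut_group_def by (rule subgroup.subgroup_is_group[OF _ group_BijGroup])
qed

text \<open>A basic open set of the product topology constrains only finitely many coordinates, and
  these form \<open>F\<close>.\<close>

lemma aut_topology_neighbourhood:
  assumes U: "openin (aut_topology T) U" and g: "g \<in> U"
  obtains F where "finite F" "F \<subseteq> verts T"
    "\<And>h. h \<in> carrier (aut_group T) \<Longrightarrow> (\<And>v. v \<in> F \<Longrightarrow> h v = g v) \<Longrightarrow> h \<in> U"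
proof -
  let ?P = "product_topology (\<lambda>_. discrete_topology (verts T)) (verts T)"
  obtain W where W: "openin ?P W" "U = W \<inter> carrier (aut_group T)"
    using U unfolding aut_topology_def openin_subtopology by blast
  then obtain B where B: "finite {i \<in> verts T. B i \<noteq> verts T}" "g \<in> Pi\<^sub>E (verts T) B" "Pi\<^sub>E (verts T) B \<subseteq> W"
    using g unfolding openin_product_topology_alt by (metis Int_iff topspace_discrete_topology)
  have "h \<in> U" if h: "h \<in> carrier (aut_group T)" "\<And>v. v \<in> {i \<in> verts T. B i \<noteq> verts T} \<Longrightarrow> h v = g v" for h
  proof -
    have hB: "h \<in> Bij (verts T)" using h(1) by (simp add: aut_group_def)
    have "h \<in> Pi\<^sub>E (verts T) B"
    proof (rule PiE_I)
      fix v assume v: "v \<in> verts T"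
      show "h v \<in> B v"
      proof (cases "B v = verts T")
        case True
        then show ?thesis using Bij_imp_funcset[OF hB] v by blast
      next
        case False
        then show ?thesis using h(2)[of v] v PiE_mem[OF B(2) v] by simp
      qed
    qed (use Bij_imp_extensional[OF hB] in \<open>simp add: extensional_def\<close>)
    then show ?thesis using B(3) W(2) h(1) by blast
  qed
  then show ?thesis using that[OF B(1)] by blast
qed

text \<open>Some open box around the identity meets \<Gamma> in nothing else, and each side of the
  box contains all automorphisms fixing a certain finite set of vertices.\<close>

lemma discrete_subgroup_trivial_fixator:
  assumes disc: "subtopology (prod_topology (aut_topology T1) (aut_topology T2)) \<Gamma> = discrete_topology \<Gamma>"
    and sub: "\<Gamma> \<subseteq> carrier (aut_group T1) \<times> carrier (aut_group T2)"
    and e: "(\<lambda>v\<in>verts T1. v, \<lambda>v\<in>verts T2. v) \<in> \<Gamma>"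
  obtains F1 F2 where "finite F1" "F1 \<subseteq> verts T1" "finite F2" "F2 \<subseteq> verts T2"
    "\<And>g. g \<in> \<Gamma> \<Longrightarrow> (\<And>v. v \<in> F1 \<Longrightarrow> fst g v = v) \<Longrightarrow> (\<And>v. v \<in> F2 \<Longrightarrow> snd g v = v) \<Longrightarrow>
       g = (\<lambda>v\<in>verts T1. v, \<lambda>v\<in>verts T2. v)"
proof -
  let ?e1 = "\<lambda>v\<in>verts T1. v" and ?e2 = "\<lambda>v\<in>verts T2. v"
  have "openin (discrete_topology \<Gamma>) {(?e1, ?e2)}" using e by simp
  then obtain U where U: "openin (prod_topology (aut_topology T1) (aut_topology T2)) U" "{(?e1, ?e2)} = U \<inter> \<Gamma>"
    unfolding disc[symmetric] openin_subtopology by blast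
  then have "(?e1, ?e2) \<in> U" by blast
  then obtain U1 U2 where U12: "openin (aut_topology T1) U1" "openin (aut_topology T2) U2"
    "?e1 \<in> U1" "?e2 \<in> U2" "U1 \<times> U2 \<subseteq> U"
    using U(1) unfolding openin_prod_topology_alt by meson
  obtain F1 where F1: "finite F1" "F1 \<subseteq> verts T1"
    "\<And>h. h \<in> carrier (aut_group T1) \<Longrightarrow> (\<And>v. v \<in> F1 \<Longrightarrow> h v = ?e1 v) \<Longrightarrow> h \<in> U1"
    using aut_topology_neighbourhood[OF U12(1,3)] by metis
  obtain F2 where F2: "finite F2" "F2 \<subseteq> verts T2"
    "\<And>h. h \<in> carrier (aut_group T2) \<Longrightarrow> (\<And>v. v \<in> F2 \<Longrightarrow> h v = ?e2 v) \<Longrightarrow> h \<in> U2"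
    using aut_topology_neighbourhood[OF U12(2,4)] by metis
  have "g = (?e1, ?e2)" if g: "g \<in> \<Gamma>" "\<And>v. v \<in> F1 \<Longrightarrow> fst g v = v" "\<And>v. v \<in> F2 \<Longrightarrow> snd g v = v" for g
  proof -
    have "fst g \<in> U1" by (rule F1(3)) (use g sub F1(2) in auto)
    moreover have "snd g \<in> U2" by (rule F2(3)) (use g sub F2(2) in auto)
    ultimately have "g \<in> U" using U12(5) by (cases g) auto
    then show ?thesis using U(2) g(1) by blast
  qed
  then show ?thesis using that[OF F1(1,2) F2(1,2)] by blast
qed

theorem theorem1p1:
  fixes T1 :: "'a ugraph" and T2 :: "'b ugraph"
    and \<Gamma> :: "(('a \<Rightarrow> 'a) \<times> ('b \<Rightarrow> 'b)) set"
    and G :: "('g, 'm) monoid_scheme"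
    and \<phi> :: "('a \<Rightarrow> 'a) \<times> ('b \<Rightarrow> 'b) \<Rightarrow> 'g"
    and \<gamma>1 \<gamma>2 :: "('a \<Rightarrow> 'a) \<times> ('b \<Rightarrow> 'b)"
    and x1 :: 'a and x2 :: 'b
  assumes "tree T1" and "locally_finite T1"
    and "tree T2" and "locally_finite T2"
    and "cocompact_action (realization T1) (rdist T1) (carrier (aut_group T1)) (raction T1)"
    and "cocompact_action (realization T2) (rdist T2) (carrier (aut_group T2)) (raction T2)"
    and "cocompact_lattice (aut_group T1 \<times>\<times> aut_group T2)
           (prod_topology (aut_topology T1) (aut_topology T2)) \<Gamma>"
    and "x1 \<in> verts T1" and "x2 \<in> verts T2"
    and "\<gamma>1 \<in> {g \<in> \<Gamma>. fst g x1 = x1}" and "\<gamma>2 \<in> {g \<in> \<Gamma>. snd g x2 = x2}"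
    and "group G" and "\<phi> \<in> hom ((aut_group T1 \<times>\<times> aut_group T2)\<lparr>carrier := \<Gamma>\<rparr>) G"
    and "\<phi> \<gamma>1 \<otimes>\<^bsub>G\<^esub> \<phi> \<gamma>2 \<noteq> \<phi> \<gamma>2 \<otimes>\<^bsub>G\<^esub> \<phi> \<gamma>1"
    and "group.ord G (\<phi> \<gamma>1) \<noteq> 0"
    and "\<forall>v\<in>verts T1. coprime (group.ord G (\<phi> \<gamma>1)) (order (local_action T1 (fst ` \<Gamma>) v))"
    and "group.ord G (\<phi> \<gamma>2) \<noteq> 0"
    and "\<forall>v\<in>verts T2. coprime (group.ord G (\<phi> \<gamma>2)) (order (local_action T2 (snd ` \<Gamma>) v))"
  shows "(\<exists>(m::nat) (n::nat) P.
            anti_torus (realization T1 \<times> realization T2) (prod_dist (rdist T1) (rdist T2))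
              \<Gamma> (product_action T1 T2)
              (\<gamma>1 [^]\<^bsub>aut_group T1 \<times>\<times> aut_group T2\<^esub> m)
              (\<gamma>2 [^]\<^bsub>aut_group T1 \<times>\<times> aut_group T2\<^esub> n) P)
    \<and> irreducible_lattice T1 T2 \<Gamma>
    \<and> group.ord (aut_group T1) (fst \<gamma>1) = 0
    \<and> group.ord (aut_group T2) (snd \<gamma>2) = 0"
proof -
  let ?A = "aut_group T1 \<times>\<times> aut_group T2"
  let ?H = "?A\<lparr>carrier := \<Gamma>\<rparr>"
  let ?q1 = "group.ord G (\<phi> \<gamma>1)" and ?q2 = "group.ord G (\<phi> \<gamma>2)"
  interpret Aut1: group "aut_group T1" by (rule group_aut_group)
  interpret Aut2: group "aut_group T2" by (rule group_aut_group)
  have gA: "group ?A" by (rule DirProd_group) (rule group_aut_group)+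
  have sub: "subgroup \<Gamma> ?A"
    and disc: "subtopology (prod_topology (aut_topology T1) (aut_topology T2)) \<Gamma> = discrete_topology \<Gamma>"
    using assms(7) unfolding cocompact_lattice_def by blast+
  have sub': "\<Gamma> \<subseteq> carrier (aut_group T1) \<times> carrier (aut_group T2)"
    using subgroup.subset[OF sub] by simp
  interpret H: group ?H by (rule subgroup.subgroup_is_group[OF sub gA])
  have h1: "fst \<in> hom ?H (aut_group T1)" and h2: "snd \<in> hom ?H (aut_group T2)"
    using sub' by (auto simp: hom_def mult_DirProd')
  interpret P1: group_hom ?H "aut_group T1" fst using h1 by unfold_locales
  interpret P2: group_hom ?H "aut_group T2" snd using h2 by unfold_locales
  interpret G: group G by fact
  interpret F: group_hom ?H G \<phi> using assms(13) by unfold_locales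
  have ones: "\<one>\<^bsub>aut_group T1\<^esub> = (\<lambda>v\<in>verts T1. v)" "\<one>\<^bsub>aut_group T2\<^esub> = (\<lambda>v\<in>verts T2. v)"
    by (simp_all add: aut_group_def BijGroup_def)
  have oneH: "\<one>\<^bsub>?H\<^esub> = (\<lambda>v\<in>verts T1. v, \<lambda>v\<in>verts T2. v)" using ones by simp
  interpret L1: lf_tree_action T1 ?H fst using assms(1,2) h1 by unfold_locales
  interpret L2: lf_tree_action T2 ?H snd using assms(3,4) h2 by unfold_locales
  have \<gamma>: "\<gamma>1 \<in> carrier ?H" "\<gamma>2 \<in> carrier ?H" using assms(10,11) by simp_all
  \<comment> \<open>Exponents congruent to 1 modulo the order are invisible to \<phi>; this turns
    noncommuting images into the assumption \<open>noncomm\<close>.\<close>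
  have pow: "\<phi> (g [^]\<^bsub>?H\<^esub> (group.ord G (\<phi> g) * a + 1)) = \<phi> g" if "g \<in> carrier ?H" for g and a :: nat
  proof -
    have "\<phi> (g [^]\<^bsub>?H\<^esub> (group.ord G (\<phi> g) * a + 1)) = \<phi> g [^]\<^bsub>G\<^esub> (group.ord G (\<phi> g) * a + 1)"
      using F.hom_nat_pow[OF that] .
    also have "\<dots> = (\<phi> g [^]\<^bsub>G\<^esub> group.ord G (\<phi> g)) [^]\<^bsub>G\<^esub> a \<otimes>\<^bsub>G\<^esub> \<phi> g"
      using F.hom_closed[OF that] by (simp only: G.nat_pow_pow Suc_eq_plus1[symmetric] nat_pow_Suc)
    also have "\<dots> = \<phi> g" using F.hom_closed[OF that] by simp
    finally show ?thesis .
  qed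
  interpret anti_torus_pair T1 T2 ?H fst snd \<gamma>1 \<gamma>2 x1 x2 ?q1 ?q2
  proof
    have e: "(\<lambda>v\<in>verts T1. v, \<lambda>v\<in>verts T2. v) \<in> \<Gamma>" using H.one_closed unfolding oneH by simp
    obtain F1 F2 where F: "finite F1" "F1 \<subseteq> verts T1" "finite F2" "F2 \<subseteq> verts T2"
      "\<And>g. g \<in> \<Gamma> \<Longrightarrow> (\<And>v. v \<in> F1 \<Longrightarrow> fst g v = v) \<Longrightarrow> (\<And>v. v \<in> F2 \<Longrightarrow> snd g v = v) \<Longrightarrow> g = \<one>\<^bsub>?H\<^esub>"
      unfolding oneH by (rule discrete_subgroup_trivial_fixator[OF disc sub' e]) blast
    have "g = \<one>\<^bsub>?H\<^esub>" if "g \<in> L1.fixator F1" "g \<in> L2.fixator F2" for g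
      by (rule F(5)) (use that in \<open>simp_all add: L1.fixator_iff L2.fixator_iff\<close>)
    then have "L1.fixator F1 \<inter> L2.fixator F2 \<subseteq> {\<one>\<^bsub>?H\<^esub>}" by blast
    then show "\<exists>F1 F2. finite F1 \<and> F1 \<subseteq> verts T1 \<and> finite F2 \<and> F2 \<subseteq> verts T2 \<and>
        L1.fixator F1 \<inter> L2.fixator F2 \<subseteq> {\<one>\<^bsub>?H\<^esub>}"
      using F by blast
    show "\<gamma>1 [^]\<^bsub>?H\<^esub> (?q1 * a + 1) \<otimes>\<^bsub>?H\<^esub> \<gamma>2 [^]\<^bsub>?H\<^esub> (?q2 * b + 1)
      \<noteq> \<gamma>2 [^]\<^bsub>?H\<^esub> (?q2 * b + 1) \<otimes>\<^bsub>?H\<^esub> \<gamma>1 [^]\<^bsub>?H\<^esub> (?q1 * a + 1)" (is "?a \<otimes>\<^bsub>?H\<^esub> ?b \<noteq> _") for a b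
    proof
      assume "?a \<otimes>\<^bsub>?H\<^esub> ?b = ?b \<otimes>\<^bsub>?H\<^esub> ?a"
      then have "\<phi> (?a \<otimes>\<^bsub>?H\<^esub> ?b) = \<phi> (?b \<otimes>\<^bsub>?H\<^esub> ?a)" by (rule arg_cong)
      then have "\<phi> ?a \<otimes>\<^bsub>G\<^esub> \<phi> ?b = \<phi> ?b \<otimes>\<^bsub>G\<^esub> \<phi> ?a"
        unfolding F.hom_mult[OF H.nat_pow_closed[OF \<gamma>(1)] H.nat_pow_closed[OF \<gamma>(2)]]
          F.hom_mult[OF H.nat_pow_closed[OF \<gamma>(2)] H.nat_pow_closed[OF \<gamma>(1)]] .
      then show False using assms(14) unfolding pow[OF \<gamma>(1)] pow[OF \<gamma>(2)] by blast
    qed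
  qed (use assms \<gamma> in simp_all)
  interpret S: anti_torus_pair T2 T1 ?H snd fst \<gamma>2 \<gamma>1 x2 x1 ?q2 ?q1 by (rule swap_anti_torus_pair)
  have act: "product_action T1 T2 = pair_act"
    by (intro ext) (simp only: product_action_def pair_act_def)
  have powA: "g [^]\<^bsub>?H\<^esub> (n::nat) = g [^]\<^bsub>?A\<^esub> n" for g n by (simp add: nat_pow_def)
  have 1: "\<exists>(m::nat) (n::nat) P.
      anti_torus (realization T1 \<times> realization T2) (prod_dist (rdist T1) (rdist T2))
        \<Gamma> (product_action T1 T2) (\<gamma>1 [^]\<^bsub>?A\<^esub> m) (\<gamma>2 [^]\<^bsub>?A\<^esub> n) P"
    using anti_torus_exists unfolding act powA by simp
  have 2: "irreducible_lattice T1 T2 \<Gamma>"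
    unfolding irreducible_lattice_def
  proof clarify
    fix \<Lambda>1 \<Lambda>2
    assume L: "subgroup \<Lambda>1 (aut_group T1)" "subgroup \<Lambda>2 (aut_group T2)" "\<Lambda>1 \<times> \<Lambda>2 \<subseteq> \<Gamma>"
      "finite (rcosets\<^bsub>?H\<^esub> (\<Lambda>1 \<times> \<Lambda>2))"
    show False
    proof (rule no_split_finite_index)
      have "subgroup (\<Lambda>1 \<times> \<Lambda>2) ?A"
        by (rule DirProd_subgroups) (use L group_aut_group in auto)
      then show "subgroup (\<Lambda>1 \<times> \<Lambda>2) ?H"
        using group.subgroup_incl[OF gA _ sub L(3)] by blast
      fix g assume "g \<in> \<Lambda>1 \<times> \<Lambda>2"
      \<comment> \<open>The identity lies in \<open>\<Lambda>2\<close>, so the first component of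
        \<open>g\<close> alone belongs to the product, hence to \<Gamma>.\<close>
      then have "(fst g, \<one>\<^bsub>aut_group T2\<^esub>) \<in> \<Gamma>" using L(3) subgroup.one_closed[OF L(2)] by auto
      then show "\<exists>h\<in>carrier ?H. (\<forall>v\<in>verts T1. fst h v = fst g v) \<and> (\<forall>v\<in>verts T2. snd h v = v)"
        by (intro bexI[of _ "(fst g, \<one>\<^bsub>aut_group T2\<^esub>)"]) (simp_all add: ones)
    qed (use L in blast)
  qed
  have 3: "group.ord (aut_group T1) (fst \<gamma>1) = 0"
    unfolding Aut1.ord_eq_0[OF P1.hom_closed[OF \<gamma>(1)]]
  proof (intro allI impI notI)
    fix n :: nat assume "n \<noteq> 0" "fst \<gamma>1 [^]\<^bsub>aut_group T1\<^esub> n = \<one>\<^bsub>aut_group T1\<^esub>"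
    then have "fst (\<gamma>1 [^]\<^bsub>?H\<^esub> n) = (\<lambda>v\<in>verts T1. v)" using P1.hom_nat_pow[OF \<gamma>(1)] ones by simp
    then show False using infinite_order[of n] \<open>n \<noteq> 0\<close> by auto
  qed
  have 4: "group.ord (aut_group T2) (snd \<gamma>2) = 0"
    unfolding Aut2.ord_eq_0[OF P2.hom_closed[OF \<gamma>(2)]]
  proof (intro allI impI notI)
    fix n :: nat assume "n \<noteq> 0" "snd \<gamma>2 [^]\<^bsub>aut_group T2\<^esub> n = \<one>\<^bsub>aut_group T2\<^esub>"
    then have "snd (\<gamma>2 [^]\<^bsub>?H\<^esub> n) = (\<lambda>v\<in>verts T2. v)" using P2.hom_nat_pow[OF \<gamma>(2)] ones by simp
    then show False using S.infinite_order[of n] \<open>n \<noteq> 0\<close> by auto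
  qed
  show ?thesis using 1 2 3 4 by blast
qed

end
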